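(* Let $\mathbf{S}\subset\mathbb{R}^n$, $\mathbf{B}\subset\mathbb{R}^m$, $f:\mathbb{R}^n\to\mathbb{R}^m$, $\mathbf{F}=f(\mathbf{S})\subset\mathbf{B}$, $\mathbf{K}=\mathbf{S}\times\mathbf{B}$, $h_f$, $h$, the semidefinite programs $(P_r)$, $(D_r)$ with values $p_r^*$, $d_r^*$, and the integer $r^{(1)}_{\min}$ be as in the context. Suppose that one of the polynomials $g_j^{\mathbf{S}}$ is $N^{\mathbf{S}}-\|\mathbf{x}\|_2^2$ and one of the polynomials $g_j^{\mathbf{B}}$ is $N^{\mathbf{B}}-\|\mathbf{y}\|_2^2$, for some positive integers $N^{\mathbf{S}},N^{\mathbf{B}}$. Let $r\ge r^{(1)}_{\min}$. Then: 1. $p_r^*=d_r^*$, i.e. there is no duality gap between $(P_r)$ and its dual $(D_r)$. 2. The program $(D_r)$ has an optimal solution. In addition, if $\mathbf{S}$ has nonempty interior, then the program $(P_r)$ has an optimal solution $q_r\in\mathbb{R}_{2r}[\mathbf{y}]$, and the sequence $(q_r)_r$ of such optimal solutions converges to $h$ in $L_1$ norm on $\mathbf{B}$: $$\lim_{r\to\infty}\int |q_r(\mathbf{y})-h(\mathbf{y})|\,\lambda_{\mathbf{B}}(d\mathbf{y})=0.$$ 3. (With $\mathbf{S}$ having nonempty interior, so that $q_r$ exists.) Defining $\mathbf{F}^1_r:=\{\mathbf{y}\in\mathbf{B}: q_r(\mathbf{y})\ge 0\}$, it holds that $\mathbf{F}^1_r\supset\mathbf{F}$ and $$\lim_{r\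to\infty}\operatorname{vol}(\mathbf{F}^1_r\setminus\mathbf{F})=0.$$
   Context: Setting. $f=(f_1,\dots,f_m):\mathbb{R}^n\to\mathbb{R}^m$ is a polynomial map, $d:=\max_j\deg f_j$. $\mathbf{S}=\{\mathbf{x}\in\mathbb{R}^n: g_1^{\mathbf{S}}(\mathbf{x})\ge0,\dots,g_{n^{\mathbf{S}}}^{\mathbf{S}}(\mathbf{x})\ge0\}$ is a nonempty compact basic semi-algebraic set, and $\mathbf{B}=\{\mathbf{y}\in\mathbb{R}^m: g_1^{\mathbf{B}}(\mathbf{y})\ge0,\dots,g_{n^{\mathbf{B}}}^{\mathbf{B}}(\mathbf{y})\ge0\}$ is a compact basic semi-algebraic set (all $g$'s real polynomials) with $\mathbf{F}:=f(\mathbf{S})\subset\mathbf{B}$. $\lambda_{\mathbf{B}}$ is the restriction of Lebesgue measure to $\mathbf{B}$, $\operatorname{vol}$ is Lebesgue measure on $\mathbb{R}^m$, and $z^{\mathbf{B}}_\beta:=\int\mathbf{y}^\beta\,\lambda_{\mathbf{B}}(d\mathbf{y})$ for $\beta\in\mathbb{N}^m$. $\mathbb{N}^k_r:=\{\alpha\in\mathbb{N}^k:\sum_i\alpha_i\le r\}$; $\mathbb{R}_{2r}[\cdot]$ denotes polynomials of degree at most $2r$; $\Sigma_r[\cdot]$ denotes sums of squares of polynomials having degree at most $2r$. Functions: $h_f(\mathbf{x},\mathbf{y}):=-\|\mathbf{y}-f(\mathbf{x})\|_2^2$ and $h(\mathbf{y}):=\sup_{\mathbf{x}\in\mathbf{S}}h_f(\mathbf{x},\mathbf{y})$.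 Product set: $\mathbf{K}:=\mathbf{S}\times\mathbf{B}$ is described by $g_1,\dots,g_{n^{\mathbf{K}}}\in\mathbb{R}[\mathbf{x},\mathbf{y}]$, $n^{\mathbf{K}}=n^{\mathbf{S}}+n^{\mathbf{B}}$, where $g_1,\dots,g_{n^{\mathbf{S}}}$ are the $g_j^{\mathbf{S}}(\mathbf{x})$ and $g_{n^{\mathbf{S}}+1},\dots,g_{n^{\mathbf{K}}}$ are the $g_j^{\mathbf{B}}(\mathbf{y})$; $g_0:=1$; $r_j^{\mathbf{K}}:=\lceil(\deg g_j)/2\rceil$. Truncated quadratic module: $\mathbf{Q}_r(\mathbf{K}):=\{\sum_{j=0}^{n^{\mathbf{K}}}s_jg_j: s_j\in\Sigma_{r-r_j^{\mathbf{K}}}[\mathbf{x},\mathbf{y}]\}$ (with $r_0^{\mathbf{K}}=0$). $r^{(1)}_{\min}:=\max\{d,r_1^{\mathbf{K}},\dots,r_{n^{\mathbf{K}}}^{\mathbf{K}}\}$. Moment and localizing matrices: for a real sequence $\mathbf{z}=(z_{\alpha\beta})_{(\alpha,\beta)\in\mathbb{N}^{n+m}_{2r}}$ let $\ell_{\mathbf{z}}(p):=\sum p_{\alpha\beta}z_{\alpha\beta}$ for $p=\sum p_{\alpha\beta}\mathbf{x}^\alpha\mathbf{y}^\beta$ of degree at most $2r$. For a polynomial $q$, $\mathbf{M}_k(q\mathbf{z})$ is the symmetric matrix indexed by $\mathbb{N}^{n+m}_k$ with entries $\ell_{\mathbf{z}}(q\,\mathbf{x}^{\alpha+\delta}\mathbf{y}^{\beta+\gamma})$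 at position $((\alpha,\beta),(\delta,\gamma))$; $\mathbf{M}_k(\mathbf{z}):=\mathbf{M}_k(1\cdot\mathbf{z})$. $\succeq0$ means positive semidefinite. Programs: $$(P_r)\quad p_r^*:=\inf_{q\in\mathbb{R}_{2r}[\mathbf{y}]}\Big\{\sum_{\beta\in\mathbb{N}^m_{2r}}q_\beta z^{\mathbf{B}}_\beta:\ q-h_f\in\mathbf{Q}_r(\mathbf{K})\Big\},$$ $$(D_r)\quad d_r^*:=\sup_{\mathbf{z}}\Big\{\ell_{\mathbf{z}}(h_f):\ \mathbf{M}_r(\mathbf{z})\succeq0,\ \mathbf{M}_{r-r_j^{\mathbf{K}}}(g_j\mathbf{z})\succeq0\ (j=1,\dots,n^{\mathbf{K}}),\ \ell_{\mathbf{z}}(\mathbf{y}^\beta)=z^{\mathbf{B}}_\beta\ \forall\beta\in\mathbb{N}^m_{2r}\Big\}.$$ *)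

theory Defs
  imports "HOL-Analysis.Analysis" "HOL-Library.Poly_Mapping"
begin

section \<open>Real polynomials in finitely many variables\<close>

type_synonym 'v mpoly = "('v \<Rightarrow>\<^sub>0 nat) \<Rightarrow>\<^sub>0 real"

definition mono_deg :: "('v::finite \<Rightarrow>\<^sub>0 nat) \<Rightarrow> nat" where
  "mono_deg \<alpha> = (\<Sum>i\<in>UNIV. Poly_Mapping.lookup \<alpha> i)"

definition exponents :: "nat \<Rightarrow> ('v::finite \<Rightarrow>\<^sub>0 nat) set" where
  "exponents k = {\<alpha>. mono_deg \<alpha> \<le> k}"

definition mono_eval :: "('v::finite \<Rightarrow>\<^sub>0 nat) \<Rightarrow> real ^ 'v \<Rightarrow> real" where
  "mono_eval \<alpha> x = (\<Prod>i\<in>UNIV. (x $ i) ^ Poly_Mapping.lookup \<alpha> i)"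

(* The zero polynomial gets degree 0. *)
definition mpoly_deg :: "('v::finite) mpoly \<Rightarrow> nat" where
  "mpoly_deg p = Max (insert 0 (mono_deg ` Poly_Mapping.keys p))"

definition mpoly_eval :: "('v::finite) mpoly \<Rightarrow> real ^ 'v \<Rightarrow> real" where
  "mpoly_eval p x = (\<Sum>\<alpha>\<in>Poly_Mapping.keys p. Poly_Mapping.lookup p \<alpha> * mono_eval \<alpha> x)"

definition Var :: "'v \<Rightarrow> 'v mpoly" where
  "Var i = Poly_Mapping.single (Poly_Mapping.single i 1) 1"

definition rename_mono :: "('v::finite \<Rightarrow> 'w) \<Rightarrow> ('v \<Rightarrow>\<^sub>0 nat) \<Rightarrow> ('w \<Rightarrow>\<^sub>0 nat)" where
  "rename_mono \<sigma> \<alpha> = (\<Sum>i\<in>UNIV. Poly_Mapping.single (\<sigma> i) (Poly_Mapping.lookup \<alpha> i))"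

(* With \<sigma> = Inl and \<sigma> = Inr this is the inclusion of R[x] and R[y] into R[x,y], the
   variables of R[x,y] being indexed by the sum type 'n + 'm. *)
definition rename :: "('v::finite \<Rightarrow> 'w) \<Rightarrow> 'v mpoly \<Rightarrow> 'w mpoly" where
  "rename \<sigma> p = (\<Sum>\<alpha>\<in>Poly_Mapping.keys p. Poly_Mapping.single (rename_mono \<sigma> \<alpha>) (Poly_Mapping.lookup p \<alpha>))"

section \<open>Sets, polynomial maps and the functions hf and h\<close>

definition basic_semialg :: "('v::finite) mpoly list \<Rightarrow> (real ^ 'v) set" where
  "basic_semialg gs = {x. \<forall>g\<in>set gs. mpoly_eval g x \<ge> 0}"

definition ball_poly :: "nat \<Rightarrow> ('v::finite) mpoly" where
  "ball_poly N = of_nat N - (\<Sum>i\<in>UNIV. Var i ^ 2)"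

definition poly_map :: "('m \<Rightarrow> 'n mpoly) \<Rightarrow> real ^ ('n::finite) \<Rightarrow> real ^ ('m::finite)" where
  "poly_map f x = (\<chi> j. mpoly_eval (f j) x)"

definition map_deg :: "('m::finite \<Rightarrow> ('n::finite) mpoly) \<Rightarrow> nat" where
  "map_deg f = Max (range (\<lambda>j. mpoly_deg (f j)))"

definition hf_fun :: "('m::finite \<Rightarrow> ('n::finite) mpoly) \<Rightarrow> real ^ 'n \<Rightarrow> real ^ 'm \<Rightarrow> real" where
  "hf_fun f x y = - (norm (y - poly_map f x))\<^sup>2"

definition h_fun :: "('m::finite \<Rightarrow> ('n::finite) mpoly) \<Rightarrow> (real ^ 'n) set \<Rightarrow> real ^ 'm \<Rightarrow> real" where
  "h_fun f S y = (SUP x\<in>S. hf_fun f x y)"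

(* The function hf_fun as an element of R[x,y]; see mpoly_eval_hf_poly. *)
definition hf_poly :: "('m::finite \<Rightarrow> ('n::finite) mpoly) \<Rightarrow> ('n + 'm) mpoly" where
  "hf_poly f = - (\<Sum>j\<in>UNIV. (Var (Inr j) - rename Inl (f j)) ^ 2)"

section \<open>Truncated quadratic module\<close>

definition half_deg :: "('v::finite) mpoly \<Rightarrow> nat" where
  "half_deg g = nat \<lceil>real (mpoly_deg g) / 2\<rceil>"

definition prod_constraints ::
  "('n::finite) mpoly list \<Rightarrow> ('m::finite) mpoly list \<Rightarrow> ('n + 'm) mpoly list" where
  "prod_constraints gS gB = map (rename Inl) gS @ map (rename Inr) gB"

definition SOS :: "nat \<Rightarrow> ('v::finite) mpoly set" where
  "SOS r = {p. mpoly_deg p \<le> 2 * r \<and> (\<exists>qs. p = (\<Sum>q\<leftarrow>qs. q ^ 2))}"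

(* The natural number subtraction is exact for all r that are at least min_order. *)
definition quad_module :: "('v::finite) mpoly list \<Rightarrow> nat \<Rightarrow> 'v mpoly set" where
  "quad_module gs r =
     {\<Sum>j\<le>length gs. s j * (1 # gs) ! j | s.
        \<forall>j\<le>length gs. s j \<in> SOS (r - half_deg ((1 # gs) ! j))}"

definition min_order ::
  "('m::finite \<Rightarrow> ('n::finite) mpoly) \<Rightarrow> 'n mpoly list \<Rightarrow> 'm mpoly list \<Rightarrow> nat" where
  "min_order f gS gB =
     Max (insert (map_deg f) (half_deg ` set (prod_constraints gS gB)))"

section \<open>Moment and localizing matrices\<close>

definition riesz :: "(('v \<Rightarrow>\<^sub>0 nat) \<Rightarrow> real) \<Rightarrow> 'v mpoly \<Rightarrow> real" where
  "riesz z p = (\<Sum>\<alpha>\<in>Poly_Mapping.keys p. Poly_Mapping.lookup p \<alpha> * z \<alpha>)"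

definition loc_matrix ::
  "'v mpoly \<Rightarrow> (('v \<Rightarrow>\<^sub>0 nat) \<Rightarrow> real) \<Rightarrow> ('v \<Rightarrow>\<^sub>0 nat) \<Rightarrow> ('v \<Rightarrow>\<^sub>0 nat) \<Rightarrow> real" where
  "loc_matrix q z \<alpha> \<delta> = riesz z (q * Poly_Mapping.single (\<alpha> + \<delta>) 1)"

definition psd_on :: "'i set \<Rightarrow> ('i \<Rightarrow> 'i \<Rightarrow> real) \<Rightarrow> bool" where
  "psd_on I M \<longleftrightarrow>
     (\<forall>i\<in>I. \<forall>j\<in>I. M i j = M j i) \<and>
     (\<forall>v. 0 \<le> (\<Sum>i\<in>I. \<Sum>j\<in>I. v i * M i j * v j))"

definition leb_moment :: "(real ^ ('m::finite)) set \<Rightarrow> ('m \<Rightarrow>\<^sub>0 nat) \<Rightarrow> real" where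
  "leb_moment B \<beta> = (\<integral>y. mono_eval \<beta> y \<partial>lebesgue_on B)"

section \<open>The semidefinite programs\<close>

definition primal_feasible ::
  "('m::finite \<Rightarrow> ('n::finite) mpoly) \<Rightarrow> 'n mpoly list \<Rightarrow> 'm mpoly list \<Rightarrow> nat \<Rightarrow> 'm mpoly set" where
  "primal_feasible f gS gB r =
     {q. mpoly_deg q \<le> 2 * r \<and>
         rename Inr q - hf_poly f \<in> quad_module (prod_constraints gS gB) r}"

definition primal_objective :: "('m::finite) mpoly list \<Rightarrow> nat \<Rightarrow> 'm mpoly \<Rightarrow> real" where
  "primal_objective gB r q =
     (\<Sum>\<beta>\<in>exponents (2 * r). Poly_Mapping.lookup q \<beta> * leb_moment (basic_semialg gB) \<beta>)"

definition primal_value ::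
  "('m::finite \<Rightarrow> ('n::finite) mpoly) \<Rightarrow> 'n mpoly list \<Rightarrow> 'm mpoly list \<Rightarrow> nat \<Rightarrow> ereal" where
  "primal_value f gS gB r =
     (INF q\<in>primal_feasible f gS gB r. ereal (primal_objective gB r q))"

definition primal_optimal ::
  "('m::finite \<Rightarrow> ('n::finite) mpoly) \<Rightarrow> 'n mpoly list \<Rightarrow> 'm mpoly list \<Rightarrow> nat \<Rightarrow> 'm mpoly \<Rightarrow> bool" where
  "primal_optimal f gS gB r q \<longleftrightarrow>
     q \<in> primal_feasible f gS gB r \<and>
     ereal (primal_objective gB r q) = primal_value f gS gB r"

(* A sequence indexed by the exponents of degree at most 2r is a function that is undefined
   (in the sense of extensional) at all other exponents. For r at least min_order, riesz is
   applied below only to polynomials of degree at most 2r. *)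
definition dual_feasible ::
  "('n::finite) mpoly list \<Rightarrow> ('m::finite) mpoly list \<Rightarrow> nat \<Rightarrow> (('n + 'm \<Rightarrow>\<^sub>0 nat) \<Rightarrow> real) set" where
  "dual_feasible gS gB r =
     {z \<in> extensional (exponents (2 * r)).
        psd_on (exponents r) (loc_matrix 1 z) \<and>
        (\<forall>g\<in>set (prod_constraints gS gB). psd_on (exponents (r - half_deg g)) (loc_matrix g z)) \<and>
        (\<forall>\<beta>\<in>exponents (2 * r).
           riesz z (Poly_Mapping.single (rename_mono Inr \<beta>) 1) = leb_moment (basic_semialg gB) \<beta>)}"

definition dual_value ::
  "('m::finite \<Rightarrow> ('n::finite) mpoly) \<Rightarrow> 'n mpoly list \<Rightarrow> 'm mpoly list \<Rightarrow> nat \<Rightarrow> ereal" where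
  "dual_value f gS gB r = (SUP z\<in>dual_feasible gS gB r. ereal (riesz z (hf_poly f)))"

definition dual_optimal ::
  "('m::finite \<Rightarrow> ('n::finite) mpoly) \<Rightarrow> 'n mpoly list \<Rightarrow> 'm mpoly list \<Rightarrow> nat \<Rightarrow>
   (('n + 'm \<Rightarrow>\<^sub>0 nat) \<Rightarrow> real) \<Rightarrow> bool" where
  "dual_optimal f gS gB r z \<longleftrightarrow>
     z \<in> dual_feasible gS gB r \<and> ereal (riesz z (hf_poly f)) = dual_value f gS gB r"

section \<open>Basic facts confirming the encoding\<close>

lemma finite_exponents: "finite (exponents k :: ('v::finite \<Rightarrow>\<^sub>0 nat) set)"
proof -
  have "Poly_Mapping.lookup ` (exponents k :: ('v \<Rightarrow>\<^sub>0 nat) set) \<subseteq> UNIV \<rightarrow>\<^sub>E {..k}"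
  proof -
    have "Poly_Mapping.lookup \<alpha> i \<le> mono_deg \<alpha>" for \<alpha> :: "'v \<Rightarrow>\<^sub>0 nat" and i
      unfolding mono_deg_def by (rule member_le_sum) auto
    then have "Poly_Mapping.lookup \<alpha> i \<le> k"
      if "\<alpha> \<in> exponents k" for \<alpha> :: "'v \<Rightarrow>\<^sub>0 nat" and i
      using that unfolding exponents_def mem_Collect_eq by (metis le_trans)
    then show ?thesis
      by (simp add: image_subset_iff PiE_def Pi_def)
  qed
  moreover have "finite (UNIV \<rightarrow>\<^sub>E {..k} :: ('v \<Rightarrow> nat) set)"
    by (intro finite_PiE) auto
  ultimately have "finite (Poly_Mapping.lookup ` (exponents k :: ('v \<Rightarrow>\<^sub>0 nat) set))"
    by (rule finite_subset)
  then show ?thesis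
    by (rule finite_imageD) (simp add: inj_on_def lookup_inject)
qed

lemma mono_eval_add: "mono_eval (\<alpha> + \<beta>) x = mono_eval \<alpha> x * mono_eval \<beta> x"
  by (simp add: mono_eval_def lookup_add power_add prod.distrib)

lemma mono_eval_zero [simp]: "mono_eval 0 x = 1"
  by (simp add: mono_eval_def)

lemma mpoly_eval_superset:
  assumes "finite A" "Poly_Mapping.keys p \<subseteq> A"
  shows "mpoly_eval p x = (\<Sum>\<alpha>\<in>A. Poly_Mapping.lookup p \<alpha> * mono_eval \<alpha> x)"
  unfolding mpoly_eval_def using assms
  by (intro sum.mono_neutral_left) (auto simp: in_keys_iff)

lemma mpoly_eval_zero [simp]: "mpoly_eval 0 x = 0"
  by (simp add: mpoly_eval_def)

lemma mpoly_eval_add: "mpoly_eval (p + q) x = mpoly_eval p x + mpoly_eval q x"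
proof -
  have A: "finite (Poly_Mapping.keys p \<union> Poly_Mapping.keys q)" by simp
  show ?thesis
    using mpoly_eval_superset[OF A, of p x] mpoly_eval_superset[OF A, of q x]
      mpoly_eval_superset[OF A, of "p + q" x] keys_add[of p q]
    by (simp add: lookup_add algebra_simps sum.distrib)
qed

lemma mpoly_eval_uminus: "mpoly_eval (- p) x = - mpoly_eval p x"
  using mpoly_eval_add[of p "- p" x] by simp

lemma mpoly_eval_diff: "mpoly_eval (p - q) x = mpoly_eval p x - mpoly_eval q x"
  using mpoly_eval_add[of "p - q" q x] by simp

lemma mpoly_eval_sum: "mpoly_eval (sum p A) x = (\<Sum>i\<in>A. mpoly_eval (p i) x)"
  by (induction A rule: infinite_finite_induct) (simp_all add: mpoly_eval_add)

lemma mpoly_eval_single [simp]: "mpoly_eval (Poly_Mapping.single \<alpha> c) x = c * mono_eval \<alpha> x"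
  by (simp add: mpoly_eval_def)

lemma mpoly_expand: "p = (\<Sum>\<alpha>\<in>Poly_Mapping.keys p. Poly_Mapping.single \<alpha> (Poly_Mapping.lookup p \<alpha>))"
proof (rule poly_mapping_eqI)
  fix \<alpha>
  show "Poly_Mapping.lookup p \<alpha> = Poly_Mapping.lookup (\<Sum>\<alpha>\<in>Poly_Mapping.keys p. Poly_Mapping.single \<alpha> (Poly_Mapping.lookup p \<alpha>)) \<alpha>"
    by (simp add: lookup_sum lookup_single when_def in_keys_iff)
qed

lemma mpoly_eval_mult: "mpoly_eval (p * q) x = mpoly_eval p x * mpoly_eval q x"
proof -
  have "p * q = (\<Sum>\<alpha>\<in>Poly_Mapping.keys p. Poly_Mapping.single \<alpha> (Poly_Mapping.lookup p \<alpha>)) *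
      (\<Sum>\<beta>\<in>Poly_Mapping.keys q. Poly_Mapping.single \<beta> (Poly_Mapping.lookup q \<beta>))"
    using mpoly_expand[of p] mpoly_expand[of q] by (rule arg_cong2)
  then have "mpoly_eval (p * q) x = (\<Sum>\<alpha>\<in>Poly_Mapping.keys p. \<Sum>\<beta>\<in>Poly_Mapping.keys q.
      (Poly_Mapping.lookup p \<alpha> * mono_eval \<alpha> x) * (Poly_Mapping.lookup q \<beta> * mono_eval \<beta> x))"
    by (simp add: sum_product mult_single mpoly_eval_sum mono_eval_add mult_ac)
  then show ?thesis
    by (simp add: mpoly_eval_def sum_product)
qed

lemma mpoly_eval_of_nat: "mpoly_eval (of_nat n) x = real n"
  by (simp flip: single_of_nat)

lemma mpoly_eval_one: "mpoly_eval 1 x = 1"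
  using mpoly_eval_of_nat[of 1 x] by simp

lemma mpoly_eval_power: "mpoly_eval (p ^ k) x = mpoly_eval p x ^ k"
  by (induction k) (simp_all add: mpoly_eval_one mpoly_eval_mult)

lemma mpoly_eval_Var: "mpoly_eval (Var i) x = x $ i"
proof -
  have "mono_eval (Poly_Mapping.single i 1) x = (\<Prod>j\<in>UNIV. if i = j then x $ j else 1)"
    unfolding mono_eval_def by (intro prod.cong) (auto simp: lookup_single when_def)
  then show ?thesis
    by (simp add: Var_def)
qed

lemma mono_eval_sum: "mono_eval (sum \<alpha> A) x = (\<Prod>i\<in>A. mono_eval (\<alpha> i) x)"
  by (induction A rule: infinite_finite_induct) (simp_all add: mono_eval_add)

lemma mono_eval_single: "mono_eval (Poly_Mapping.single i k) x = (x $ i) ^ k"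
proof -
  have "mono_eval (Poly_Mapping.single i k) x = (\<Prod>j\<in>UNIV. if i = j then (x $ j) ^ k else 1)"
    unfolding mono_eval_def by (intro prod.cong) (auto simp: lookup_single when_def)
  then show ?thesis
    by simp
qed

lemma mpoly_eval_rename: "mpoly_eval (rename \<sigma> p) x = mpoly_eval p (\<chi> i. x $ \<sigma> i)"
proof -
  have "mono_eval (rename_mono \<sigma> \<alpha>) x = mono_eval \<alpha> (\<chi> i. x $ \<sigma> i)" for \<alpha>
    unfolding rename_mono_def mono_eval_sum mono_eval_single by (simp add: mono_eval_def)
  then show ?thesis
    by (simp add: rename_def mpoly_eval_sum mpoly_eval_def[of p])
qed

lemma mpoly_eval_ball_poly: "mpoly_eval (ball_poly N) x = real N - (norm x)\<^sup>2"
  by (simp add: ball_poly_def mpoly_eval_diff mpoly_eval_of_nat mpoly_eval_sum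
      mpoly_eval_power mpoly_eval_Var norm_vec_def L2_set_def sum_nonneg)

lemma mpoly_eval_hf_poly:
  "mpoly_eval (hf_poly f) w = hf_fun f (\<chi> i. w $ Inl i) (\<chi> j. w $ Inr j)"
  by (simp add: hf_poly_def hf_fun_def mpoly_eval_uminus mpoly_eval_diff mpoly_eval_sum
      mpoly_eval_power mpoly_eval_Var mpoly_eval_rename poly_map_def norm_vec_def
      L2_set_def sum_nonneg)

lemma basic_semialg_prod_constraints:
  "w \<in> basic_semialg (prod_constraints gS gB) \<longleftrightarrow>
     (\<chi> i. w $ Inl i) \<in> basic_semialg gS \<and> (\<chi> j. w $ Inr j) \<in> basic_semialg gB"
  by (simp add: basic_semialg_def prod_constraints_def mpoly_eval_rename ball_Un)

end

theory Submission
  imports Defs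
begin

text \<open>
  The value of the primal program, as a function of the polynomial that takes the place of
  \<open>hf_poly f\<close>, is a sublinear functional on the polynomials of degree at most \<open>2 r\<close>: by the two ball
  constraints the constants are order units modulo the truncated quadratic module. A linear
  functional below it that agrees with it at \<open>hf_poly f\<close> (Hahn--Banach) is dual feasible and closes
  the duality gap, so the dual is attained.

  If \<open>S\<close> has nonempty interior and \<open>B\<close> is not a null set, Lebesgue measure on \<open>S \<times> B\<close> gives a
  functional that is positive definite on squares times each nonzero constraint. Hence the Gram
  matrices along a minimising sequence are bounded and a subsequence converges to a minimiser. If
  \<open>B\<close> is null, the objective vanishes.

  Feasible polynomials dominate \<open>h\<close> on \<open>B\<close>, so the \<open>L\<^sub>1\<close> distance of \<open>q\<^sub>r\<close> to \<open>h\<close> is the optimal value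
  minus \<open>\<integral> h\<close>. It tends to zero because a polynomial slightly above the continuous function \<open>h\<close>
  becomes feasible by Putinar's Positivstellensatz, which is reduced to the positivity of Bernstein
  coefficients on a box. Since \<open>h\<close> vanishes exactly on \<open>F\<close>, convergence of the volumes follows by
  Markov's inequality.
\<close>

text \<open>The first two assertions must hold even when \<open>S\<close> has no interior, so they
  cannot rest on a Slater point. The order unit replaces it: it makes every set of admissible
  polynomials nonempty and every objective bounded below, so the value functional is finite on the
  whole space of polynomials of degree at most \<open>2 * r\<close>, and that space has finite
  dimension.

  Compactness of Gram matrices meets two obstacles. \<open>SOS\<close> bounds the degree of a sum of
  squares but not of its summands, so it must be shown that leading terms of squares cannot cancel.
  And a moment functional given by integrals is positive definite only if a nonzero formal
  polynomial cannot vanish on a set of positive measure. The same fact lets polynomial identities be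
  checked pointwise.

  In the Positivstellensatz, a quadratic module is in general not closed under products, whereas
  Bernstein polynomials are products of the facets of a box. They are therefore formed inside the
  cone of the ball polynomial alone, which is closed under products; the other constraints enter
  only through a penalty term.\<close>

section \<open>Polynomials as a real algebra\<close>

instantiation poly_mapping :: (type, real_vector) real_vector
begin

lift_definition scaleR_poly_mapping :: "real \<Rightarrow> ('a \<Rightarrow>\<^sub>0 'b) \<Rightarrow> ('a \<Rightarrow>\<^sub>0 'b)"
  is "\<lambda>c f k. c *\<^sub>R f k"
  by (rule finite_subset) auto

instance
  by standard (transfer; simp add: fun_eq_iff algebra_simps)+

end

lemma lookup_scaleR [simp]: "Poly_Mapping.lookup (c *\<^sub>R p) k = c *\<^sub>R Poly_Mapping.lookup p k"
  by transfer simp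

text \<open>Scaling is multiplication by a constant polynomial, so the laws of a real algebra reduce
  to those of a commutative ring.\<close>

lemma scaleR_conv_mult:
  fixes p :: "'a::comm_monoid_add \<Rightarrow>\<^sub>0 'b::real_algebra_1"
  shows "c *\<^sub>R p = Poly_Mapping.single 0 (of_real c) * p"
proof -
  have "c *\<^sub>R p = Poly_Mapping.map ((*) (of_real c)) p"
    by (rule poly_mapping_eqI) (auto simp: map.rep_eq when_def of_real_def in_keys_iff)
  then show ?thesis
    by (simp add: mult_map_scale_conv_mult)
qed

instance poly_mapping :: (comm_monoid_add, "{real_algebra_1, comm_ring_1}") real_algebra_1
  by standard (simp_all add: scaleR_conv_mult mult_ac)

lemma scaleR_single: "c *\<^sub>R Poly_Mapping.single \<alpha> (a::real) = Poly_Mapping.single \<alpha> (c * a)"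
  by (rule poly_mapping_eqI) (simp add: lookup_single when_def)

lemma mpoly_eval_scaleR [simp]: "mpoly_eval (c *\<^sub>R p) x = c * mpoly_eval p x"
  by (simp add: scaleR_conv_mult mpoly_eval_mult)

lemma mpoly_eval_of_real [simp]: "mpoly_eval (of_real c) x = c"
  by (simp add: of_real_def mpoly_eval_one)

section \<open>Degrees\<close>

lemma mpoly_deg_le_iff: "mpoly_deg p \<le> k \<longleftrightarrow> Poly_Mapping.keys p \<subseteq> exponents k"
  unfolding mpoly_deg_def exponents_def by (subst Max_le_iff) auto

lemma mpoly_degD: "mpoly_deg p \<le> k \<Longrightarrow> \<alpha> \<in> Poly_Mapping.keys p \<Longrightarrow> mono_deg \<alpha> \<le> k"
  by (auto simp: mpoly_deg_le_iff exponents_def)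

lemma mpoly_degI: "(\<And>\<alpha>. \<alpha> \<in> Poly_Mapping.keys p \<Longrightarrow> mono_deg \<alpha> \<le> k) \<Longrightarrow> mpoly_deg p \<le> k"
  by (auto simp: mpoly_deg_le_iff exponents_def)

lemma mono_deg_add [simp]: "mono_deg (\<alpha> + \<beta>) = mono_deg \<alpha> + mono_deg \<beta>"
  by (simp add: mono_deg_def lookup_add sum.distrib)

lemma mono_deg_zero [simp]: "mono_deg 0 = 0"
  by (simp add: mono_deg_def)

lemma mono_deg_single [simp]: "mono_deg (Poly_Mapping.single i k) = k"
  by (simp add: mono_deg_def lookup_single when_def)

lemma mpoly_deg_zero [simp]: "mpoly_deg 0 = 0"
  by (simp add: mpoly_deg_def)

lemma mpoly_deg_one [simp]: "mpoly_deg 1 = 0"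
  by (simp add: mpoly_deg_def)

lemma mpoly_deg_single_le: "mpoly_deg (Poly_Mapping.single \<alpha> c) \<le> mono_deg \<alpha>"
  by (rule mpoly_degI) (auto split: if_splits)

lemma mpoly_deg_Var_le: "mpoly_deg (Var i) \<le> 1"
  using mpoly_deg_single_le[of "Poly_Mapping.single i 1" 1] by (simp add: Var_def)

lemma mpoly_deg_uminus [simp]: "mpoly_deg (- p) = mpoly_deg p"
proof -
  have "Poly_Mapping.keys (- p) = Poly_Mapping.keys p"
    by (auto simp: in_keys_iff)
  then show ?thesis
    by (simp add: mpoly_deg_def)
qed

lemma mpoly_deg_add_le: "mpoly_deg p \<le> k \<Longrightarrow> mpoly_deg q \<le> k \<Longrightarrow> mpoly_deg (p + q) \<le> k"
  using keys_add[of p q] by (fastforce simp: mpoly_deg_le_iff)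

lemma mpoly_deg_diff_le: "mpoly_deg p \<le> k \<Longrightarrow> mpoly_deg q \<le> k \<Longrightarrow> mpoly_deg (p - q) \<le> k"
  using mpoly_deg_add_le[of p k "- q"] by simp

lemma mpoly_deg_sum_le: "(\<And>i. i \<in> A \<Longrightarrow> mpoly_deg (p i) \<le> k) \<Longrightarrow> mpoly_deg (sum p A) \<le> k"
  by (induction A rule: infinite_finite_induct) (simp_all add: mpoly_deg_add_le)

lemma mpoly_deg_mult_le:
  assumes "mpoly_deg p \<le> j" "mpoly_deg q \<le> k" "j + k \<le> l"
  shows "mpoly_deg (p * q) \<le> l"
proof (rule mpoly_degI)
  fix \<gamma> assume "\<gamma> \<in> Poly_Mapping.keys (p * q)"
  then obtain \<alpha> \<beta> where "\<alpha> \<in> Poly_Mapping.keys p" "\<beta> \<in> Poly_Mapping.keys q" "\<gamma> = \<alpha> + \<beta>"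
    using keys_mult[of p q] by blast
  then show "mono_deg \<gamma> \<le> l"
    using mpoly_degD[OF assms(1)] mpoly_degD[OF assms(2)] assms(3) by (fastforce intro: order_trans add_mono)
qed

lemma mpoly_deg_power2_le: "mpoly_deg p \<le> k \<Longrightarrow> mpoly_deg (p ^ 2) \<le> 2 * k"
  by (auto simp: power2_eq_square intro: mpoly_deg_mult_le)

lemma mpoly_deg_scaleR_le: "mpoly_deg p \<le> k \<Longrightarrow> mpoly_deg (c *\<^sub>R p) \<le> k"
  by (auto simp: mpoly_deg_le_iff in_keys_iff)

lemma mpoly_deg_of_real [simp]: "mpoly_deg (of_real c) = 0"
  using mpoly_deg_scaleR_le[of 1 0 c] by (simp add: of_real_def)

lemma mpoly_deg_of_nat [simp]: "mpoly_deg (of_nat c) = 0"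
  using mpoly_deg_of_real[of "of_nat c"] by simp

lemma mpoly_deg_ball_poly: "mpoly_deg (ball_poly N) \<le> 2"
  unfolding ball_poly_def
  by (intro mpoly_deg_diff_le mpoly_deg_sum_le)
     (use mpoly_deg_power2_le[OF mpoly_deg_Var_le] in auto)

lemma mono_deg_sum: "mono_deg (sum \<alpha> A) = (\<Sum>i\<in>A. mono_deg (\<alpha> i))"
  by (induction A rule: infinite_finite_induct) simp_all

lemma mono_deg_rename_mono [simp]: "mono_deg (rename_mono \<sigma> \<alpha>) = mono_deg \<alpha>"
  by (simp add: rename_mono_def mono_deg_sum) (simp add: mono_deg_def)

lemma mpoly_deg_rename_le: "mpoly_deg p \<le> k \<Longrightarrow> mpoly_deg (rename \<sigma> p) \<le> k"
  unfolding rename_def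
  by (intro mpoly_deg_sum_le order_trans[OF mpoly_deg_single_le]) (simp add: mpoly_degD)

lemma half_deg_le_iff: "half_deg g \<le> k \<longleftrightarrow> mpoly_deg g \<le> 2 * k"
  unfolding half_deg_def by (auto simp: nat_le_iff ceiling_le_iff field_simps)

lemma half_deg_one [simp]: "half_deg 1 = 0"
  using half_deg_le_iff[of 1 0] by simp

lemma mpoly_deg_le_half_deg: "mpoly_deg g \<le> 2 * half_deg g"
  using half_deg_le_iff[of g "half_deg g"] by simp

section \<open>Leading terms of sums of squares\<close>

lemma lookup_mult_superset:
  fixes p q :: "'a::comm_monoid_add \<Rightarrow>\<^sub>0 'b::comm_ring_1"
  assumes "finite A" "Poly_Mapping.keys p \<subseteq> A" "finite B" "Poly_Mapping.keys q \<subseteq> B"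
  shows "Poly_Mapping.lookup (p * q) \<gamma> =
    (\<Sum>\<alpha>\<in>A. \<Sum>\<beta>\<in>B. (if \<alpha> + \<beta> = \<gamma> then Poly_Mapping.lookup p \<alpha> * Poly_Mapping.lookup q \<beta> else 0))"
proof -
  have expand: "r = (\<Sum>\<alpha>\<in>X. Poly_Mapping.single \<alpha> (Poly_Mapping.lookup r \<alpha>))"
    if "finite X" "Poly_Mapping.keys r \<subseteq> X" for r :: "'a \<Rightarrow>\<^sub>0 'b" and X
    using that
    by (intro poly_mapping_eqI) (auto simp: lookup_sum lookup_single when_def in_keys_iff)
  have "p * q = (\<Sum>\<alpha>\<in>A. \<Sum>\<beta>\<in>B. Poly_Mapping.single (\<alpha> + \<beta>)
          (Poly_Mapping.lookup p \<alpha> * Poly_Mapping.lookup q \<beta>))"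
    by (subst expand[OF assms(1,2)], subst expand[OF assms(3,4)])
       (simp add: sum_product mult_single)
  then show ?thesis
    by (simp add: lookup_sum lookup_single when_def)
qed

text \<open>The Euclidean inner product of exponent vectors. It serves twice: to single out an
  extreme point of a support, and as the degree in \<open>s\<close> that the monomial \<beta>
  acquires along the curve with coordinates \<open>s ^ \<alpha> i\<close>.\<close>

definition mono_inner :: "('v::finite \<Rightarrow>\<^sub>0 nat) \<Rightarrow> ('v \<Rightarrow>\<^sub>0 nat) \<Rightarrow> nat" where
  "mono_inner \<alpha> \<beta> = (\<Sum>i\<in>UNIV. Poly_Mapping.lookup \<alpha> i * Poly_Mapping.lookup \<beta> i)"

text \<open>Expand the squared distance of \<alpha> and \<beta>, which is positive.\<close>

lemma mono_inner_less:
  assumes "mono_inner \<beta> \<beta> \<le> mono_inner \<alpha> \<alpha>" "\<beta> \<noteq> \<alpha>"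
  shows "mono_inner \<beta> \<alpha> < mono_inner \<alpha> \<alpha>"
proof -
  let ?d = "\<lambda>i. real (Poly_Mapping.lookup \<alpha> i) - real (Poly_Mapping.lookup \<beta> i)"
  obtain i where "?d i \<noteq> 0"
    using assms(2) by (metis poly_mapping_eqI eq_iff_diff_eq_0 of_nat_eq_iff)
  then have "0 < (\<Sum>i\<in>UNIV. (?d i)\<^sup>2)"
    by (intro sum_pos2[of _ i]) auto
  also have "(\<Sum>i\<in>UNIV. (?d i)\<^sup>2) =
      real (mono_inner \<alpha> \<alpha>) + real (mono_inner \<beta> \<beta>) - 2 * real (mono_inner \<beta> \<alpha>)"
    by (simp add: mono_inner_def power2_diff sum.distrib sum_subtractf sum_distrib_left
        power2_eq_square algebra_simps)
  finally show ?thesis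
    using assms(1) by linarith
qed

text \<open>Among the exponents of top degree, one of maximal Euclidean norm is an extreme point of the
  support, so the coefficient of its double in a sum of squares is a sum of squares of
  coefficients and cannot cancel.\<close>

lemma mpoly_deg_le_if_sum_squares:
  assumes "mpoly_deg (\<Sum>q\<leftarrow>qs. q ^ 2) \<le> 2 * k" "q \<in> set qs"
  shows "mpoly_deg q \<le> k"
proof (rule ccontr)
  assume not_le: "\<not> mpoly_deg q \<le> k"
  let ?K = "\<Union>q\<in>set qs. Poly_Mapping.keys q"
  define D where "D = Max (mono_deg ` ?K)"
  let ?T = "{\<alpha>\<in>?K. mono_deg \<alpha> = D}"
  obtain \<alpha>0 where \<alpha>0: "\<alpha>0 \<in> Poly_Mapping.keys q" "k < mono_deg \<alpha>0"
    using not_le mpoly_degI[of q k] by (meson not_le_imp_less)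
  then have ne: "mono_deg ` ?K \<noteq> {}"
    using assms(2) by blast
  have fin: "finite ?K"
    by simp
  have D_ge: "mono_deg \<alpha> \<le> D" if "\<alpha> \<in> ?K" for \<alpha>
    unfolding D_def using fin that by (intro Max_ge) auto
  have "k < D"
    using \<alpha>0 assms(2) D_ge[of \<alpha>0] by (meson UN_I less_le_trans)
  have "D \<in> mono_deg ` ?K"
    unfolding D_def using ne fin by (intro Max_in) auto
  then have T: "?T \<noteq> {}" "finite ?T"
    using fin by auto
  obtain \<alpha> where \<alpha>: "\<alpha> \<in> ?T" and Max: "Max ((\<lambda>\<beta>. mono_inner \<beta> \<beta>) ` ?T) = mono_inner \<alpha> \<alpha>"
    by (rule obtains_MAX[OF T(2,1), of "\<lambda>\<beta>. mono_inner \<beta> \<beta>"])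
  have max: "mono_inner \<beta> \<beta> \<le> mono_inner \<alpha> \<alpha>" if "\<beta> \<in> ?T" for \<beta>
    unfolding Max[symmetric] using T(2) that by (intro Max_ge) auto
  \<comment> \<open>Comparing degrees puts both exponents into the top degree. If both differed from
    \<alpha>, their inner products with \<alpha> would add up to less than twice
    \<open>mono_inner \<alpha> \<alpha>\<close>, contrary to the equation.\<close>
  have unique: "\<beta> = \<alpha> \<and> \<gamma> = \<alpha>" if "\<beta> \<in> ?K" "\<gamma> \<in> ?K" "\<beta> + \<gamma> = \<alpha> + \<alpha>" for \<beta> \<gamma>
  proof -
    have "mono_deg \<beta> + mono_deg \<gamma> = D + D"
      using arg_cong[OF that(3), of mono_deg] \<alpha> by simp
    then have "\<beta> \<in> ?T" "\<gamma> \<in> ?T"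
      using D_ge[OF that(1)] D_ge[OF that(2)] that by auto
    then have le: "mono_inner \<beta> \<beta> \<le> mono_inner \<alpha> \<alpha>" "mono_inner \<gamma> \<gamma> \<le> mono_inner \<alpha> \<alpha>"
      using max by auto
    have "mono_inner \<beta> \<alpha> + mono_inner \<gamma> \<alpha> = mono_inner (\<beta> + \<gamma>) \<alpha>"
      by (simp add: mono_inner_def lookup_add sum.distrib algebra_simps)
    also have "\<dots> = mono_inner \<alpha> \<alpha> + mono_inner \<alpha> \<alpha>"
      unfolding that(3) by (simp add: mono_inner_def lookup_add sum.distrib algebra_simps)
    finally have "\<beta> = \<alpha> \<or> \<gamma> = \<alpha>"
      using mono_inner_less[OF le(1)] mono_inner_less[OF le(2)] by fastforce
    then show ?thesis
      using that(3) by auto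
  qed
  have sq: "Poly_Mapping.lookup (p ^ 2) (\<alpha> + \<alpha>) = (Poly_Mapping.lookup p \<alpha>)\<^sup>2" if "p \<in> set qs" for p
  proof -
    have sub: "Poly_Mapping.keys p \<subseteq> ?K"
      using that by blast
    have "Poly_Mapping.lookup (p * p) (\<alpha> + \<alpha>) = (\<Sum>\<beta>\<in>?K. \<Sum>\<gamma>\<in>?K.
        (if \<beta> + \<gamma> = \<alpha> + \<alpha> then Poly_Mapping.lookup p \<beta> * Poly_Mapping.lookup p \<gamma> else 0))"
      by (rule lookup_mult_superset[OF fin sub fin sub])
    also have "\<dots> = (\<Sum>\<beta>\<in>?K. \<Sum>\<gamma>\<in>?K. (if \<gamma> = \<alpha> then if \<beta> = \<alpha> then
        Poly_Mapping.lookup p \<alpha> * Poly_Mapping.lookup p \<alpha> else 0 else 0))"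
    proof (intro sum.cong refl)
      fix \<beta> \<gamma> assume "\<beta> \<in> ?K" "\<gamma> \<in> ?K"
      then show "(if \<beta> + \<gamma> = \<alpha> + \<alpha> then Poly_Mapping.lookup p \<beta> * Poly_Mapping.lookup p \<gamma> else 0) =
          (if \<gamma> = \<alpha> then if \<beta> = \<alpha> then Poly_Mapping.lookup p \<alpha> * Poly_Mapping.lookup p \<alpha> else 0 else 0)"
        using unique[of \<beta> \<gamma>] by (cases "\<beta> + \<gamma> = \<alpha> + \<alpha>") (simp only: if_True if_False, fastforce)+
    qed
    also have "\<dots> = Poly_Mapping.lookup p \<alpha> * Poly_Mapping.lookup p \<alpha>"
      using fin \<alpha> by (simp only: sum.delta) (simp del: UN_iff)
    finally show ?thesis
      by (simp add: power2_eq_square)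
  qed
  obtain p where p: "p \<in> set qs" "\<alpha> \<in> Poly_Mapping.keys p"
    using \<alpha> by auto
  have lookup_sum_list: "Poly_Mapping.lookup (\<Sum>q\<leftarrow>ps. q ^ 2) (\<alpha> + \<alpha>) =
      (\<Sum>q\<leftarrow>ps. (Poly_Mapping.lookup q \<alpha>)\<^sup>2)" if "set ps \<subseteq> set qs" for ps
    using that by (induction ps) (auto simp: lookup_add sq)
  have "(Poly_Mapping.lookup p \<alpha>)\<^sup>2 \<le> (\<Sum>q\<leftarrow>qs. (Poly_Mapping.lookup q \<alpha>)\<^sup>2)"
    using p(1) by (intro member_le_sum_list) auto
  moreover have "0 < (Poly_Mapping.lookup p \<alpha>)\<^sup>2"
    using p(2) by (simp add: in_keys_iff)
  ultimately have "Poly_Mapping.lookup (\<Sum>q\<leftarrow>qs. q ^ 2) (\<alpha> + \<alpha>) \<noteq> 0"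
    using lookup_sum_list[OF order_refl] by linarith
  then have "mono_deg (\<alpha> + \<alpha>) \<le> 2 * k"
    by (intro mpoly_degD[OF assms(1)]) (simp add: in_keys_iff)
  then show False
    using \<alpha> \<open>k < D\<close> by simp
qed

section \<open>Zero sets of polynomials\<close>

lemma real_polynomial_function_mpoly_eval [simp, intro]: "real_polynomial_function (mpoly_eval p)"
  unfolding mpoly_eval_def mono_eval_def
  by (intro real_polynomial_function_sum real_polynomial_function_prod real_polynomial_function_power
      real_polynomial_function.intros bounded_linear_vec_nth finite_keys finite)

lemma continuous_on_mpoly_eval: "continuous_on A (mpoly_eval p)"
  by (intro continuous_on_polymonial_function)
     (simp flip: real_polynomial_function_eq)

lemma closed_mpoly_zeros: "closed {x. mpoly_eval p x = 0}"
  by (intro closed_Collect_eq continuous_on_mpoly_eval continuous_on_const)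

text \<open>If \<open>\<alpha>\<close> is an exponent of \<open>p\<close> of maximal Euclidean norm, then along the curve
  \<open>s \<mapsto> (s ^ \<alpha> i)\<^sub>i\<close> the monomial of \<open>\<alpha>\<close> dominates all others, whatever the base point.\<close>

lemma mpoly_zeros_along_curve:
  fixes p :: "'v::finite mpoly"
  assumes "p \<noteq> 0"
  obtains v :: "real \<Rightarrow> real ^ 'v" and C :: real and D :: nat
  where "\<And>s. s \<in> {0..1} \<Longrightarrow> norm (v s) \<le> C"
    and "\<And>x. finite {s. mpoly_eval p (x + v s) = 0}"
    and "\<And>x. card {s. mpoly_eval p (x + v s) = 0} \<le> D"
proof -
  let ?K = "Poly_Mapping.keys p"
  have K: "?K \<noteq> {}" "finite ?K"
    using assms by auto
  obtain \<alpha> where \<alpha>: "\<alpha> \<in> ?K" and Max: "Max ((\<lambda>\<beta>. mono_inner \<beta> \<beta>) ` ?K) = mono_inner \<alpha> \<alpha>"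
    by (rule obtains_MAX[OF K(2,1), of "\<lambda>\<beta>. mono_inner \<beta> \<beta>"])
  have max: "mono_inner \<beta> \<beta> \<le> mono_inner \<alpha> \<alpha>" if "\<beta> \<in> ?K" for \<beta>
    unfolding Max[symmetric] using that by (intro Max_ge) auto
  define v :: "real \<Rightarrow> real ^ 'v" where "v s = (\<chi> i. s ^ Poly_Mapping.lookup \<alpha> i)" for s
  define a where "a i = Poly_Mapping.lookup \<alpha> i" for i
  define F where "F x i = [:x $ i:] + monom 1 (a i)" for x :: "real ^ 'v" and i
  define T where "T x \<beta> = (\<Prod>i\<in>UNIV. F x i ^ Poly_Mapping.lookup \<beta> i)" for x \<beta>
  define U where "U x = (\<Sum>\<beta>\<in>?K. smult (Poly_Mapping.lookup p \<beta>) (T x \<beta>))" for x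
  have eval: "poly (U x) s = mpoly_eval p (x + v s)" for x s
    by (simp add: U_def T_def F_def poly_sum poly_prod poly_monom mpoly_eval_def mono_eval_def
        v_def a_def)
  have degF: "degree (F x i) \<le> a i" for x i
    unfolding F_def by (intro degree_add_le) (auto simp: degree_monom_eq)
  have degT: "degree (T x \<beta>) \<le> mono_inner \<beta> \<alpha>" for x \<beta>
  proof -
    have "degree (T x \<beta>) \<le> (\<Sum>i\<in>UNIV. degree (F x i ^ Poly_Mapping.lookup \<beta> i))"
      unfolding T_def using degree_prod_sum_le[of UNIV "\<lambda>i. F x i ^ Poly_Mapping.lookup \<beta> i"]
      by (simp add: o_def)
    also have "\<dots> \<le> (\<Sum>i\<in>UNIV. a i * Poly_Mapping.lookup \<beta> i)"
      by (intro sum_mono order_trans[OF degree_power_le] mult_right_mono degF) auto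
    finally show ?thesis
      by (simp add: mono_inner_def a_def mult.commute)
  qed
  have coeffT: "coeff (T x \<alpha>) (mono_inner \<alpha> \<alpha>) = 1" for x
  proof -
    \<comment> \<open>For \<open>a i = 0\<close> the factor \<open>F x i\<close> is the constant
      \<open>x $ i + 1\<close>, which may vanish, but it is then raised to the power zero.\<close>
    have "degree (F x i ^ a i) = a i * a i \<and> lead_coeff (F x i ^ a i) = 1" for i
    proof (cases "a i = 0")
      case False
      then have "coeff (F x i) (a i) = 1"
        by (cases "a i") (simp_all add: F_def coeff_pCons)
      with degF[of x i] have "degree (F x i) = a i"
        by (metis le_antisym le_degree zero_neq_one)
      moreover have "F x i \<noteq> 0"
        using \<open>coeff (F x i) (a i) = 1\<close> by auto
      ultimately show ?thesis
        using \<open>coeff (F x i) (a i) = 1\<close> lead_coeff_power[of "F x i" "a i"]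
        by (simp add: degree_power_eq)
    qed simp
    then have *: "degree (F x i ^ a i) = a i * a i" "lead_coeff (F x i ^ a i) = 1" for i
      by blast+
    then have "F x i ^ a i \<noteq> 0" for i
      by (metis leading_coeff_0_iff zero_neq_one)
    then have "degree (T x \<alpha>) = (\<Sum>i\<in>UNIV. degree (F x i ^ a i))"
      unfolding T_def a_def[symmetric] by (intro degree_prod_eq_sum_degree) auto
    then have "degree (T x \<alpha>) = mono_inner \<alpha> \<alpha>"
      by (simp only: *) (simp add: mono_inner_def a_def)
    moreover have "lead_coeff (T x \<alpha>) = 1"
      unfolding T_def a_def[symmetric] lead_coeff_prod using *(2) by (intro prod.neutral) blast
    ultimately show ?thesis
      by simp
  qed
  have "coeff (U x) (mono_inner \<alpha> \<alpha>) = Poly_Mapping.lookup p \<alpha>" for x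
  proof -
    have "coeff (U x) (mono_inner \<alpha> \<alpha>) =
        (\<Sum>\<beta>\<in>?K. Poly_Mapping.lookup p \<beta> * coeff (T x \<beta>) (mono_inner \<alpha> \<alpha>))"
      by (simp add: U_def coeff_sum)
    also have "\<dots> = (\<Sum>\<beta>\<in>?K. if \<beta> = \<alpha> then Poly_Mapping.lookup p \<alpha> else 0)"
    proof (rule sum.cong[OF refl])
      fix \<beta> assume "\<beta> \<in> ?K"
      then show "Poly_Mapping.lookup p \<beta> * coeff (T x \<beta>) (mono_inner \<alpha> \<alpha>) =
          (if \<beta> = \<alpha> then Poly_Mapping.lookup p \<alpha> else 0)"
        using coeffT degT[of x \<beta>] mono_inner_less[OF max[of \<beta>]]
        by (auto intro!: coeff_eq_0)
    qed
    finally show ?thesis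
      using \<alpha> by simp
  qed
  then have nz: "U x \<noteq> 0" for x
    using \<alpha> by (metis coeff_0 in_keys_iff)
  have degU: "degree (U x) \<le> mono_inner \<alpha> \<alpha>" for x
    unfolding U_def
  proof (intro degree_sum_le order_trans[OF degree_smult_le])
    fix \<beta> assume "\<beta> \<in> ?K"
    then show "degree (T x \<beta>) \<le> mono_inner \<alpha> \<alpha>"
      using degT[of x \<beta>] mono_inner_less[OF max[of \<beta>]] by (cases "\<beta> = \<alpha>") auto
  qed simp
  show ?thesis
  proof (rule that)
    show "norm (v s) \<le> real CARD('v)" if "s \<in> {0..1}" for s
    proof -
      have "norm (v s) \<le> (\<Sum>i\<in>UNIV. \<bar>v s $ i\<bar>)"
        by (rule norm_le_l1_cart)
      also have "\<dots> \<le> (\<Sum>i\<in>(UNIV::'v set). 1)"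
        using that by (intro sum_mono) (auto simp: v_def power_le_one)
      finally show ?thesis by simp
    qed
    show "finite {s. mpoly_eval p (x + v s) = 0}" for x
      using poly_roots_finite[OF nz[of x]] by (simp add: eval)
    show "card {s. mpoly_eval p (x + v s) = 0} \<le> mono_inner \<alpha> \<alpha>" for x
      using card_poly_roots_bound[OF nz[of x]] degU[of x] by (simp add: eval)
  qed
qed

text \<open>Infinitely many translates of equal measure cover a bounded region at most \<open>D\<close> times.\<close>

lemma negligible_if_finite_translates:
  fixes Z :: "'a::euclidean_space set" and v :: "real \<Rightarrow> 'a"
  assumes "closed Z"
    and bounded: "\<And>s. s \<in> {0..1} \<Longrightarrow> norm (v s) \<le> C"
    and fin: "\<And>x. finite {s. x + v s \<in> Z}"
    and card: "\<And>x. card {s. x + v s \<in> Z} \<le> D"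
  shows "negligible Z"
proof -
  have "negligible (Z \<inter> cball 0 R)" for R
  proof -
    let ?Z = "Z \<inter> cball 0 R" and ?B = "cball 0 (R + C) :: 'a set"
    define s where "s j = 1 / real (Suc j)" for j
    define T where "T j = (\<lambda>z. z - v (s j)) ` ?Z" for j
    have s: "s j \<in> {0..1}" "inj s" for j
      by (auto simp: s_def inj_def)
    have Z: "?Z \<in> lmeasurable"
      using \<open>closed Z\<close> by (intro lmeasurable_compact closed_Int_compact compact_cball)
    then have T1: "T j \<in> lmeasurable" for j
      by (simp add: T_def measurable_translation_subtract)
    have T: "T j \<in> lmeasurable" "emeasure lebesgue (T j) < \<infinity>" "measure lebesgue (T j) = measure lebesgue ?Z" for j
      using T1[of j] fmeasurableD2[OF T1[of j]] unfolding T_def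
      by (simp_all add: measure_translation_subtract less_top del: emeasure_completion)
    have T_sub: "T j \<subseteq> ?B" for j
      using norm_triangle_ineq4 bounded[OF s(1)[of j]]
      by (force simp: T_def intro: order_trans[OF norm_triangle_ineq4] add_mono)
    \<comment> \<open>A point \<open>x\<close> lies in \<open>T j\<close> only if
      \<open>x + v (s j)\<close> lies in \<open>Z\<close>, and \<open>s\<close> is injective, so at
      most \<open>D\<close> of these sets contain \<open>x\<close>.\<close>
    have pointwise: "(\<Sum>j<n. indicat_real (T j) x) \<le> real D * indicat_real ?B x" for n x
    proof (cases "x \<in> ?B")
      case True
      have sub: "s ` {j\<in>{..<n}. x \<in> T j} \<subseteq> {s. x + v s \<in> Z}"
        by (auto simp: T_def)
      have "(\<Sum>j<n. indicat_real (T j) x) = real (card {j\<in>{..<n}. x \<in> T j})"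
        by (simp add: indicator_def sum.If_cases Int_def)
      also have "\<dots> = real (card (s ` {j\<in>{..<n}. x \<in> T j}))"
        by (subst card_image) (use s(2) in \<open>auto intro: inj_on_subset\<close>)
      also have "\<dots> \<le> real D"
        using card_mono[OF fin sub] card[of x] by simp
      finally show ?thesis
        using True by simp
    next
      case False
      then have "x \<notin> T j" for j
        using T_sub by blast
      then show ?thesis
        using False by simp
    qed
    have "real n * measure lebesgue ?Z \<le> real D * measure lebesgue ?B" for n
    proof -
      have "real n * measure lebesgue ?Z = (\<Sum>j<n. measure lebesgue (T j))"
        by (simp add: T)
      also have "\<dots> = (\<integral>x. (\<Sum>j<n. indicat_real (T j) x) \<partial>lebesgue)"
        using T by (subst Bochner_Integration.integral_sum)
          (auto simp del: emeasure_completion intro!: integrable_real_indicator)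
      also have "\<dots> \<le> (\<integral>x. real D * indicat_real ?B x \<partial>lebesgue)"
        using T(1,2) by (intro integral_mono pointwise Bochner_Integration.integrable_sum
            integrable_mult_right integrable_real_indicator)
          (use fmeasurableD2[OF lmeasurable_cball[of 0 "R + C"]]
            in \<open>auto simp del: emeasure_completion simp: less_top\<close>)
      also have "\<dots> = real D * measure lebesgue ?B"
        by simp
      finally show ?thesis .
    qed
    then have "measure lebesgue ?Z \<le> 0"
      by (meson linorder_not_le reals_Archimedean3)
    then show ?thesis
      using Z by (simp add: negligible_iff_measure0 antisym)
  qed
  then have "negligible (\<Union>n. Z \<inter> cball 0 (real n))"
    by (intro negligible_countable_Union) auto
  moreover have "Z = (\<Union>n. Z \<inter> cball 0 (real n))"
    by (auto simp: real_arch_simple)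
  ultimately show ?thesis
    by simp
qed

lemma negligible_mpoly_zeros: "p \<noteq> 0 \<Longrightarrow> negligible {x. mpoly_eval p x = 0}"
  by (erule mpoly_zeros_along_curve, rule negligible_if_finite_translates[OF closed_mpoly_zeros])
    simp_all

text \<open>The zero set of a nonzero difference is null, while the whole space is not. Later
  identities between formal polynomials are proved by evaluation in this way.\<close>

lemma mpoly_eq_iff_eval: "p = q \<longleftrightarrow> (\<forall>x. mpoly_eval p x = mpoly_eval q x)"
proof
  assume *: "\<forall>x. mpoly_eval p x = mpoly_eval q x"
  show "p = q"
  proof (rule ccontr)
    assume "p \<noteq> q"
    then have "negligible {x. mpoly_eval (p - q) x = 0}"
      by (intro negligible_mpoly_zeros) simp
    then show False
      using * by (simp add: mpoly_eval_diff non_negligible_UNIV)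
  qed
qed simp

lemma mpoly_eqI: "(\<And>x. mpoly_eval p x = mpoly_eval q x) \<Longrightarrow> p = q"
  by (simp add: mpoly_eq_iff_eval)

text \<open>Two null zero sets cannot cover the space. This makes \<open>g * q ^ 2\<close> nonzero
  in \<open>gram_bounded\<close>.\<close>

lemma mpoly_mult_eq_0_iff:
  fixes p q :: "'v::finite mpoly"
  shows "p * q = 0 \<longleftrightarrow> p = 0 \<or> q = 0"
proof
  assume *: "p * q = 0"
  show "p = 0 \<or> q = 0"
  proof (rule ccontr)
    assume "\<not> (p = 0 \<or> q = 0)"
    then have "negligible ({x. mpoly_eval p x = 0} \<union> {x. mpoly_eval q x = 0})"
      by (intro negligible_Un negligible_mpoly_zeros) auto
    moreover have "mpoly_eval p x * mpoly_eval q x = 0" for x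
      using * mpoly_eval_mult[of p q x] by simp
    then have "{x. mpoly_eval p x = 0} \<union> {x. mpoly_eval q x = 0} = UNIV"
      by auto
    ultimately show False
      by (simp add: non_negligible_UNIV)
  qed
qed auto

text \<open>Brings results on polynomial functions back to formal polynomials: the Stone-Weierstrass
  theorem and closure under affine substitution.\<close>

lemma real_polynomial_function_imp_mpoly:
  fixes g :: "real ^ 'v::finite \<Rightarrow> real"
  assumes "real_polynomial_function g"
  obtains p where "\<And>x. mpoly_eval p x = g x"
proof -
  have "\<exists>p. \<forall>x. mpoly_eval p x = g x"
    using assms
  proof induction
    case (linear g)
    have "mpoly_eval (\<Sum>i\<in>UNIV. g (axis i 1) *\<^sub>R Var i) x = g x" for x
    proof -
      have "g x = g (\<Sum>i\<in>UNIV. x $ i *\<^sub>R axis i 1)"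
        by (metis basis_expansion scalar_mult_eq_scaleR)
      also have "\<dots> = (\<Sum>i\<in>UNIV. x $ i * g (axis i 1))"
        using linear by (simp add: linear_sum bounded_linear.linear linear_scale o_def)
      finally show ?thesis
        by (simp add: mpoly_eval_sum mpoly_eval_Var mult.commute)
    qed
    then show ?case by blast
  next
    case (const c)
    then show ?case by (metis mpoly_eval_of_real)
  next
    case (add f g)
    then show ?case by (metis mpoly_eval_add)
  next
    case (mult f g)
    then show ?case by (metis mpoly_eval_mult)
  qed
  then show ?thesis
    using that by blast
qed

section \<open>Riesz functionals and Gram polynomials\<close>

lemma riesz_superset:
  assumes "finite A" "Poly_Mapping.keys p \<subseteq> A"
  shows "riesz z p = (\<Sum>\<alpha>\<in>A. Poly_Mapping.lookup p \<alpha> * z \<alpha>)"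
  unfolding riesz_def using assms
  by (intro sum.mono_neutral_left) (auto simp: in_keys_iff)

lemma riesz_zero [simp]: "riesz z 0 = 0"
  by (simp add: riesz_def)

lemma riesz_single [simp]: "riesz z (Poly_Mapping.single \<alpha> c) = c * z \<alpha>"
  by (simp add: riesz_def)

lemma riesz_add: "riesz z (p + q) = riesz z p + riesz z q"
proof -
  have A: "finite (Poly_Mapping.keys p \<union> Poly_Mapping.keys q)" by simp
  show ?thesis
    using riesz_superset[OF A, of p z] riesz_superset[OF A, of q z]
      riesz_superset[OF A, of "p + q" z] keys_add[of p q]
    by (simp add: lookup_add algebra_simps sum.distrib)
qed

lemma riesz_scaleR: "riesz z (c *\<^sub>R p) = c * riesz z p"
  by (subst riesz_superset[of "Poly_Mapping.keys p"])
     (auto simp: riesz_def in_keys_iff sum_distrib_left mult_ac)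

lemma riesz_diff: "riesz z (p - q) = riesz z p - riesz z q"
  using riesz_add[of z "p - q" q] by simp

lemma riesz_sum: "riesz z (sum p A) = (\<Sum>i\<in>A. riesz z (p i))"
  by (induction A rule: infinite_finite_induct) (simp_all add: riesz_add)

lemma riesz_sum_list: "riesz z (\<Sum>x\<leftarrow>xs. p x) = (\<Sum>x\<leftarrow>xs. riesz z (p x))"
  by (induction xs) (simp_all add: riesz_add)

text \<open>The quadratic form of \<open>G\<close> evaluated at the vector of monomials with
  exponents in \<open>I\<close>.\<close>

definition gram_poly :: "'a set \<Rightarrow> ('a \<Rightarrow> 'a \<Rightarrow> real) \<Rightarrow> ('a::comm_monoid_add \<Rightarrow>\<^sub>0 real)" where
  "gram_poly I G = (\<Sum>\<alpha>\<in>I. \<Sum>\<beta>\<in>I. Poly_Mapping.single (\<alpha> + \<beta>) (G \<alpha> \<beta>))"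

text \<open>The pairing of a Gram matrix with a localizing matrix, which translates between
  conditions on polynomials and conditions on moments.\<close>

lemma riesz_mult_gram_poly:
  "riesz z (g * gram_poly I G) = (\<Sum>\<alpha>\<in>I. \<Sum>\<beta>\<in>I. G \<alpha> \<beta> * loc_matrix g z \<alpha> \<beta>)"
proof -
  have "riesz z (g * Poly_Mapping.single \<gamma> c) = c * riesz z (g * Poly_Mapping.single \<gamma> 1)" for \<gamma> c
  proof -
    have "g * Poly_Mapping.single \<gamma> c = c *\<^sub>R (g * Poly_Mapping.single \<gamma> 1)"
      by (simp only: mult_scaleR_right[symmetric] scaleR_single mult_1_right)
    then show ?thesis
      by (simp only: riesz_scaleR)
  qed
  note scale = this
  show ?thesis
    unfolding gram_poly_def loc_matrix_def sum_distrib_left riesz_sum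
    by (intro sum.cong refl scale)
qed

lemma mpoly_expand_superset:
  fixes p :: "'a \<Rightarrow>\<^sub>0 real"
  assumes "finite I" "Poly_Mapping.keys p \<subseteq> I"
  shows "p = (\<Sum>\<alpha>\<in>I. Poly_Mapping.single \<alpha> (Poly_Mapping.lookup p \<alpha>))"
  using assms by (intro poly_mapping_eqI) (auto simp: lookup_sum lookup_single when_def in_keys_iff)

lemma power2_eq_gram_poly:
  fixes q :: "'a::comm_monoid_add \<Rightarrow>\<^sub>0 real"
  assumes "finite I" "Poly_Mapping.keys q \<subseteq> I"
  shows "q ^ 2 = gram_poly I (\<lambda>\<alpha> \<beta>. Poly_Mapping.lookup q \<alpha> * Poly_Mapping.lookup q \<beta>)"
proof -
  let ?q = "\<Sum>\<alpha>\<in>I. Poly_Mapping.single \<alpha> (Poly_Mapping.lookup q \<alpha>)"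
  have "q ^ 2 = ?q * ?q"
    using mpoly_expand_superset[OF assms] by (simp add: power2_eq_square)
  then show ?thesis
    by (simp add: gram_poly_def sum_product mult_single)
qed

lemma gram_poly_add: "gram_poly I (\<lambda>\<alpha> \<beta>. G \<alpha> \<beta> + H \<alpha> \<beta>) = gram_poly I G + gram_poly I H"
  by (simp add: gram_poly_def single_add sum.distrib)

lemma mpoly_deg_gram_poly: "mpoly_deg (gram_poly (exponents k) G) \<le> 2 * k"
  unfolding gram_poly_def
  by (intro mpoly_deg_sum_le order_trans[OF mpoly_deg_single_le]) (simp add: exponents_def)

lemma riesz_mult_power2_nonneg:
  assumes "psd_on (exponents k) (loc_matrix g z)" "mpoly_deg q \<le> k"
  shows "0 \<le> riesz z (g * q ^ 2)"
proof -
  have "riesz z (g * q ^ 2) = (\<Sum>\<alpha>\<in>exponents k. \<Sum>\<beta>\<in>exponents k.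
      Poly_Mapping.lookup q \<alpha> * loc_matrix g z \<alpha> \<beta> * Poly_Mapping.lookup q \<beta>)"
    using power2_eq_gram_poly[OF finite_exponents, of q k] assms(2)
    by (simp add: mpoly_deg_le_iff riesz_mult_gram_poly mult_ac)
  then show ?thesis
    using assms(1) by (simp add: psd_on_def)
qed

section \<open>Truncated quadratic modules\<close>

lemma SOS_zero [simp]: "0 \<in> SOS r"
  by (auto simp: SOS_def intro: exI[of _ "[]"])

lemma SOS_power2: "mpoly_deg q \<le> r \<Longrightarrow> q ^ 2 \<in> SOS r"
  unfolding SOS_def using mpoly_deg_power2_le by (auto intro!: exI[of _ "[q]"])

lemma SOS_add: "p \<in> SOS r \<Longrightarrow> q \<in> SOS r \<Longrightarrow> p + q \<in> SOS r"
proof -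
  assume "p \<in> SOS r" "q \<in> SOS r"
  then obtain ps qs where "p = (\<Sum>q\<leftarrow>ps. q ^ 2)" "q = (\<Sum>q\<leftarrow>qs. q ^ 2)"
    "mpoly_deg p \<le> 2 * r" "mpoly_deg q \<le> 2 * r"
    by (auto simp: SOS_def)
  then show ?thesis
    by (auto simp: SOS_def mpoly_deg_add_le intro!: exI[of _ "ps @ qs"])
qed

lemma SOS_sum: "(\<And>i. i \<in> A \<Longrightarrow> p i \<in> SOS r) \<Longrightarrow> sum p A \<in> SOS r"
  by (induction A rule: infinite_finite_induct) (simp_all add: SOS_add)

text \<open>\<open>SOS\<close> restricts the degree of the sum only; the bound on each summand comes
  from the absence of cancellation among leading terms.\<close>

lemma SOS_obtain:
  assumes "p \<in> SOS r"
  obtains qs where "p = (\<Sum>q\<leftarrow>qs. q ^ 2)" "\<And>q. q \<in> set qs \<Longrightarrow> mpoly_deg q \<le> r"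
  using assms mpoly_deg_le_if_sum_squares unfolding SOS_def by blast

lemma SOS_mono: "p \<in> SOS r \<Longrightarrow> r \<le> s \<Longrightarrow> p \<in> SOS s"
  by (auto simp: SOS_def)

lemma SOS_scaleR:
  assumes "p \<in> SOS r" "0 \<le> c"
  shows "c *\<^sub>R p \<in> SOS r"
proof -
  obtain qs where qs: "p = (\<Sum>q\<leftarrow>qs. q ^ 2)" "mpoly_deg p \<le> 2 * r"
    using assms(1) by (auto simp: SOS_def)
  have "c *\<^sub>R (\<Sum>q\<leftarrow>qs. q ^ 2) = (\<Sum>q\<leftarrow>map (\<lambda>q. sqrt c *\<^sub>R q) qs. q ^ 2)"
    using assms(2) by (induction qs) (simp_all add: scaleR_add_right power2_eq_square)
  then show ?thesis
    unfolding SOS_def using qs mpoly_deg_scaleR_le by blast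
qed

lemma quad_moduleI:
  assumes "g \<in> set (1 # gs)" "s \<in> SOS (r - half_deg g)"
  shows "s * g \<in> quad_module gs r"
proof -
  obtain i where i: "i < length (1 # gs)" "(1 # gs) ! i = g"
    using assms(1) by (metis in_set_conv_nth)
  let ?s = "\<lambda>j. if j = i then s else 0"
  have "(\<Sum>j\<le>length gs. ?s j * (1 # gs) ! j) = (\<Sum>j\<le>length gs. if j = i then s * g else 0)"
    using i by (intro sum.cong) auto
  also have "\<dots> = s * g"
    using i(1) by simp
  finally show ?thesis
    unfolding quad_module_def using i assms(2) by (auto intro!: exI[of _ ?s])
qed

lemma quad_module_SOS: "s \<in> SOS r \<Longrightarrow> s \<in> quad_module gs r"
  using quad_moduleI[of 1 gs s r] by simp

lemma quad_module_zero [simp]: "0 \<in> quad_module gs r"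
  by (simp add: quad_module_SOS)

lemma quad_module_add:
  assumes "p \<in> quad_module gs r" "q \<in> quad_module gs r"
  shows "p + q \<in> quad_module gs r"
proof -
  obtain s t where "p = (\<Sum>j\<le>length gs. s j * (1 # gs) ! j)"
    "q = (\<Sum>j\<le>length gs. t j * (1 # gs) ! j)"
    "\<forall>j\<le>length gs. s j \<in> SOS (r - half_deg ((1 # gs) ! j))"
    "\<forall>j\<le>length gs. t j \<in> SOS (r - half_deg ((1 # gs) ! j))"
    using assms by (auto simp: quad_module_def)
  then show ?thesis
    unfolding quad_module_def
    by (intro CollectI exI[of _ "\<lambda>j. s j + t j"]) (auto simp: SOS_add sum.distrib ring_distribs)
qed

lemma quad_module_sum:
  "(\<And>i. i \<in> A \<Longrightarrow> p i \<in> quad_module gs r) \<Longrightarrow> sum p A \<in> quad_module gs r"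
  by (induction A rule: infinite_finite_induct) (simp_all add: quad_module_add)

lemma quad_module_scaleR:
  assumes "p \<in> quad_module gs r" "0 \<le> c"
  shows "c *\<^sub>R p \<in> quad_module gs r"
proof -
  obtain s where "p = (\<Sum>j\<le>length gs. s j * (1 # gs) ! j)"
    "\<forall>j\<le>length gs. s j \<in> SOS (r - half_deg ((1 # gs) ! j))"
    using assms by (auto simp: quad_module_def)
  then show ?thesis
    unfolding quad_module_def using assms(2)
    by (intro CollectI exI[of _ "\<lambda>j. c *\<^sub>R s j"]) (auto simp: SOS_scaleR scaleR_sum_right)
qed

lemma quad_module_mono:
  assumes "p \<in> quad_module gs r" "r \<le> s"
  shows "p \<in> quad_module gs s"
proof -
  obtain t where "p = (\<Sum>j\<le>length gs. t j * (1 # gs) ! j)"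
    "\<forall>j\<le>length gs. t j \<in> SOS (r - half_deg ((1 # gs) ! j))"
    using assms by (auto simp: quad_module_def)
  then show ?thesis
    unfolding quad_module_def using assms(2)
    by (intro CollectI exI[of _ t]) (auto intro: SOS_mono)
qed

lemma nth_Cons_one_mem: "j \<le> length gs \<Longrightarrow> (1 # gs) ! j \<in> set (1 # gs)"
  by (metis le_imp_less_Suc length_Cons nth_mem)

lemma SOS_nonneg: "s \<in> SOS r \<Longrightarrow> 0 \<le> mpoly_eval s x"
proof -
  assume "s \<in> SOS r"
  then obtain qs where "s = (\<Sum>q\<leftarrow>qs. q ^ 2)"
    by (rule SOS_obtain)
  moreover have "0 \<le> mpoly_eval (\<Sum>q\<leftarrow>qs. q ^ 2) x"
    by (induction qs) (simp_all add: mpoly_eval_add mpoly_eval_power)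
  ultimately show ?thesis
    by simp
qed

lemma quad_module_nonneg:
  assumes "p \<in> quad_module gs r" "x \<in> basic_semialg gs"
  shows "0 \<le> mpoly_eval p x"
proof -
  obtain s where s: "p = (\<Sum>j\<le>length gs. s j * (1 # gs) ! j)"
    "\<forall>j\<le>length gs. s j \<in> SOS (r - half_deg ((1 # gs) ! j))"
    using assms by (auto simp: quad_module_def)
  have "0 \<le> mpoly_eval g x" if "g \<in> set (1 # gs)" for g
    using that assms(2) by (auto simp: basic_semialg_def mpoly_eval_one)
  then have "0 \<le> mpoly_eval (s j * (1 # gs) ! j) x" if "j \<le> length gs" for j
    unfolding mpoly_eval_mult using s(2) SOS_nonneg nth_Cons_one_mem[OF that] that
    by (metis mult_nonneg_nonneg)
  then show ?thesis
    by (auto simp: s(1) mpoly_eval_sum intro!: sum_nonneg)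
qed

lemma riesz_SOS_mult_nonneg:
  assumes "psd_on (exponents k) (loc_matrix g z)" "s \<in> SOS k"
  shows "0 \<le> riesz z (s * g)"
proof -
  obtain qs where qs: "s = (\<Sum>q\<leftarrow>qs. q ^ 2)" "\<And>q. q \<in> set qs \<Longrightarrow> mpoly_deg q \<le> k"
    using assms(2) by (rule SOS_obtain) blast
  have "s * g = (\<Sum>q\<leftarrow>qs. g * q ^ 2)"
    unfolding qs(1) by (induction qs) (simp_all add: ring_distribs mult.commute)
  then show ?thesis
    using riesz_mult_power2_nonneg[OF assms(1) qs(2)]
    by (auto simp: riesz_sum_list intro!: sum_list_nonneg)
qed

lemma riesz_quad_module_nonneg:
  assumes "psd_on (exponents r) (loc_matrix 1 z)"
    and "\<forall>g\<in>set gs. psd_on (exponents (r - half_deg g)) (loc_matrix g z)"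
    and "p \<in> quad_module gs r"
  shows "0 \<le> riesz z p"
proof -
  obtain s where s: "p = (\<Sum>j\<le>length gs. s j * (1 # gs) ! j)"
    "\<forall>j\<le>length gs. s j \<in> SOS (r - half_deg ((1 # gs) ! j))"
    using assms by (auto simp: quad_module_def)
  have "psd_on (exponents (r - half_deg g)) (loc_matrix g z)" if "g \<in> set (1 # gs)" for g
    using that assms by auto
  then have "0 \<le> riesz z (s j * (1 # gs) ! j)" if "j \<le> length gs" for j
    using s(2) that by (intro riesz_SOS_mult_nonneg) (use nth_Cons_one_mem[OF that] in auto)
  then show ?thesis
    by (auto simp: s(1) riesz_sum intro!: sum_nonneg)
qed

lemma mono_split_single:
  fixes \<alpha> :: "'v::finite \<Rightarrow>\<^sub>0 nat"
  assumes "\<alpha> \<noteq> 0"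
  obtains i \<beta> where "\<alpha> = \<beta> + Poly_Mapping.single i 1" "mono_deg \<alpha> = Suc (mono_deg \<beta>)"
proof -
  obtain i where i: "Poly_Mapping.lookup \<alpha> i \<noteq> 0"
    using assms by (metis poly_mapping_eqI lookup_zero)
  have "\<alpha> = (\<alpha> - Poly_Mapping.single i 1) + Poly_Mapping.single i 1"
    using i by (intro poly_mapping_eqI) (auto simp: lookup_add lookup_minus lookup_single when_def)
  then show ?thesis
    by (intro that[of "\<alpha> - Poly_Mapping.single i 1" i]) (auto dest: arg_cong[of _ _ mono_deg])
qed

text \<open>With \<open>j = k = r\<close> this writes each monomial of degree at most
  \<open>2 * r\<close> as a product of two monomials that index the moment matrix of order
  \<open>r\<close>.\<close>

lemma mono_split:
  fixes \<gamma> :: "'v::finite \<Rightarrow>\<^sub>0 nat"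
  assumes "mono_deg \<gamma> \<le> j + k"
  obtains \<alpha> \<beta> where "\<gamma> = \<alpha> + \<beta>" "mono_deg \<alpha> \<le> j" "mono_deg \<beta> \<le> k"
proof -
  have "\<exists>\<alpha> \<beta>. \<gamma> = \<alpha> + \<beta> \<and> mono_deg \<alpha> \<le> j \<and> mono_deg \<beta> \<le> k"
    using assms
  proof (induction j arbitrary: \<gamma>)
    case 0
    then show ?case by (intro exI[of _ 0] exI[of _ \<gamma>]) auto
  next
    case (Suc j)
    show ?case
    proof (cases "\<gamma> = 0")
      case False
      then obtain i \<delta> where \<delta>: "\<gamma> = \<delta> + Poly_Mapping.single i 1" "mono_deg \<gamma> = Suc (mono_deg \<delta>)"
        by (rule mono_split_single)
      then obtain \<alpha> \<beta> where "\<delta> = \<alpha> + \<beta>" "mono_deg \<alpha> \<le> j" "mono_deg \<beta> \<le> k"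
        using Suc by force
      then show ?thesis
        using \<delta> by (intro exI[of _ "\<alpha> + Poly_Mapping.single i 1"] exI[of _ \<beta>]) (auto simp: add_ac)
    qed (auto intro: exI[of _ 0])
  qed
  then show ?thesis
    using that by blast
qed

text \<open>The squares of the monomials are bounded by constants modulo the quadratic module by
  telescoping with \<open>N - w\<^sub>i\<^sup>2\<close>; the other monomials follow from
  \<open>\<plusminus>2ab \<le> a\<^sup>2 + b\<^sup>2\<close>.\<close>

lemma quad_module_order_unit:
  fixes gs :: "('v::finite) mpoly list"
  assumes N: "0 \<le> N"
    and arch: "\<And>q i. mpoly_deg q < r \<Longrightarrow> q ^ 2 * (of_real N - Var i ^ 2) \<in> quad_module gs r"
    and deg: "mpoly_deg p \<le> 2 * r"
  obtains c where "of_real c - p \<in> quad_module gs r"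
proof -
  let ?Q = "quad_module gs r" and ?m = "\<lambda>\<alpha>. Poly_Mapping.single \<alpha> (1::real) :: 'v mpoly"
  have m_deg: "mpoly_deg (?m \<alpha>) \<le> mono_deg \<alpha>" for \<alpha> :: "'v \<Rightarrow>\<^sub>0 nat"
    by (rule mpoly_deg_single_le)
  have m_add: "?m (\<alpha> + \<beta>) = ?m \<alpha> * ?m \<beta>" for \<alpha> \<beta> :: "'v \<Rightarrow>\<^sub>0 nat"
    by (simp add: mult_single)
  have square: "of_real (N ^ mono_deg \<alpha>) - ?m \<alpha> ^ 2 \<in> ?Q" if "mono_deg \<alpha> \<le> r" for \<alpha>
    using that
  proof (induction "mono_deg \<alpha>" arbitrary: \<alpha>)
    case 0
    then have "\<alpha> = 0"
      by (metis mono_split_single nat.simps(3))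
    then show ?case by simp
  next
    case (Suc k)
    then have "\<alpha> \<noteq> 0" by auto
    then obtain i \<beta> where \<beta>: "\<alpha> = \<beta> + Poly_Mapping.single i 1" "mono_deg \<alpha> = Suc (mono_deg \<beta>)"
      by (rule mono_split_single)
    have "of_real (N ^ mono_deg \<alpha>) - ?m \<alpha> ^ 2 =
        N *\<^sub>R (of_real (N ^ mono_deg \<beta>) - ?m \<beta> ^ 2) + ?m \<beta> ^ 2 * (of_real N - Var i ^ 2)"
      unfolding \<beta>(2) unfolding \<beta>(1) m_add
      by (simp add: Var_def scaleR_conv_of_real algebra_simps)
    moreover have "of_real (N ^ mono_deg \<beta>) - ?m \<beta> ^ 2 \<in> ?Q"
      using Suc \<beta> by simp
    moreover have "?m \<beta> ^ 2 * (of_real N - Var i ^ 2) \<in> ?Q"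
      using m_deg[of \<beta>] \<beta> Suc.prems by (intro arch) simp
    ultimately show ?case
      using N by (simp add: quad_module_add quad_module_scaleR)
  qed
  have mono: "\<exists>c. of_real c - Poly_Mapping.single \<gamma> a \<in> ?Q" if "mono_deg \<gamma> \<le> 2 * r" for \<gamma> a
  proof -
    from that have "mono_deg \<gamma> \<le> r + r" by simp
    then obtain \<alpha> \<beta> where ab: "\<gamma> = \<alpha> + \<beta>" "mono_deg \<alpha> \<le> r" "mono_deg \<beta> \<le> r"
      by (rule mono_split)
    \<comment> \<open>With the sign \<open>e\<close> of \<open>a\<close>, the single identity
      \<open>\<bar>a\<bar> * (A^2 + B^2 - (A - e * B)^2) = 2 * a * A * B\<close> handles
      coefficients of both signs. Replacing \<open>A^2\<close> and \<open>B^2\<close> by their upper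
      bounds gives the constant \<open>c\<close>.\<close>
    define e :: real where "e = (if 0 \<le> a then 1 else -1)"
    have e: "e * e = 1" "\<bar>a\<bar> * e = a"
      by (auto simp: e_def)
    let ?s = "of_real (N ^ mono_deg \<alpha>) - ?m \<alpha> ^ 2" and ?t = "of_real (N ^ mono_deg \<beta>) - ?m \<beta> ^ 2"
    let ?u = "(?m \<alpha> - e *\<^sub>R ?m \<beta>) ^ 2"
    define c where "c = \<bar>a\<bar> / 2 * (N ^ mono_deg \<alpha> + N ^ mono_deg \<beta>)"
    have "mpoly_deg (?m \<alpha> - e *\<^sub>R ?m \<beta>) \<le> r"
      using m_deg[of \<alpha>] m_deg[of \<beta>] ab by (intro mpoly_deg_diff_le mpoly_deg_scaleR_le) auto
    then have "?u \<in> ?Q"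
      by (intro quad_module_SOS SOS_power2)
    moreover have "of_real c - Poly_Mapping.single \<gamma> a = (\<bar>a\<bar> / 2) *\<^sub>R (?s + ?t + ?u)"
    proof (rule mpoly_eqI)
      fix x
      have "e\<^sup>2 = 1" using e by (simp add: power2_eq_square)
      then have "\<bar>a\<bar> / 2 * (A\<^sup>2 + B\<^sup>2 - (A - e * B)\<^sup>2) = a * (A * B)" for A B
        using e(2) by (simp add: power2_diff power_mult_distrib)
      note this[of "mono_eval \<alpha> x" "mono_eval \<beta> x"]
      then show "mpoly_eval (of_real c - Poly_Mapping.single \<gamma> a) x =
          mpoly_eval ((\<bar>a\<bar> / 2) *\<^sub>R (?s + ?t + ?u)) x"
        by (simp add: mpoly_eval_diff mpoly_eval_add mpoly_eval_power ab mono_eval_add c_def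
            algebra_simps)
    qed
    ultimately show ?thesis
      using square ab by (metis abs_ge_zero divide_nonneg_nonneg quad_module_add quad_module_scaleR
          zero_le_numeral)
  qed
  have "\<exists>c. of_real c - (\<Sum>\<alpha>\<in>A. Poly_Mapping.single \<alpha> (Poly_Mapping.lookup p \<alpha>)) \<in> ?Q"
    if "finite A" "A \<subseteq> exponents (2 * r)" for A
    using that
  proof (induction A)
    case empty
    then show ?case by (intro exI[of _ 0]) simp
  next
    case (insert \<alpha> A)
    then obtain c where c: "of_real c - (\<Sum>\<alpha>\<in>A. Poly_Mapping.single \<alpha> (Poly_Mapping.lookup p \<alpha>)) \<in> ?Q"
      by auto
    obtain d where d: "of_real d - Poly_Mapping.single \<alpha> (Poly_Mapping.lookup p \<alpha>) \<in> ?Q"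
      using mono[of \<alpha>] insert.prems by (auto simp: exponents_def)
    from quad_module_add[OF c d] show ?case
      using insert by (intro exI[of _ "c + d"]) (simp add: algebra_simps)
  qed
  from this[of "Poly_Mapping.keys p"] deg obtain c where
    "of_real c - (\<Sum>\<alpha>\<in>Poly_Mapping.keys p. Poly_Mapping.single \<alpha> (Poly_Mapping.lookup p \<alpha>)) \<in> ?Q"
    by (auto simp: mpoly_deg_le_iff)
  then show ?thesis
    using that by (metis mpoly_expand)
qed

section \<open>Finite-dimensional Hahn--Banach\<close>

text \<open>Only an inequality is asked for, and only for positive scalars, which is what comes
  naturally for an infimum. Equality follows by applying it to the inverse scalar as well
  (\<open>sublinear_on_scale\<close>).\<close>

definition sublinear_on :: "'a::real_vector set \<Rightarrow> ('a \<Rightarrow> real) \<Rightarrow> bool" where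
  "sublinear_on V p \<longleftrightarrow> (\<forall>x\<in>V. \<forall>y\<in>V. p (x + y) \<le> p x + p y) \<and>
     (\<forall>c>0. \<forall>x\<in>V. p (c *\<^sub>R x) \<le> c * p x)"

lemma sublinear_onD:
  assumes "sublinear_on V p"
  shows "x \<in> V \<Longrightarrow> y \<in> V \<Longrightarrow> p (x + y) \<le> p x + p y"
    and "0 < c \<Longrightarrow> x \<in> V \<Longrightarrow> p (c *\<^sub>R x) \<le> c * p x"
  using assms by (auto simp: sublinear_on_def)

lemma sublinear_on_zero:
  assumes "sublinear_on V p" "subspace V"
  shows "p 0 = 0"
proof -
  have "p 0 \<le> 2 * p 0" "p 0 \<le> (1/2) * p 0"
    using sublinear_onD(2)[OF assms(1), of 2 0] sublinear_onD(2)[OF assms(1), of "1/2" 0]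
      subspace_0[OF assms(2)] by simp_all
  then show ?thesis by simp
qed

lemma sublinear_on_neg_le:
  assumes "sublinear_on V p" "subspace V" "x \<in> V"
  shows "- p (- x) \<le> p x"
  using sublinear_onD(1)[OF assms(1), of x "- x"] sublinear_on_zero[OF assms(1,2)]
    subspace_neg[OF assms(2,3)] assms(3) by simp

lemma sublinear_on_scale:
  assumes "sublinear_on V p" "x \<in> V" "subspace V" "0 \<le> c"
  shows "p (c *\<^sub>R x) = c * p x"
proof (cases "c = 0")
  case False
  then have "c > 0" using assms(4) by simp
  then have "p (inverse c *\<^sub>R c *\<^sub>R x) \<le> inverse c * p (c *\<^sub>R x)"
    using assms by (intro sublinear_onD(2)) (auto simp: subspace_scale)
  then have "c * p x \<le> p (c *\<^sub>R x)"
    using \<open>c > 0\<close> by (simp add: field_simps)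
  moreover have "p (c *\<^sub>R x) \<le> c * p x"
    using assms \<open>c > 0\<close> by (intro sublinear_onD(2))
  ultimately show ?thesis by simp
qed (use sublinear_on_zero assms in auto)

text \<open>Passing to the infimum of \<open>p (x + t b) - t p b\<close> over \<open>t \<ge> 0\<close> makes a sublinear functional
  linear in the direction \<open>b\<close> and keeps it linear in every direction where it already was.\<close>

lemma sublinear_on_step:
  assumes p: "sublinear_on V p" and V: "subspace V" and b: "b \<in> V"
  obtains p' where "sublinear_on V p'" "\<And>x. x \<in> V \<Longrightarrow> p' x \<le> p x" "p' b = p b" "p' (- b) = - p' b"
proof -
  define A where "A x t = p (x + t *\<^sub>R b) - t * p b" for x t
  define p' where "p' x = (INF t\<in>{0..}. A x t)" for x
  have in_V: "x + t *\<^sub>R b \<in> V" if "x \<in> V" for x t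
    using that V b by (simp add: subspace_add subspace_scale)
  \<comment> \<open>A bound uniform in \<open>t\<close>: \<open>t * p b = p (t b)\<close> is at most
    \<open>p (x + t b) + p (- x)\<close>. Hence the infimum is a real number.\<close>
  have lower: "- p (- x) \<le> A x t" if "x \<in> V" "0 \<le> t" for x t
  proof -
    have "p (t *\<^sub>R b) \<le> p (x + t *\<^sub>R b) + p (- x)"
      using sublinear_onD(1)[OF p in_V[OF that(1)], of "- x" t] that V by (simp add: subspace_neg)
    then show ?thesis
      using sublinear_on_scale[OF p b V that(2)] by (simp add: A_def)
  qed
  have bdd: "bdd_below (A x ` {0..})" if "x \<in> V" for x
    using lower[OF that] by (auto intro!: bdd_belowI2)
  have p'_le: "p' x \<le> A x t" if "x \<in> V" "0 \<le> t" for x t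
    unfolding p'_def using bdd that by (auto intro!: cINF_lower)
  have le_p': "m \<le> p' x" if "\<And>t. 0 \<le> t \<Longrightarrow> m \<le> A x t" for m x
    unfolding p'_def using that by (intro cINF_greatest) auto
  have add: "p' (x + y) \<le> p' x + p' y" if xy: "x \<in> V" "y \<in> V" for x y
  proof -
    have "p' (x + y) - A x s \<le> A y t" if "0 \<le> s" "0 \<le> t" for s t
    proof -
      have "p' (x + y) \<le> A (x + y) (s + t)"
        using xy that V by (intro p'_le) (auto simp: subspace_add)
      moreover have "p (x + s *\<^sub>R b + (y + t *\<^sub>R b)) \<le> p (x + s *\<^sub>R b) + p (y + t *\<^sub>R b)"
        using xy by (intro sublinear_onD(1)[OF p] in_V)
      ultimately show ?thesis
        by (simp add: A_def algebra_simps)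
    qed
    then have "p' (x + y) - A x s \<le> p' y" if "0 \<le> s" for s
      using that by (intro le_p')
    then have "p' (x + y) - p' y \<le> p' x"
      by (intro le_p') (simp add: algebra_simps)
    then show ?thesis by simp
  qed
  have scale: "p' (c *\<^sub>R x) \<le> c * p' x" if "0 < c" "x \<in> V" for c x
  proof -
    have "inverse c * p' (c *\<^sub>R x) \<le> A x t" if "0 \<le> t" for t
    proof -
      have "p' (c *\<^sub>R x) \<le> A (c *\<^sub>R x) (c * t)"
        using \<open>0 < c\<close> \<open>x \<in> V\<close> that V by (intro p'_le) (auto simp: subspace_scale)
      also have "\<dots> = p (c *\<^sub>R (x + t *\<^sub>R b)) - c * t * p b"
        by (simp add: A_def scaleR_add_right)
      also have "\<dots> \<le> c * A x t"
        using sublinear_onD(2)[OF p \<open>0 < c\<close> in_V[OF \<open>x \<in> V\<close>], of t] by (simp add: A_def algebra_simps)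
      finally show ?thesis
        using \<open>0 < c\<close> by (simp add: field_simps)
    qed
    then have "inverse c * p' (c *\<^sub>R x) \<le> p' x"
      by (rule le_p')
    then show ?thesis
      using \<open>0 < c\<close> by (simp add: field_simps)
  qed
  have sub: "sublinear_on V p'"
    using add scale by (auto simp: sublinear_on_def)
  have le: "p' x \<le> p x" if "x \<in> V" for x
    using p'_le[OF that, of 0] by (simp add: A_def)
  \<comment> \<open>The value \<open>t = 1\<close> at \<open>- b\<close>. Together with sublinearity
    this closes the chain \<open>p b \<le> - p' (- b) \<le> p' b \<le> p b\<close>.\<close>
  have "p' (- b) \<le> - p b"
    using p'_le[of "- b" 1] V b sublinear_on_zero[OF p V] by (simp add: A_def subspace_neg)
  moreover have "- p' (- b) \<le> p' b"
    by (rule sublinear_on_neg_le[OF sub V b])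
  ultimately show ?thesis
    using le[OF b] by (intro that[of p']) (auto simp: sub le)
qed

text \<open>Linearise first in the direction \<open>x0\<close>, which keeps the value at
  \<open>x0\<close> and prevents every smaller sublinear functional from changing it, and then in
  each generator. A sublinear functional that is odd on the generators is odd on their span, hence
  additive there.\<close>

lemma finite_dim_hahn_banach:
  fixes p :: "'a::real_vector \<Rightarrow> real"
  assumes "finite B" and p: "sublinear_on (span B) p" and x0: "x0 \<in> span B"
  obtains \<phi> where "\<And>x. x \<in> span B \<Longrightarrow> \<phi> x \<le> p x" "\<phi> x0 = p x0"
    "\<And>x y. x \<in> span B \<Longrightarrow> y \<in> span B \<Longrightarrow> \<phi> (x + y) = \<phi> x + \<phi> y"
    "\<And>c x. x \<in> span B \<Longrightarrow> \<phi> (c *\<^sub>R x) = c * \<phi> x"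
proof -
  let ?V = "span B"
  have V: "subspace ?V" by simp
  \<comment> \<open>Oddness survives passing to a smaller sublinear functional \<open>q\<close>:
    \<open>q (- b) \<le> p' (- b) \<le> - p' b \<le> - q b\<close>.\<close>
  have shrink: "q (- b) \<le> - q b"
    if "sublinear_on ?V q" "b \<in> ?V" "\<And>x. x \<in> ?V \<Longrightarrow> q x \<le> p' x" "p' (- b) \<le> - p' b" for q p' b
    using that(3)[OF that(2)] that(3)[of "- b"] that(2,4) by (simp add: span_neg)
  obtain p0 where p0: "sublinear_on ?V p0" "\<And>x. x \<in> ?V \<Longrightarrow> p0 x \<le> p x" "p0 x0 = p x0"
      "p0 (- x0) = - p0 x0"
    using sublinear_on_step[OF p V x0] by metis
  have "\<exists>q. sublinear_on ?V q \<and> (\<forall>x\<in>?V. q x \<le> p0 x) \<and> (\<forall>b\<in>C. q (- b) \<le> - q b)"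
    if "finite C" "C \<subseteq> ?V" for C
    using that
  proof (induction C)
    case empty
    then show ?case using p0 by auto
  next
    case (insert b C)
    then obtain q where q: "sublinear_on ?V q" "\<And>x. x \<in> ?V \<Longrightarrow> q x \<le> p0 x" "\<And>b. b \<in> C \<Longrightarrow> q (- b) \<le> - q b"
      by auto
    obtain q' where q': "sublinear_on ?V q'" "\<And>x. x \<in> ?V \<Longrightarrow> q' x \<le> q x" "q' (- b) = - q' b"
      using sublinear_on_step[OF q(1) V, of b] insert.prems by (metis insert_subset)
    have "\<forall>c\<in>insert b C. q' (- c) \<le> - q' c"
    proof (intro ballI)
      fix c assume "c \<in> insert b C"
      then show "q' (- c) \<le> - q' c"
        using q'(3) insert.prems shrink[OF q'(1) _ q'(2) q(3)] by auto
    qed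
    then show ?case
      using q' q(2) by (intro exI[of _ q']) (auto intro: order_trans)
  qed
  from this[OF \<open>finite B\<close> span_superset] obtain \<phi> where
    \<phi>: "sublinear_on ?V \<phi>" "\<And>x. x \<in> ?V \<Longrightarrow> \<phi> x \<le> p0 x" "\<And>b. b \<in> B \<Longrightarrow> \<phi> (- b) \<le> - \<phi> b"
    by blast
  have "x \<in> ?V \<and> \<phi> (- x) \<le> - \<phi> x" if "x \<in> ?V" for x
    using that
  proof (induction rule: span_induct_alt)
    case base
    then show ?case using sublinear_on_zero[OF \<phi>(1) V] by (simp add: span_zero)
  next
    case (step c b x)
    have b: "b \<in> ?V" "- b \<in> ?V" and x: "x \<in> ?V"
      using step(1,2) by (auto simp: span_base span_neg)
    have cb: "\<phi> (c *\<^sub>R b) + \<phi> (- (c *\<^sub>R b)) \<le> 0"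
    proof (cases "0 \<le> c")
      case True
      then show ?thesis
        using sublinear_on_scale[OF \<phi>(1) b(1) V True] sublinear_on_scale[OF \<phi>(1) b(2) V True]
          mult_left_mono[OF \<phi>(3)[OF step(1)] True] by simp
    next
      case False
      then have "0 \<le> - c" by simp
      then show ?thesis
        using sublinear_on_scale[OF \<phi>(1) b(1) V, of "- c"] sublinear_on_scale[OF \<phi>(1) b(2) V, of "- c"]
          mult_left_mono[OF \<phi>(3)[OF step(1)], of "- c"] by simp
    qed
    have "\<phi> (c *\<^sub>R b + x) \<le> \<phi> (c *\<^sub>R b) + \<phi> x"
      using b x by (intro sublinear_onD(1)[OF \<phi>(1)]) (auto simp: span_scale)
    moreover have "\<phi> (- (c *\<^sub>R b) + - x) \<le> \<phi> (- (c *\<^sub>R b)) + \<phi> (- x)"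
      using b x by (intro sublinear_onD(1)[OF \<phi>(1)]) (auto simp: span_scale span_neg)
    ultimately show ?case
      using cb step(2) b x by (simp add: span_add span_scale)
  qed
  then have neg: "\<phi> (- x) = - \<phi> x" if "x \<in> ?V" for x
    using that sublinear_on_neg_le[OF \<phi>(1) V that] by (simp add: antisym)
  show ?thesis
  proof (rule that)
    show "\<phi> x \<le> p x" if "x \<in> ?V" for x
      using \<phi>(2)[OF that] p0(2)[OF that] by linarith
    show "\<phi> x0 = p x0"
      using \<phi>(2)[OF x0] \<phi>(2)[of "- x0"] neg[OF x0] x0 p0(3,4) by (simp add: span_neg)
    show "\<phi> (x + y) = \<phi> x + \<phi> y" if "x \<in> ?V" "y \<in> ?V" for x y
      using sublinear_onD(1)[OF \<phi>(1), of x y] sublinear_onD(1)[OF \<phi>(1), of "- x" "- y"]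
        neg[of "x + y"] neg[of x] neg[of y] that by (simp add: span_neg span_add)
    show "\<phi> (c *\<^sub>R x) = c * \<phi> x" if "x \<in> ?V" for c x
    proof (cases "0 \<le> c")
      case True
      then show ?thesis using sublinear_on_scale[OF \<phi>(1) that V] by simp
    next
      case False
      then show ?thesis
        using sublinear_on_scale[OF \<phi>(1) that V, of "- c"] neg[of "c *\<^sub>R x"] that
        by (simp add: span_scale)
    qed
  qed
qed

text \<open>Supplies the finite generating set for Hahn-Banach.\<close>

lemma span_monomials:
  "span ((\<lambda>\<alpha>. Poly_Mapping.single \<alpha> 1) ` exponents k) = {p :: 'v::finite mpoly. mpoly_deg p \<le> k}"
proof (intro subset_antisym subsetI)
  fix p :: "'v mpoly" assume "p \<in> {p. mpoly_deg p \<le> k}"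
  then have "Poly_Mapping.keys p \<subseteq> exponents k"
    by (simp add: mpoly_deg_le_iff)
  then have "p = (\<Sum>\<alpha>\<in>exponents k. Poly_Mapping.lookup p \<alpha> *\<^sub>R Poly_Mapping.single \<alpha> 1)"
    using mpoly_expand_superset[OF finite_exponents] by (simp add: scaleR_single)
  then show "p \<in> span ((\<lambda>\<alpha>. Poly_Mapping.single \<alpha> 1) ` exponents k)"
    by (metis (mono_tags, lifting) span_sum span_scale span_base imageI)
next
  fix p :: "'v mpoly" assume "p \<in> span ((\<lambda>\<alpha>. Poly_Mapping.single \<alpha> 1) ` exponents k)"
  then show "p \<in> {p. mpoly_deg p \<le> k}"
  proof (induction rule: span_induct_alt)
    case (step c x y)
    then obtain \<alpha> where "x = Poly_Mapping.single \<alpha> 1" "mono_deg \<alpha> \<le> k"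
      by (auto simp: exponents_def)
    then have "mpoly_deg x \<le> k"
      using mpoly_deg_single_le order_trans by blast
    then show ?case
      using step by (simp add: mpoly_deg_add_le mpoly_deg_scaleR_le)
  qed simp
qed

section \<open>Strong duality\<close>

text \<open>The converse of \<open>riesz_mult_power2_nonneg\<close>: a test vector is the
  coefficient vector of a polynomial \<open>q\<close>, and its quadratic form is the value at
  \<open>g * q ^ 2\<close>.\<close>

lemma psd_on_loc_matrixI:
  assumes "\<And>q. mpoly_deg q \<le> k \<Longrightarrow> 0 \<le> riesz z (g * q ^ 2)"
  shows "psd_on (exponents k) (loc_matrix g z)"
  unfolding psd_on_def
proof (intro conjI ballI allI)
  fix v :: "('a \<Rightarrow>\<^sub>0 nat) \<Rightarrow> real"
  define q where "q = (\<Sum>\<alpha>\<in>exponents k. Poly_Mapping.single \<alpha> (v \<alpha>))"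
  have lookup: "Poly_Mapping.lookup q \<alpha> = (if \<alpha> \<in> exponents k then v \<alpha> else 0)" for \<alpha>
    by (simp add: q_def lookup_sum lookup_single when_def finite_exponents)
  then have keys: "Poly_Mapping.keys q \<subseteq> exponents k"
    by (auto simp: in_keys_iff split: if_splits)
  have "riesz z (g * q ^ 2) = (\<Sum>i\<in>exponents k. \<Sum>j\<in>exponents k. v i * loc_matrix g z i j * v j)"
    unfolding power2_eq_gram_poly[OF finite_exponents keys] riesz_mult_gram_poly
    by (intro sum.cong) (auto simp: lookup)
  then show "0 \<le> (\<Sum>i\<in>exponents k. \<Sum>j\<in>exponents k. v i * loc_matrix g z i j * v j)"
    using assms[of q] keys by (simp add: mpoly_deg_le_iff)
qed (simp add: loc_matrix_def add.commute)

text \<open>The square of one variable is bounded by adding the squares of the others and the slack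
  \<open>N - M\<close> to the ball polynomial. The strict bound on the degree of \<open>q\<close>
  leaves room for the degree two of that polynomial.\<close>

lemma quad_module_ball:
  fixes q :: "'w::finite mpoly" and \<sigma> :: "'v::finite \<Rightarrow> 'w"
  assumes ball: "rename \<sigma> (ball_poly M) \<in> set gs" and q: "mpoly_deg q < r" and M: "real M \<le> N"
  shows "q ^ 2 * (of_real N - Var (\<sigma> a) ^ 2) \<in> quad_module gs r"
proof -
  let ?b = "rename \<sigma> (ball_poly M)"
  have "half_deg ?b \<le> 1"
    using mpoly_deg_rename_le[OF mpoly_deg_ball_poly] by (simp add: half_deg_le_iff)
  then have "q ^ 2 * ?b \<in> quad_module gs r"
    using ball q by (intro quad_moduleI SOS_power2) auto
  moreover have "mpoly_deg (q * Var (\<sigma> j)) \<le> r" for j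
    using q by (intro mpoly_deg_mult_le[OF order_refl mpoly_deg_Var_le]) simp
  then have "(\<Sum>j\<in>UNIV - {a}. (q * Var (\<sigma> j)) ^ 2) \<in> quad_module gs r"
    by (intro quad_module_sum quad_module_SOS SOS_power2)
  moreover have "(N - real M) *\<^sub>R q ^ 2 \<in> quad_module gs r"
    using q M by (intro quad_module_scaleR quad_module_SOS SOS_power2) auto
  moreover have "q ^ 2 * (of_real N - Var (\<sigma> a) ^ 2) =
      q ^ 2 * ?b + (\<Sum>j\<in>UNIV - {a}. (q * Var (\<sigma> j)) ^ 2) + (N - real M) *\<^sub>R q ^ 2"
  proof (rule mpoly_eqI)
    fix x :: "real ^ 'w"
    have "(norm (\<chi> i. x $ \<sigma> i))\<^sup>2 = (\<Sum>j\<in>UNIV. (x $ \<sigma> j)\<^sup>2)"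
      by (simp add: norm_vec_def L2_set_def sum_nonneg)
    also have "\<dots> = (x $ \<sigma> a)\<^sup>2 + (\<Sum>j\<in>UNIV - {a}. (x $ \<sigma> j)\<^sup>2)"
      by (simp add: sum.remove)
    finally have *: "(norm (\<chi> i. x $ \<sigma> i))\<^sup>2 = (x $ \<sigma> a)\<^sup>2 + (\<Sum>j\<in>UNIV - {a}. (x $ \<sigma> j)\<^sup>2)" .
    show "mpoly_eval (q ^ 2 * (of_real N - Var (\<sigma> a) ^ 2)) x =
        mpoly_eval (q ^ 2 * ?b + (\<Sum>j\<in>UNIV - {a}. (q * Var (\<sigma> j)) ^ 2) + (N - real M) *\<^sub>R q ^ 2) x"
      by (simp add: mpoly_eval_add mpoly_eval_mult mpoly_eval_power mpoly_eval_diff mpoly_eval_sum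
          mpoly_eval_Var mpoly_eval_rename mpoly_eval_ball_poly * power_mult_distrib
          flip: sum_distrib_left) (simp add: algebra_simps)
  qed
  ultimately show ?thesis
    by (simp add: quad_module_add)
qed

section \<open>Integrals over compact sets and the splitting of the variables\<close>

lemma integrable_lebesgue_on_compact:
  fixes g :: "'a::euclidean_space \<Rightarrow> real"
  assumes "compact K" "continuous_on K g"
  shows "integrable (lebesgue_on K) g"
proof -
  have "integrable lborel (\<lambda>x. indicator K x *\<^sub>R g x)"
    by (rule borel_integrable_compact) fact+
  then have "integrable lebesgue (\<lambda>x. indicator K x *\<^sub>R g x)"
    by (intro integrable_completion[THEN iffD2]) auto
  then show ?thesis
    using assms(1) by (subst integrable_restrict_space) (auto simp: compact_imp_closed)
qed

definition join :: "real ^ 'n \<Rightarrow> real ^ 'm \<Rightarrow> real ^ ('n::finite + 'm::finite)" where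
  "join x y = (\<chi> k. case k of Inl i \<Rightarrow> x $ i | Inr j \<Rightarrow> y $ j)"

lemma join_nth [simp]: "join x y $ Inl i = x $ i" "join x y $ Inr j = y $ j"
  by (simp_all add: join_def)

lemma join_proj: "join (\<chi> i. w $ Inl i) (\<chi> j. w $ Inr j) = w"
  by (simp add: vec_eq_iff join_def split: sum.split)

lemma mpoly_eval_rename_Inl_join [simp]: "mpoly_eval (rename Inl p) (join x y) = mpoly_eval p x"
  by (simp add: mpoly_eval_rename)

lemma mpoly_eval_rename_Inr_join [simp]: "mpoly_eval (rename Inr p) (join x y) = mpoly_eval p y"
  by (simp add: mpoly_eval_rename)

lemma mpoly_eval_hf_poly_join [simp]: "mpoly_eval (hf_poly f) (join x y) = hf_fun f x y"
  by (simp add: mpoly_eval_hf_poly)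

lemma join_mem_prod_constraints:
  "join x y \<in> basic_semialg (prod_constraints gS gB) \<longleftrightarrow> x \<in> basic_semialg gS \<and> y \<in> basic_semialg gB"
  by (simp add: basic_semialg_prod_constraints)

text \<open>A polynomial of degree zero is constant, but this one separates the origin from the
  all-ones vector. It forces \<open>min_order\<close> to be at least one, so that the variables in
  \<open>hf_poly f\<close> fit into order \<open>r\<close> even for constant
  \<open>f\<close>.\<close>

lemma mpoly_deg_ball_poly_pos:
  fixes \<sigma> :: "'v::finite \<Rightarrow> 'w::finite"
  shows "0 < mpoly_deg (rename \<sigma> (ball_poly N))"
proof (rule ccontr)
  assume "\<not> 0 < mpoly_deg (rename \<sigma> (ball_poly N))"
  then have "\<alpha> = 0" if "\<alpha> \<in> Poly_Mapping.keys (rename \<sigma> (ball_poly N))" for \<alpha>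
    using that mpoly_degD[of _ 0 \<alpha>] mono_split_single[of \<alpha>] by (metis le_zero_eq nat.simps(3) not_gr0)
  then have "mpoly_eval (rename \<sigma> (ball_poly N)) x = Poly_Mapping.lookup (rename \<sigma> (ball_poly N)) 0" for x
    using mpoly_eval_superset[of "{0}" "rename \<sigma> (ball_poly N)" x] by auto
  then have "mpoly_eval (rename \<sigma> (ball_poly N)) 0 = mpoly_eval (rename \<sigma> (ball_poly N)) (\<chi> i. 1)"
    by metis
  then have "(0 :: real ^ 'v) = (\<chi> i. 1)"
    by (simp add: mpoly_eval_rename mpoly_eval_ball_poly zero_vec_def[symmetric])
  then show False
    by (simp add: vec_eq_iff)
qed

lemma keys_rename: "Poly_Mapping.keys (rename \<sigma> p) \<subseteq> rename_mono \<sigma> ` Poly_Mapping.keys p"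
  unfolding rename_def by (rule subset_trans[OF keys_sum]) auto

lemma rename_add:
  fixes \<sigma> :: "'v::finite \<Rightarrow> 'w::finite"
  shows "rename \<sigma> (p + q) = rename \<sigma> p + rename \<sigma> q"
  by (rule mpoly_eqI) (simp add: mpoly_eval_rename mpoly_eval_add)

lemma rename_uminus:
  fixes \<sigma> :: "'v::finite \<Rightarrow> 'w::finite"
  shows "rename \<sigma> (- p) = - rename \<sigma> p"
  by (rule mpoly_eqI) (simp add: mpoly_eval_rename mpoly_eval_uminus)

lemma rename_scaleR:
  fixes \<sigma> :: "'v::finite \<Rightarrow> 'w::finite"
  shows "rename \<sigma> (c *\<^sub>R p) = c *\<^sub>R rename \<sigma> p"
  by (rule mpoly_eqI) (simp add: mpoly_eval_rename)

lemma rename_of_real: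
  fixes \<sigma> :: "'v::finite \<Rightarrow> 'w::finite"
  shows "rename \<sigma> (of_real c) = of_real c"
  by (rule mpoly_eqI) (simp add: mpoly_eval_rename)

section \<open>The value functional and the two programs\<close>

locale image_approximation =
  fixes f :: "'m::finite \<Rightarrow> ('n::finite) mpoly"
    and gS :: "'n mpoly list" and gB :: "'m mpoly list"
    and NS NB :: nat
  assumes S_nonempty: "basic_semialg gS \<noteq> {}"
    and compact_S: "compact (basic_semialg gS)"
    and compact_B: "compact (basic_semialg gB)"
    and image_subset: "poly_map f ` basic_semialg gS \<subseteq> basic_semialg gB"
    and ball_S: "ball_poly NS \<in> set gS"
    and ball_B: "ball_poly NB \<in> set gB"
begin

abbreviation "S \<equiv> basic_semialg gS"
abbreviation "B \<equiv> basic_semialg gB"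
abbreviation "Q \<equiv> quad_module (prod_constraints gS gB)"
abbreviation "obj \<equiv> primal_objective gB"

lemma ball_mem:
  "rename Inl (ball_poly NS) \<in> set (prod_constraints gS gB)"
  "rename Inr (ball_poly NB) \<in> set (prod_constraints gS gB)"
  using ball_S ball_B by (auto simp: prod_constraints_def)

lemma min_orderD:
  assumes "min_order f gS gB \<le> r"
  shows "g \<in> set (prod_constraints gS gB) \<Longrightarrow> half_deg g \<le> r"
    and "mpoly_deg (f j) \<le> r" and "1 \<le> r"
proof -
  show *: "half_deg g \<le> r" if "g \<in> set (prod_constraints gS gB)" for g
    using assms that unfolding min_order_def by (subst (asm) Max_le_iff) auto
  have "map_deg f \<le> r"
    using assms unfolding min_order_def by (subst (asm) Max_le_iff) auto
  then show "mpoly_deg (f j) \<le> r"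
    unfolding map_deg_def by (subst (asm) Max_le_iff) auto
  have "\<not> half_deg (rename Inl (ball_poly NS) :: ('n + 'm) mpoly) \<le> 0"
    unfolding half_deg_le_iff using mpoly_deg_ball_poly_pos by simp
  then show "1 \<le> r"
    using *[OF ball_mem(1)] by linarith
qed

text \<open>The sum of the two constants dominates each of them, so one constant serves both blocks
  of variables.\<close>

lemma arch:
  "mpoly_deg q < r \<Longrightarrow> q ^ 2 * (of_real (real NS + real NB) - Var k ^ 2) \<in> Q r"
  by (cases k; hypsubst; rule quad_module_ball[OF ball_mem(1)] quad_module_ball[OF ball_mem(2)]) auto

lemma order_unit:
  assumes "mpoly_deg p \<le> 2 * r"
  obtains c where "of_real c - p \<in> Q r"
  by (rule quad_module_order_unit[OF _ arch assms]) auto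

lemma Q_nonneg: "p \<in> Q r \<Longrightarrow> x \<in> S \<Longrightarrow> y \<in> B \<Longrightarrow> 0 \<le> mpoly_eval p (join x y)"
  by (rule quad_module_nonneg[OF _ join_mem_prod_constraints[THEN iffD2]]) auto

lemma integrable_mpoly: "integrable (lebesgue_on B) (mpoly_eval q)"
  by (intro integrable_lebesgue_on_compact compact_B continuous_on_mpoly_eval)

lemma integrable_mono: "integrable (lebesgue_on B) (mono_eval \<beta>)"
proof -
  have "mono_eval \<beta> = mpoly_eval (Poly_Mapping.single \<beta> 1)"
    by (simp add: fun_eq_iff)
  then show ?thesis
    using integrable_mpoly by simp
qed

lemma obj_eq_integral:
  assumes "mpoly_deg q \<le> 2 * r"
  shows "obj r q = (\<integral>y. mpoly_eval q y \<partial>lebesgue_on B)"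
proof -
  have "mpoly_eval q y = (\<Sum>\<beta>\<in>exponents (2 * r). Poly_Mapping.lookup q \<beta> * mono_eval \<beta> y)" for y
    using assms by (intro mpoly_eval_superset finite_exponents) (simp add: mpoly_deg_le_iff)
  then show ?thesis
    by (simp add: primal_objective_def leb_moment_def integrable_mono)
qed

text \<open>Fix any point of \<open>S\<close>: the values of \<open>rename Inr q\<close> do not
  depend on it, so \<open>q\<close> is nonnegative on \<open>B\<close>. This bounds the objective
  from below in \<open>dual_attained\<close>.\<close>

lemma obj_nonneg:
  assumes "mpoly_deg q \<le> 2 * r" "rename Inr q \<in> Q r"
  shows "0 \<le> obj r q"
proof -
  obtain x where "x \<in> S" using S_nonempty by blast
  then have "0 \<le> mpoly_eval q y" if "y \<in> B" for y
    using Q_nonneg[OF assms(2) _ that] by fastforce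
  then show ?thesis
    unfolding obj_eq_integral[OF assms(1)]
    by (intro Bochner_Integration.integral_nonneg_AE AE_I2) simp
qed

lemma obj_add: "obj r (p + q) = obj r p + obj r q"
  by (simp add: primal_objective_def lookup_add ring_distribs sum.distrib)

lemma obj_scaleR: "obj r (c *\<^sub>R p) = c * obj r p"
  by (simp add: primal_objective_def sum_distrib_left mult_ac)

lemma obj_uminus: "obj r (- p) = - obj r p"
  by (simp add: primal_objective_def sum_negf)

lemma deg_hf_summand:
  assumes "min_order f gS gB \<le> r"
  shows "mpoly_deg (Var (Inr j) - rename Inl (f j)) \<le> r"
  using min_orderD[OF assms] mpoly_deg_Var_le
  by (intro mpoly_deg_diff_le mpoly_deg_rename_le) (auto intro: order_trans)

lemma deg_hf:
  assumes "min_order f gS gB \<le> r"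
  shows "mpoly_deg (hf_poly f) \<le> 2 * r"
  unfolding hf_poly_def mpoly_deg_uminus
  by (intro mpoly_deg_sum_le mpoly_deg_power2_le deg_hf_summand assms)

text \<open>The negative of \<open>hf_poly f\<close> is itself a sum of squares.\<close>

lemma zero_primal_feasible:
  assumes "min_order f gS gB \<le> r"
  shows "0 \<in> primal_feasible f gS gB r"
proof -
  have "- hf_poly f \<in> Q r"
    unfolding hf_poly_def minus_minus
    by (intro quad_module_SOS SOS_sum SOS_power2 deg_hf_summand assms)
  then show ?thesis
    by (simp add: primal_feasible_def rename_def)
qed

lemma riesz_rename_Inr:
  assumes "z \<in> dual_feasible gS gB r" "mpoly_deg q \<le> 2 * r"
  shows "riesz z (rename Inr q) = obj r q"
proof -
  have "(rename Inr q :: ('n + 'm) mpoly) = (\<Sum>\<alpha>\<in>Poly_Mapping.keys q. Poly_Mapping.lookup q \<alpha> *\<^sub>R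
      Poly_Mapping.single (rename_mono Inr \<alpha>) 1)"
    by (simp add: rename_def scaleR_single)
  then have "riesz z (rename Inr q) = (\<Sum>\<alpha>\<in>Poly_Mapping.keys q. Poly_Mapping.lookup q \<alpha> *
      riesz z (Poly_Mapping.single (rename_mono Inr \<alpha>) 1))"
    by (simp only: riesz_sum riesz_scaleR)
  also have "\<dots> = (\<Sum>\<alpha>\<in>Poly_Mapping.keys q. Poly_Mapping.lookup q \<alpha> * leb_moment B \<alpha>)"
    using assms by (intro sum.cong) (auto simp: dual_feasible_def mpoly_deg_le_iff)
  also have "\<dots> = obj r q"
    unfolding primal_objective_def using assms(2) finite_exponents
    by (intro sum.mono_neutral_left) (auto simp: mpoly_deg_le_iff in_keys_iff)
  finally show ?thesis .
qed

lemma weak_duality: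
  assumes q: "q \<in> primal_feasible f gS gB r" and z: "z \<in> dual_feasible gS gB r"
  shows "riesz z (hf_poly f) \<le> obj r q"
proof -
  have "0 \<le> riesz z (rename Inr q - hf_poly f)"
    using q z by (intro riesz_quad_module_nonneg) (auto simp: primal_feasible_def dual_feasible_def)
  then show ?thesis
    using riesz_rename_Inr[OF z] q by (simp add: riesz_diff primal_feasible_def)
qed

lemma dual_attained:
  assumes r: "min_order f gS gB \<le> r"
  obtains z where "z \<in> dual_feasible gS gB r"
    "riesz z (hf_poly f) = Inf (obj r ` primal_feasible f gS gB r)"
proof -
  \<comment> \<open>At \<open>v = hf_poly f\<close> these are the feasible set and the value of the
    primal program.\<close>
  define W where "W v = {w. mpoly_deg w \<le> 2 * r \<and> rename Inr w - v \<in> Q r}" for v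
  define P where "P v = Inf (obj r ` W v)" for v
  let ?X = "(\<lambda>\<alpha>. Poly_Mapping.single \<alpha> 1) ` exponents (2 * r) :: ('n + 'm) mpoly set"
  have V: "v \<in> span ?X \<longleftrightarrow> mpoly_deg v \<le> 2 * r" for v
    by (simp add: span_monomials)
  have nonempty: "W v \<noteq> {}" if deg: "mpoly_deg v \<le> 2 * r" for v
    using order_unit[OF deg] by (metis (mono_tags, lifting) W_def empty_iff mem_Collect_eq
        mpoly_deg_of_real rename_of_real zero_le)
  \<comment> \<open>If \<open>c + v\<close> is in the module, then so is
    \<open>w + c = (w - v) + (c + v)\<close> for every admissible \<open>w\<close>, whose objective
    is therefore at least that of \<open>- c\<close>.\<close>
  have lower: "\<exists>b. \<forall>w\<in>W v. b \<le> obj r w" if deg: "mpoly_deg v \<le> 2 * r" for v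
  proof -
    obtain c where c: "of_real c - (- v) \<in> Q r"
      using order_unit[of "- v"] deg by auto
    have "- obj r (of_real c) \<le> obj r w" if "w \<in> W v" for w
    proof -
      have "rename Inr (w + of_real c) \<in> Q r"
        using quad_module_add[OF _ c] that by (force simp: W_def rename_add rename_of_real)
      moreover have "mpoly_deg (w + of_real c) \<le> 2 * r"
        using that by (intro mpoly_deg_add_le) (auto simp: W_def)
      ultimately show ?thesis
        using obj_nonneg[of "w + of_real c" r] by (simp add: obj_add)
    qed
    then show ?thesis by blast
  qed
  have bdd: "bdd_below (obj r ` W v)" if "mpoly_deg v \<le> 2 * r" for v
    using lower[OF that] by (auto simp: bdd_below_def)
  have P_le: "P v \<le> obj r w" if "mpoly_deg v \<le> 2 * r" "w \<in> W v" for v w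
    unfolding P_def using bdd that by (auto intro!: cInf_lower)
  have le_P: "b \<le> P v" if "mpoly_deg v \<le> 2 * r" "\<And>w. w \<in> W v \<Longrightarrow> b \<le> obj r w" for b v
    unfolding P_def using nonempty that by (intro cInf_greatest) auto
  have sub: "sublinear_on (span ?X) P"
    unfolding sublinear_on_def V
  proof (intro conjI ballI allI impI)
    fix u v assume "u \<in> span ?X" "v \<in> span ?X"
    then have uv: "mpoly_deg u \<le> 2 * r" "mpoly_deg v \<le> 2 * r" by (simp_all add: V)
    have "P (u + v) \<le> obj r a + obj r b" if "a \<in> W u" "b \<in> W v" for a b
    proof -
      have eq: "rename Inr (a + b) - (u + v) = (rename Inr a - u) + (rename Inr b - v)"
        by (simp add: rename_add)
      have "rename Inr (a + b) - (u + v) \<in> Q r"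
        unfolding eq using that by (intro quad_module_add) (auto simp: W_def)
      then have "a + b \<in> W (u + v)"
        using that unfolding W_def by (simp add: mpoly_deg_add_le)
      then have "P (u + v) \<le> obj r (a + b)"
        using uv by (intro P_le mpoly_deg_add_le)
      then show ?thesis by (simp add: obj_add)
    qed
    then have "P (u + v) - obj r b \<le> P u" if "b \<in> W v" for b
      using that uv by (intro le_P) (auto simp: algebra_simps)
    then have "P (u + v) - P u \<le> P v"
      using uv by (intro le_P) (auto simp: algebra_simps)
    then show "P (u + v) \<le> P u + P v" by simp
  next
    fix c :: real and v assume "0 < c" "v \<in> span ?X"
    then have v: "mpoly_deg v \<le> 2 * r" by (simp add: V)
    have "inverse c * P (c *\<^sub>R v) \<le> obj r w" if "w \<in> W v" for w
    proof -
      have "rename Inr (c *\<^sub>R w) - c *\<^sub>R v = c *\<^sub>R (rename Inr w - v)"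
        by (simp add: rename_scaleR scaleR_diff_right)
      then have "c *\<^sub>R w \<in> W (c *\<^sub>R v)"
        using that quad_module_scaleR[of _ _ r c] \<open>0 < c\<close> unfolding W_def
        by (auto intro!: mpoly_deg_scaleR_le)
      then have "P (c *\<^sub>R v) \<le> obj r (c *\<^sub>R w)"
        using v by (intro P_le mpoly_deg_scaleR_le)
      then show ?thesis
        using \<open>0 < c\<close> by (simp add: obj_scaleR field_simps)
    qed
    then have "inverse c * P (c *\<^sub>R v) \<le> P v"
      by (rule le_P[OF v])
    then show "P (c *\<^sub>R v) \<le> c * P v"
      using \<open>0 < c\<close> by (simp add: field_simps)
  qed
  have hf: "hf_poly f \<in> span ?X"
    using deg_hf[OF r] by (simp add: V)
  have fin: "finite ?X"
    by (intro finite_imageI finite_exponents)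
  obtain \<phi> where \<phi>:
    "\<And>v. v \<in> span ?X \<Longrightarrow> \<phi> v \<le> P v" "\<phi> (hf_poly f) = P (hf_poly f)"
    "\<And>u v. u \<in> span ?X \<Longrightarrow> v \<in> span ?X \<Longrightarrow> \<phi> (u + v) = \<phi> u + \<phi> v"
    "\<And>c v. v \<in> span ?X \<Longrightarrow> \<phi> (c *\<^sub>R v) = c * \<phi> v"
    by (rule finite_dim_hahn_banach[OF fin sub hf], rule that)
  note \<phi> = \<phi>[unfolded V]
  have \<phi>_zero: "\<phi> 0 = 0"
    using \<phi>(4)[of 0 0] by simp
  define z where "z = restrict (\<lambda>\<alpha>. \<phi> (Poly_Mapping.single \<alpha> 1)) (exponents (2 * r))"
  have riesz_z: "riesz z v = \<phi> v" if deg: "mpoly_deg v \<le> 2 * r" for v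
  proof -
    have deg_sum: "mpoly_deg (\<Sum>\<alpha>\<in>A. Poly_Mapping.lookup v \<alpha> *\<^sub>R Poly_Mapping.single \<alpha> 1) \<le> 2 * r"
      if "A \<subseteq> exponents (2 * r)" for A
      using that by (intro mpoly_deg_sum_le mpoly_deg_scaleR_le order_trans[OF mpoly_deg_single_le])
        (auto simp: exponents_def)
    have "\<phi> (\<Sum>\<alpha>\<in>A. Poly_Mapping.lookup v \<alpha> *\<^sub>R Poly_Mapping.single \<alpha> 1) =
        (\<Sum>\<alpha>\<in>A. Poly_Mapping.lookup v \<alpha> * z \<alpha>)" if "finite A" "A \<subseteq> exponents (2 * r)" for A
      using that
    proof (induction A)
      case (insert \<alpha> A)
      have 1: "mpoly_deg (Poly_Mapping.single \<alpha> 1) \<le> 2 * r"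
        using insert.prems by (intro order_trans[OF mpoly_deg_single_le]) (auto simp: exponents_def)
      have "\<phi> (Poly_Mapping.lookup v \<alpha> *\<^sub>R Poly_Mapping.single \<alpha> 1 +
          (\<Sum>\<alpha>\<in>A. Poly_Mapping.lookup v \<alpha> *\<^sub>R Poly_Mapping.single \<alpha> 1)) =
          Poly_Mapping.lookup v \<alpha> * z \<alpha> + (\<Sum>\<alpha>\<in>A. Poly_Mapping.lookup v \<alpha> * z \<alpha>)"
        using insert 1 \<phi>(3)[OF mpoly_deg_scaleR_le[OF 1] deg_sum[of A]] \<phi>(4)[OF 1]
        by (simp add: z_def)
      then show ?case using insert by simp
    qed (simp add: \<phi>_zero)
    from this[OF finite_exponents order_refl] deg show ?thesis
      using riesz_superset[OF finite_exponents, of v "2 * r" z]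
        mpoly_expand_superset[OF finite_exponents, of v "2 * r"]
      by (simp add: mpoly_deg_le_iff scaleR_single)
  qed
  \<comment> \<open>For \<open>v\<close> in the module the zero polynomial is admissible for
    \<open>- v\<close>, so \<open>\<phi> (- v)\<close> is at most zero.\<close>
  have \<phi>_Q: "0 \<le> \<phi> v" if "v \<in> Q r" "mpoly_deg v \<le> 2 * r" for v
  proof -
    have "0 \<in> W (- v)"
      using that by (simp add: W_def rename_def)
    then have "P (- v) \<le> obj r 0"
      using that by (intro P_le) auto
    then have "\<phi> (- v) \<le> 0"
      using \<phi>(1)[of "- v"] that by (simp add: primal_objective_def)
    then show ?thesis
      using \<phi>(4)[of v "-1"] that by simp
  qed
  have psd: "psd_on (exponents (r - half_deg g)) (loc_matrix g z)"
    if g: "g \<in> set (1 # prod_constraints gS gB)" for g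
  proof (rule psd_on_loc_matrixI)
    fix q :: "('n + 'm) mpoly" assume q: "mpoly_deg q \<le> r - half_deg g"
    \<comment> \<open>Makes the natural number subtraction exact, so that \<open>g * q ^ 2\<close>
      has degree at most \<open>2 * r\<close>, where \<open>z\<close> represents \<phi>.\<close>
    have "half_deg g \<le> r"
      using g min_orderD(1)[OF r] by auto
    then have "mpoly_deg (g * q ^ 2) \<le> 2 * r"
      by (intro mpoly_deg_mult_le[OF mpoly_deg_le_half_deg mpoly_deg_power2_le[OF q]]) simp
    moreover have "g * q ^ 2 \<in> Q r"
      using quad_moduleI[OF g SOS_power2[OF q]] by (simp add: mult.commute)
    ultimately show "0 \<le> riesz z (g * q ^ 2)"
      by (simp add: riesz_z \<phi>_Q)
  qed
  have moment: "riesz z (Poly_Mapping.single (rename_mono Inr \<beta>) 1) = leb_moment B \<beta>"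
    if \<beta>: "\<beta> \<in> exponents (2 * r)" for \<beta>
  proof -
    let ?w = "Poly_Mapping.single \<beta> 1 :: 'm mpoly"
    have rn: "rename Inr ?w = (Poly_Mapping.single (rename_mono Inr \<beta>) 1 :: ('n + 'm) mpoly)"
      by (simp add: rename_def)
    have deg: "mpoly_deg ?w \<le> 2 * r"
      using \<beta> by (intro order_trans[OF mpoly_deg_single_le]) (simp add: exponents_def)
    have deg': "mpoly_deg (rename Inr ?w :: ('n + 'm) mpoly) \<le> 2 * r"
      by (rule mpoly_deg_rename_le[OF deg])
    \<comment> \<open>A polynomial \<open>w\<close> in the variables of \<open>B\<close> is
      admissible for itself, with difference zero. The same bound at \<open>- w\<close> turns this
      into equality, which is the moment condition.\<close>
    have "\<phi> (rename Inr w) \<le> obj r w" if w: "mpoly_deg w \<le> 2 * r" for w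
      using w \<phi>(1)[OF mpoly_deg_rename_le[OF w, where \<sigma> = Inr]]
        P_le[OF mpoly_deg_rename_le[OF w, where \<sigma> = Inr], of w]
      by (simp add: W_def order_trans)
    from this[of ?w] this[of "- ?w"] deg
    have "\<phi> (rename Inr ?w) \<le> obj r ?w" "\<phi> (- rename Inr ?w) \<le> obj r (- ?w)"
      by (simp_all add: rename_uminus)
    then have "\<phi> (rename Inr ?w) = obj r ?w"
      using \<phi>(4)[OF deg', of "-1"] by (simp add: obj_uminus)
    moreover have "obj r ?w = leb_moment B \<beta>"
    proof -
      have "obj r ?w = (\<Sum>\<gamma>\<in>exponents (2 * r). if \<gamma> = \<beta> then leb_moment B \<beta> else 0)"
        unfolding primal_objective_def by (intro sum.cong) (auto simp: lookup_single when_def)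
      then show ?thesis
        using \<beta> by (simp add: finite_exponents)
    qed
    ultimately show ?thesis
      using riesz_z[OF deg'] by (simp add: rn)
  qed
  show ?thesis
  proof (rule that)
    show "z \<in> dual_feasible gS gB r"
      using psd[of 1] psd moment by (auto simp: dual_feasible_def z_def)
    show "riesz z (hf_poly f) = Inf (obj r ` primal_feasible f gS gB r)"
      using riesz_z[OF deg_hf[OF r]] \<phi>(2) by (simp add: P_def W_def primal_feasible_def)
  qed
qed

text \<open>The common value as a real number. It is finite from \<open>min_order\<close> on, where
  the two extended real values are shown to equal it.\<close>

definition opt :: "nat \<Rightarrow> real" where
  "opt r = Inf (obj r ` primal_feasible f gS gB r)"

lemma opt_le:
  assumes "min_order f gS gB \<le> r" "q \<in> primal_feasible f gS gB r"
  shows "opt r \<le> obj r q"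
  using dual_attained[OF assms(1)] weak_duality[OF assms(2)] unfolding opt_def by metis

lemma primal_value_eq:
  assumes r: "min_order f gS gB \<le> r"
  shows "primal_value f gS gB r = ereal (opt r)"
proof -
  have "bdd_below (obj r ` primal_feasible f gS gB r)"
    using opt_le[OF r] by (auto intro!: bdd_belowI2)
  then show ?thesis
    using zero_primal_feasible[OF r] ereal_Inf'[of "obj r ` primal_feasible f gS gB r"]
    unfolding primal_value_def opt_def image_image by (metis empty_iff image_is_empty)
qed

lemma dual_value_eq:
  assumes r: "min_order f gS gB \<le> r"
  shows "dual_value f gS gB r = ereal (opt r)" "\<exists>z. dual_optimal f gS gB r z"
proof -
  obtain z where z: "z \<in> dual_feasible gS gB r" "riesz z (hf_poly f) = opt r"
    using dual_attained[OF r] unfolding opt_def by metis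
  have "riesz z' (hf_poly f) \<le> opt r" if "z' \<in> dual_feasible gS gB r" for z'
    unfolding opt_def using zero_primal_feasible[OF r] weak_duality[OF _ that]
    by (intro cInf_greatest) auto
  then show *: "dual_value f gS gB r = ereal (opt r)"
    unfolding dual_value_def using z
    by (intro antisym SUP_least) (auto intro: SUP_upper2)
  show "\<exists>z. dual_optimal f gS gB r z"
    using z * by (auto simp: dual_optimal_def)
qed

lemma primal_optimal_iff:
  assumes "min_order f gS gB \<le> r"
  shows "primal_optimal f gS gB r q \<longleftrightarrow> q \<in> primal_feasible f gS gB r \<and> obj r q = opt r"
  by (simp add: primal_optimal_def primal_value_eq[OF assms])

end

section \<open>Bernstein expansions on a box\<close>

text \<open>Since \<open>(n choose k) * (k choose a) = (n choose a) * ((n - a) choose (k -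
  a))\<close>, an index shift leaves \<open>u ^ a\<close> times the binomial expansion of
  \<open>(u + (1 - u)) ^ (n - a)\<close>.\<close>

lemma power_eq_bernstein_sum:
  fixes u :: real
  assumes "a \<le> n"
  shows "u ^ a = (\<Sum>k\<le>n. (real (k choose a) / real (n choose a)) * (real (n choose k) * (u ^ k * (1 - u) ^ (n - k))))"
proof -
  have "(\<Sum>k\<le>n. real (k choose a) * (real (n choose k) * (u ^ k * (1 - u) ^ (n - k)))) =
      (\<Sum>k\<in>{a..n}. real (k choose a) * (real (n choose k) * (u ^ k * (1 - u) ^ (n - k))))"
    by (intro sum.mono_neutral_right) auto
  also have "\<dots> = (\<Sum>k\<in>{a..n}. real (n choose a) * (real ((n - a) choose (k - a)) * (u ^ k * (1 - u) ^ (n - k))))"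
  proof (intro sum.cong refl)
    fix k assume "k \<in> {a..n}"
    then have "real (k choose a) * real (n choose k) = real (n choose a) * real ((n - a) choose (k - a))"
      using choose_mult[of a k n] by (metis atLeastAtMost_iff mult.commute of_nat_mult)
    then show "real (k choose a) * (real (n choose k) * (u ^ k * (1 - u) ^ (n - k))) =
        real (n choose a) * (real ((n - a) choose (k - a)) * (u ^ k * (1 - u) ^ (n - k)))"
      by (simp flip: mult.assoc)
  qed
  also have "\<dots> = real (n choose a) * (\<Sum>k\<in>{0 + a..(n - a) + a}. real ((n - a) choose (k - a)) * (u ^ k * (1 - u) ^ (n - k)))"
    using assms by (simp add: sum_distrib_left)
  also have "\<dots> = real (n choose a) * (\<Sum>k\<le>n - a. real ((n - a) choose k) * (u ^ (k + a) * (1 - u) ^ (n - (k + a))))"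
    by (subst sum.shift_bounds_cl_nat_ivl) (simp add: atMost_atLeast0)
  also have "\<dots> = real (n choose a) * (u ^ a * (\<Sum>k\<le>n - a. real ((n - a) choose k) * u ^ k * (1 - u) ^ (n - a - k)))"
    by (simp add: sum_distrib_left power_add mult_ac add.commute)
  also have "(\<Sum>k\<le>n - a. real ((n - a) choose k) * u ^ k * (1 - u) ^ (n - a - k)) = 1"
    using binomial_ring[of u "1 - u" "n - a"] by simp
  finally show ?thesis
    using assms by (simp add: field_simps flip: sum_divide_distrib)
qed

text \<open>The quotient is a product of the \<open>a\<close> factors
  \<open>(k - j) / (n - j)\<close>, each close to \<open>k / n\<close>. For factors of modulus at
  most one, the difference of two products is at most the sum of the differences.\<close>

lemma choose_ratio_approx:
  assumes "a \<le> D" "k \<le> n" "2 * D < n"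
  shows "\<bar>real (k choose a) / real (n choose a) - (real k / real n) ^ a\<bar> \<le> real D * (real D / (real n - real D))"
proof -
  have ratio: "real (k choose a) / real (n choose a) = (\<Prod>j<a. (real k - real j) / (real n - real j))"
    by (simp add: binomial_gbinomial gbinomial_prod_rev prod_dividef atLeast0LessThan)
  \<comment> \<open>For \<open>k < j\<close> the factor is negative; \<open>2 * D < n\<close> keeps
    its modulus at most one.\<close>
  have bound: "\<bar>(real k - real j) / (real n - real j)\<bar> \<le> 1"
    "\<bar>(real k - real j) / (real n - real j) - real k / real n\<bar> \<le> real D / (real n - real D)" if "j < a" for j
  proof -
    have pos: "0 < real n - real j" "0 < real n" "real j \<le> real D" "0 < real n - real D"
      using that assms by linarith+
    have "real k \<le> real n" "2 * real D < real n"
      using assms by linarith+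
    then have "\<bar>real k - real j\<bar> \<le> real n - real j"
      using pos by linarith
    then show "\<bar>(real k - real j) / (real n - real j)\<bar> \<le> 1"
      using pos by simp
    have "(real k - real j) / (real n - real j) - real k / real n =
        - (real j / (real n - real j)) * ((real n - real k) / real n)"
      using pos by (simp add: field_simps)
    then have "\<bar>(real k - real j) / (real n - real j) - real k / real n\<bar> =
        (real j / (real n - real j)) * ((real n - real k) / real n)"
      using pos \<open>real k \<le> real n\<close> by (simp add: abs_mult)
    also have "\<dots> \<le> (real j / (real n - real j)) * 1"
      using pos by (intro mult_left_mono) auto
    also have "\<dots> \<le> real D / (real n - real D)"
      using pos by (simp add: frac_le)
    finally show "\<bar>(real k - real j) / (real n - real j) - real k / real n\<bar> \<le> real D / (real n - real D)" .
  qed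
  have "\<bar>(\<Prod>j<a. (real k - real j) / (real n - real j)) - (\<Prod>j<a. real k / real n)\<bar> \<le>
      (\<Sum>j<a. \<bar>(real k - real j) / (real n - real j) - real k / real n\<bar>)"
    using bound(1) assms
    by (intro norm_prod_diff[where 'a = real, unfolded real_norm_def]) auto
  also have "\<dots> \<le> (\<Sum>j<a. real D / (real n - real D))"
    using bound(2) by (intro sum_mono) auto
  also have "\<dots> \<le> real D * (real D / (real n - real D))"
    using assms by (simp add: mult_right_mono divide_right_mono)
  finally show ?thesis
    by (simp add: ratio)
qed

text \<open>The coefficient at \<open>\<kappa>\<close> in the tensor product Bernstein basis of
  degree \<open>n\<close> in each variable, on the unit cube.\<close>

definition bernstein_coeff :: "('v::finite) mpoly \<Rightarrow> nat \<Rightarrow> ('v \<Rightarrow> nat) \<Rightarrow> real" where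
  "bernstein_coeff p n \<kappa> = (\<Sum>\<alpha>\<in>Poly_Mapping.keys p. Poly_Mapping.lookup p \<alpha> *
     (\<Prod>i\<in>UNIV. real (\<kappa> i choose Poly_Mapping.lookup \<alpha> i) / real (n choose Poly_Mapping.lookup \<alpha> i)))"

lemma lookup_le_mono_deg: "Poly_Mapping.lookup \<alpha> i \<le> mono_deg \<alpha>"
  unfolding mono_deg_def by (rule member_le_sum) auto

lemma mpoly_eval_bernstein:
  assumes "mpoly_deg p \<le> n"
  shows "mpoly_eval p u = (\<Sum>\<kappa>\<in>UNIV \<rightarrow>\<^sub>E {..n}. bernstein_coeff p n \<kappa> *
    (\<Prod>i\<in>UNIV. real (n choose \<kappa> i) * ((u $ i) ^ \<kappa> i * (1 - u $ i) ^ (n - \<kappa> i))))"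
proof -
  let ?b = "\<lambda>\<kappa>. \<Prod>i\<in>UNIV. real (n choose \<kappa> i) * ((u $ i) ^ \<kappa> i * (1 - u $ i) ^ (n - \<kappa> i))"
  have "mono_eval \<alpha> u = (\<Sum>\<kappa>\<in>UNIV \<rightarrow>\<^sub>E {..n}.
      (\<Prod>i\<in>UNIV. real (\<kappa> i choose Poly_Mapping.lookup \<alpha> i) / real (n choose Poly_Mapping.lookup \<alpha> i)) * ?b \<kappa>)"
    if "\<alpha> \<in> Poly_Mapping.keys p" for \<alpha>
  proof -
    have "Poly_Mapping.lookup \<alpha> i \<le> n" for i
      using lookup_le_mono_deg[of \<alpha> i] mpoly_degD[OF assms that] by linarith
    then have "mono_eval \<alpha> u = (\<Prod>i\<in>UNIV. \<Sum>k\<le>n. (real (k choose Poly_Mapping.lookup \<alpha> i) /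
        real (n choose Poly_Mapping.lookup \<alpha> i)) * (real (n choose k) * ((u $ i) ^ k * (1 - u $ i) ^ (n - k))))"
      unfolding mono_eval_def by (intro prod.cong refl power_eq_bernstein_sum)
    then show ?thesis
      by (simp add: prod_sum_PiE flip: prod.distrib)
  qed
  then have "mpoly_eval p u = (\<Sum>\<alpha>\<in>Poly_Mapping.keys p. \<Sum>\<kappa>\<in>UNIV \<rightarrow>\<^sub>E {..n}. Poly_Mapping.lookup p \<alpha> *
      ((\<Prod>i\<in>UNIV. real (\<kappa> i choose Poly_Mapping.lookup \<alpha> i) / real (n choose Poly_Mapping.lookup \<alpha> i)) * ?b \<kappa>))"
    unfolding mpoly_eval_def by (intro sum.cong refl) (simp only: sum_distrib_left)
  also have "\<dots> = (\<Sum>\<kappa>\<in>UNIV \<rightarrow>\<^sub>E {..n}. bernstein_coeff p n \<kappa> * ?b \<kappa>)"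
    unfolding bernstein_coeff_def sum_distrib_right by (subst sum.swap) (simp only: mult.assoc)
  finally show ?thesis .
qed

text \<open>Monomial by monomial, both sides are products over the variables of numbers in the unit
  interval, which are compared factor by factor. For fixed \<open>p\<close> the error is of order
  \<open>1 / n\<close>, uniformly in \<open>\<kappa>\<close>.\<close>

lemma bernstein_coeff_approx:
  fixes p :: "'v::finite mpoly"
  assumes D: "mpoly_deg p \<le> D" and n: "2 * D < n" and \<kappa>: "\<And>i. \<kappa> i \<le> n"
  shows "\<bar>bernstein_coeff p n \<kappa> - mpoly_eval p (\<chi> i. real (\<kappa> i) / real n)\<bar> \<le>
    (\<Sum>\<alpha>\<in>Poly_Mapping.keys p. \<bar>Poly_Mapping.lookup p \<alpha>\<bar>) * (real CARD('v) * (real D * (real D / (real n - real D))))"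
proof -
  let ?e = "real D * (real D / (real n - real D))"
  let ?c = "\<lambda>\<alpha> i. real (\<kappa> i choose Poly_Mapping.lookup \<alpha> i) / real (n choose Poly_Mapping.lookup \<alpha> i)"
  let ?u = "\<chi> i. real (\<kappa> i) / real n"
  have mono: "\<bar>(\<Prod>i\<in>UNIV. ?c \<alpha> i) - mono_eval \<alpha> ?u\<bar> \<le> real CARD('v) * ?e"
    if "\<alpha> \<in> Poly_Mapping.keys p" for \<alpha>
  proof -
    have le: "Poly_Mapping.lookup \<alpha> i \<le> D" for i
      using lookup_le_mono_deg[of \<alpha> i] mpoly_degD[OF D that] by linarith
    have "?c \<alpha> i \<le> 1" for i
      using binomial_right_mono[OF \<kappa>] by (auto simp: divide_le_eq_1)
    have "(real (\<kappa> i) / real n) ^ k \<le> 1" for i k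
      using \<kappa>[of i] by (intro power_le_one) (auto simp: divide_le_eq_1)
    have "\<bar>(\<Prod>i\<in>UNIV. ?c \<alpha> i) - (\<Prod>i\<in>UNIV. (real (\<kappa> i) / real n) ^ Poly_Mapping.lookup \<alpha> i)\<bar> \<le>
        (\<Sum>i\<in>UNIV. \<bar>?c \<alpha> i - (real (\<kappa> i) / real n) ^ Poly_Mapping.lookup \<alpha> i\<bar>)"
      using \<open>\<And>i. ?c \<alpha> i \<le> 1\<close> \<open>\<And>i k. (real (\<kappa> i) / real n) ^ k \<le> 1\<close>
      by (intro norm_prod_diff[where 'a = real, unfolded real_norm_def]) auto
    also have "\<dots> \<le> (\<Sum>i\<in>(UNIV::'v set). ?e)"
      by (intro sum_mono choose_ratio_approx le \<kappa> n)
    finally show ?thesis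
      by (simp add: mono_eval_def)
  qed
  have "bernstein_coeff p n \<kappa> - mpoly_eval p ?u =
      (\<Sum>\<alpha>\<in>Poly_Mapping.keys p. Poly_Mapping.lookup p \<alpha> * ((\<Prod>i\<in>UNIV. ?c \<alpha> i) - mono_eval \<alpha> ?u))"
    by (simp add: bernstein_coeff_def mpoly_eval_def right_diff_distrib sum_subtractf)
  also have "\<bar>\<dots>\<bar> \<le> (\<Sum>\<alpha>\<in>Poly_Mapping.keys p. \<bar>Poly_Mapping.lookup p \<alpha>\<bar> * (real CARD('v) * ?e))"
    by (rule order_trans[OF sum_abs]) (intro sum_mono, simp only: abs_mult, intro mult_left_mono mono, auto)
  finally show ?thesis
    by (simp only: sum_distrib_right)
qed

text \<open>The coefficients approach the values at the grid points uniformly, and these values are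
  at least the positive minimum over the cube.\<close>

lemma bernstein_coeff_pos:
  fixes p :: "'v::finite mpoly"
  assumes "\<And>u. (\<And>i. 0 \<le> u $ i \<and> u $ i \<le> 1) \<Longrightarrow> 0 < mpoly_eval p u"
  obtains n where "mpoly_deg p \<le> n" "\<And>\<kappa>. (\<And>i. \<kappa> i \<le> n) \<Longrightarrow> 0 < bernstein_coeff p n \<kappa>"
proof -
  let ?C = "cbox (\<chi> i. 0) (\<chi> i. 1) :: (real ^ 'v) set" and ?D = "mpoly_deg p"
  have "(\<chi> i. 0) \<in> ?C"
    by (simp add: mem_box_cart)
  then have "\<exists>u\<in>?C. \<forall>v\<in>?C. mpoly_eval p u \<le> mpoly_eval p v"
    by (intro continuous_attains_inf compact_cbox continuous_on_mpoly_eval) auto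
  then obtain u where u: "u \<in> ?C" "\<And>v. v \<in> ?C \<Longrightarrow> mpoly_eval p u \<le> mpoly_eval p v"
    by blast
  define \<epsilon> where "\<epsilon> = mpoly_eval p u"
  have "0 < \<epsilon>"
    using assms[of u] u(1) by (auto simp: mem_box_cart \<epsilon>_def)
  define M where "M = (\<Sum>\<alpha>\<in>Poly_Mapping.keys p. \<bar>Poly_Mapping.lookup p \<alpha>\<bar>) * (real CARD('v) * (real ?D * real ?D))"
  obtain n0 :: nat where n0: "M / \<epsilon> < real n0"
    using reals_Archimedean2 by blast
  \<comment> \<open>The part \<open>2 * ?D + 1\<close> meets the hypothesis of the approximation
    lemma; \<open>n0\<close> pushes the error \<open>M / (n - ?D)\<close> below \<epsilon>.\<close>
  define n where "n = n0 + 2 * ?D + 1"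
  show ?thesis
  proof (rule that)
    fix \<kappa> :: "'v \<Rightarrow> nat" assume \<kappa>: "\<And>i. \<kappa> i \<le> n"
    have "real (\<kappa> i) \<le> real n" for i
      using \<kappa> by simp
    then have "(\<chi> i. real (\<kappa> i) / real n) \<in> ?C"
      by (auto simp: mem_box_cart divide_le_eq_1)
    then have "\<epsilon> \<le> mpoly_eval p (\<chi> i. real (\<kappa> i) / real n)"
      unfolding \<epsilon>_def by (rule u(2))
    moreover have "\<bar>bernstein_coeff p n \<kappa> - mpoly_eval p (\<chi> i. real (\<kappa> i) / real n)\<bar> \<le> M / (real n - real ?D)"
      using bernstein_coeff_approx[of p ?D n \<kappa>] \<kappa> by (simp add: M_def n_def)
    moreover have "M / (real n - real ?D) < \<epsilon>"
    proof -
      have "M < real n0 * \<epsilon>"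
        using n0 \<open>0 < \<epsilon>\<close> by (simp add: field_simps)
      also have "\<dots> \<le> (real n - real ?D) * \<epsilon>"
        using \<open>0 < \<epsilon>\<close> by (intro mult_right_mono) (auto simp: n_def)
      finally show ?thesis
        by (simp add: divide_less_eq n_def mult.commute)
    qed
    ultimately show "0 < bernstein_coeff p n \<kappa>"
      by linarith
  qed (simp add: n_def)
qed

section \<open>Putinar's Positivstellensatz\<close>

definition sum_squares :: "('v::finite) mpoly set" where
  "sum_squares = (\<Union>r. SOS r)"

lemma sum_squares_power2: "q ^ 2 \<in> sum_squares"
  by (auto simp: sum_squares_def intro: SOS_power2)

lemma sum_squares_add: "p \<in> sum_squares \<Longrightarrow> q \<in> sum_squares \<Longrightarrow> p + q \<in> sum_squares"
  unfolding sum_squares_def by (metis SOS_add SOS_mono UN_iff UNIV_I linorder_linear)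

lemma sum_squares_zero: "0 \<in> sum_squares"
  by (simp add: sum_squares_def)

lemma sum_squares_scaleR: "p \<in> sum_squares \<Longrightarrow> 0 \<le> c \<Longrightarrow> c *\<^sub>R p \<in> sum_squares"
  by (auto simp: sum_squares_def intro: SOS_scaleR)

lemma sum_squares_obtain:
  assumes "p \<in> sum_squares"
  obtains qs where "p = (\<Sum>q\<leftarrow>qs. q ^ 2)"
  using assms by (auto simp: sum_squares_def SOS_def)

lemma sum_squares_sum_list: "(\<Sum>q\<leftarrow>qs. q ^ 2) \<in> sum_squares"
  by (induction qs) (auto simp: sum_squares_zero sum_squares_add sum_squares_power2)

lemma sum_squares_mult:
  assumes "p \<in> sum_squares" "q \<in> sum_squares"
  shows "p * q \<in> sum_squares"
proof -
  obtain ps where ps: "p = (\<Sum>q\<leftarrow>ps. q ^ 2)"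
    using assms(1) by (rule sum_squares_obtain)
  obtain qs where qs: "q = (\<Sum>q\<leftarrow>qs. q ^ 2)"
    using assms(2) by (rule sum_squares_obtain)
  have "a ^ 2 * (\<Sum>q\<leftarrow>qs. q ^ 2) = (\<Sum>q\<leftarrow>map ((*) a) qs. q ^ 2)" for a
    by (induction qs) (simp_all add: ring_distribs power_mult_distrib)
  then have *: "a ^ 2 * (\<Sum>q\<leftarrow>qs. q ^ 2) \<in> sum_squares" for a
    by (metis sum_squares_sum_list)
  have "(\<Sum>q\<leftarrow>ps. q ^ 2) * (\<Sum>q\<leftarrow>qs. q ^ 2) \<in> sum_squares"
    by (induction ps) (auto simp: ring_distribs sum_squares_zero intro!: sum_squares_add *)
  then show ?thesis
    by (simp add: ps qs)
qed

text \<open>With a single generator the quadratic module is already closed under multiplication.\<close>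

definition ball_cone :: "real \<Rightarrow> ('v::finite) mpoly set" where
  "ball_cone N = {a + b * (of_real N - (\<Sum>i\<in>UNIV. Var i ^ 2)) | a b. a \<in> sum_squares \<and> b \<in> sum_squares}"

lemma ball_cone_squares: "a \<in> sum_squares \<Longrightarrow> a \<in> ball_cone N"
  unfolding ball_cone_def by (intro CollectI exI[of _ a] exI[of _ 0]) (simp add: sum_squares_zero)

lemma ball_cone_add: "p \<in> ball_cone N \<Longrightarrow> q \<in> ball_cone N \<Longrightarrow> p + q \<in> ball_cone N"
proof -
  let ?G = "of_real N - (\<Sum>i\<in>UNIV. Var i ^ 2)"
  assume "p \<in> ball_cone N" "q \<in> ball_cone N"
  then obtain a b c d where "p = a + b * ?G" "q = c + d * ?G"
    "a \<in> sum_squares" "b \<in> sum_squares" "c \<in> sum_squares" "d \<in> sum_squares"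
    unfolding ball_cone_def by blast
  moreover have "a + b * ?G + (c + d * ?G) = (a + c) + (b + d) * ?G"
    by (simp add: algebra_simps)
  ultimately show ?thesis
    unfolding ball_cone_def using sum_squares_add by blast
qed

text \<open>The product of the two generator terms is \<open>b * d * ?G ^ 2\<close>, again a sum of
  squares.\<close>

lemma ball_cone_mult: "p \<in> ball_cone N \<Longrightarrow> q \<in> ball_cone N \<Longrightarrow> p * q \<in> ball_cone N"
proof -
  let ?G = "of_real N - (\<Sum>i\<in>UNIV. Var i ^ 2)"
  assume "p \<in> ball_cone N" "q \<in> ball_cone N"
  then obtain a b c d where "p = a + b * ?G" "q = c + d * ?G"
    and ss: "a \<in> sum_squares" "b \<in> sum_squares" "c \<in> sum_squares" "d \<in> sum_squares"
    unfolding ball_cone_def by blast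
  moreover have "(a + b * ?G) * (c + d * ?G) = (a * c + b * d * ?G ^ 2) + (a * d + b * c) * ?G"
    by (simp add: ring_distribs power2_eq_square ac_simps)
  moreover have "a * c + b * d * ?G ^ 2 \<in> sum_squares" "a * d + b * c \<in> sum_squares"
    using ss by (auto intro!: sum_squares_add sum_squares_mult sum_squares_power2)
  ultimately show ?thesis
    unfolding ball_cone_def by blast
qed

lemma ball_cone_const: "0 \<le> c \<Longrightarrow> of_real c \<in> ball_cone N"
  using ball_cone_squares[OF sum_squares_scaleR[OF sum_squares_power2[of 1]]] by (simp add: of_real_def)

lemma ball_cone_scaleR: "p \<in> ball_cone N \<Longrightarrow> 0 \<le> c \<Longrightarrow> c *\<^sub>R p \<in> ball_cone N"
  using ball_cone_mult[OF ball_cone_const] by (simp add: scaleR_conv_of_real)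

lemma ball_cone_sum: "(\<And>i. i \<in> A \<Longrightarrow> p i \<in> ball_cone N) \<Longrightarrow> sum p A \<in> ball_cone N"
  using ball_cone_const[of 0]
  by (induction A rule: infinite_finite_induct) (auto intro: ball_cone_add)

lemma ball_cone_prod: "(\<And>i. i \<in> A \<Longrightarrow> p i \<in> ball_cone N) \<Longrightarrow> prod p A \<in> ball_cone N"
  using ball_cone_const[of 1]
  by (induction A rule: infinite_finite_induct) (auto intro: ball_cone_mult)

lemma ball_cone_power: "p \<in> ball_cone N \<Longrightarrow> p ^ k \<in> ball_cone N"
  using ball_cone_const[of 1] by (induction k) (auto intro: ball_cone_mult)

text \<open>Completing the square: \<open>2 * c\<close> times the linear form is the square of
  \<open>Var i + e * c\<close>, plus the squares of the other variables, plus
  \<open>c^2 - N\<close>, plus the ball polynomial. With \<open>e\<close> equal to 1 or -1 these are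
  the facets of the box.\<close>

lemma ball_cone_linear:
  fixes i :: "'v::finite"
  assumes "0 < c" "N \<le> c\<^sup>2" "e\<^sup>2 = 1"
  shows "of_real c + e *\<^sub>R Var i \<in> ball_cone N"
proof -
  let ?G = "of_real N - (\<Sum>i\<in>UNIV. Var i ^ 2) :: 'v mpoly"
  let ?P = "((Var i + of_real (e * c)) ^ 2 + (\<Sum>j\<in>UNIV - {i}. Var j ^ 2) + of_real (c\<^sup>2 - N)) + ?G"
  have "?G \<in> ball_cone N"
    unfolding ball_cone_def using sum_squares_zero sum_squares_power2[of 1]
    by (intro CollectI exI[of _ 0] exI[of _ 1]) auto
  then have "?P \<in> ball_cone N"
    using assms(2)
    by (intro ball_cone_add ball_cone_sum ball_cone_squares[OF sum_squares_power2] ball_cone_const) auto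
  moreover have "of_real c + e *\<^sub>R Var i = (1 / (2 * c)) *\<^sub>R ?P"
  proof (rule mpoly_eqI)
    fix x :: "real ^ 'v"
    have "(\<Sum>j\<in>UNIV. (x $ j)\<^sup>2) = (x $ i)\<^sup>2 + (\<Sum>j\<in>UNIV - {i}. (x $ j)\<^sup>2)"
      by (simp add: sum.remove)
    then show "mpoly_eval (of_real c + e *\<^sub>R Var i) x = mpoly_eval ((1 / (2 * c)) *\<^sub>R ?P) x"
      using assms by (simp add: mpoly_eval_add mpoly_eval_diff mpoly_eval_sum mpoly_eval_power
          mpoly_eval_Var del: of_real_mult of_real_diff of_real_power)
        (simp add: power2_sum power_mult_distrib field_simps power2_eq_square)
  qed
  ultimately show ?thesis
    using assms(1) by (simp add: ball_cone_scaleR)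
qed

lemma mpoly_eval_prod: "mpoly_eval (prod p A) x = (\<Prod>i\<in>A. mpoly_eval (p i) x)"
  by (induction A rule: infinite_finite_induct) (simp_all add: mpoly_eval_one mpoly_eval_mult)

text \<open>After transport to the unit cube, all Bernstein coefficients of high degree are
  positive, and the basis polynomials are products of facets of the box, which lie in the
  cone.\<close>

lemma ball_cone_if_pos_on_box:
  fixes p :: "'v::finite mpoly"
  assumes c: "0 < c" "N \<le> c\<^sup>2"
    and pos: "\<And>w. (\<And>i. \<bar>w $ i\<bar> \<le> c) \<Longrightarrow> 0 < mpoly_eval p w"
  shows "p \<in> ball_cone N"
proof -
  define T where "T u = (\<chi> i. 2 * c * u $ i - c)" for u :: "real ^ 'v"
  have "real_polynomial_function (\<lambda>u. T u $ i)" for i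
    unfolding T_def by (simp add: real_polynomial_function.intros bounded_linear_vec_nth
        real_polynomial_function_diff)
  then have "polynomial_function T"
    unfolding polynomial_function_iff_Basis_inner by (auto simp: Basis_vec_def inner_axis)
  then have "real_polynomial_function (mpoly_eval p \<circ> T)"
    by (intro real_polynomial_function_compose) auto
  then obtain p' where "\<And>u. mpoly_eval p' u = (mpoly_eval p \<circ> T) u"
    by (rule real_polynomial_function_imp_mpoly) blast
  then have p': "mpoly_eval p' u = mpoly_eval p (T u)" for u
    by simp
  have "0 < mpoly_eval p' u" if u: "\<And>i. 0 \<le> u $ i \<and> u $ i \<le> 1" for u
    unfolding p'
  proof (rule pos)
    fix i
    have "2 * c * u $ i \<le> 2 * c * 1" "0 \<le> 2 * c * u $ i"
      using u[of i] c by (intro mult_left_mono mult_nonneg_nonneg; simp)+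
    then show "\<bar>T u $ i\<bar> \<le> c"
      by (simp add: T_def abs_le_iff)
  qed
  then obtain n where n: "mpoly_deg p' \<le> n" "\<And>\<kappa>. (\<And>i. \<kappa> i \<le> n) \<Longrightarrow> 0 < bernstein_coeff p' n \<kappa>"
    using bernstein_coeff_pos by blast
  \<comment> \<open>\<open>U i\<close> is the coordinate \<open>u $ i\<close> of the unit cube
    expressed in the original variable, and \<open>V i\<close> is \<open>1 - u $ i\<close>.\<close>
  define U where "U i = (1 / (2 * c)) *\<^sub>R (of_real c + 1 *\<^sub>R Var i)" for i :: 'v
  define V where "V i = (1 / (2 * c)) *\<^sub>R (of_real c + (-1) *\<^sub>R Var i)" for i :: 'v
  have UV: "U i \<in> ball_cone N" "V i \<in> ball_cone N" for i
    unfolding U_def V_def using c by (intro ball_cone_scaleR ball_cone_linear; simp)+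
  have eval: "mpoly_eval (U i) w = (c + w $ i) / (2 * c)" "mpoly_eval (V i) w = 1 - (c + w $ i) / (2 * c)" for i w
    using c by (simp_all add: U_def V_def mpoly_eval_add mpoly_eval_diff mpoly_eval_Var field_simps)
  have "p = (\<Sum>\<kappa>\<in>UNIV \<rightarrow>\<^sub>E {..n}. bernstein_coeff p' n \<kappa> *\<^sub>R
      (\<Prod>i\<in>UNIV. real (n choose \<kappa> i) *\<^sub>R (U i ^ \<kappa> i * V i ^ (n - \<kappa> i))))"
  proof (rule mpoly_eqI)
    fix w :: "real ^ 'v"
    define u :: "real ^ 'v" where "u = (\<chi> i. (c + w $ i) / (2 * c))"
    have "T u = w"
      using c by (simp add: T_def u_def vec_eq_iff)
    then have "mpoly_eval p w = mpoly_eval p' u"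
      by (simp add: p')
    also have "\<dots> = (\<Sum>\<kappa>\<in>UNIV \<rightarrow>\<^sub>E {..n}. bernstein_coeff p' n \<kappa> *
        (\<Prod>i\<in>UNIV. real (n choose \<kappa> i) * ((u $ i) ^ \<kappa> i * (1 - u $ i) ^ (n - \<kappa> i))))"
      by (rule mpoly_eval_bernstein[OF n(1)])
    finally show "mpoly_eval p w = mpoly_eval (\<Sum>\<kappa>\<in>UNIV \<rightarrow>\<^sub>E {..n}. bernstein_coeff p' n \<kappa> *\<^sub>R
        (\<Prod>i\<in>UNIV. real (n choose \<kappa> i) *\<^sub>R (U i ^ \<kappa> i * V i ^ (n - \<kappa> i)))) w"
      by (simp only: mpoly_eval_sum mpoly_eval_scaleR mpoly_eval_prod mpoly_eval_mult mpoly_eval_power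
          eval u_def vec_lambda_beta)
  qed
  also have "\<dots> \<in> ball_cone N"
    using n(2) by (intro ball_cone_sum ball_cone_scaleR ball_cone_prod ball_cone_mult ball_cone_power UV)
      (auto simp: PiE_def Pi_def intro!: less_imp_le)
  finally show ?thesis .
qed

section \<open>Penalty terms and positivity on the constraint set\<close>

text \<open>For \<open>0 \<le> t\<close>, Bernoulli's inequality bounds
  \<open>(1 - t) ^ (2 * k) * (1 + 2 * k * t)\<close> by \<open>(1 - t^2) ^ (2 * k)\<close>, hence by
  one, and \<open>(2 * k + 1) * t\<close> is at most \<open>1 + 2 * k * t\<close>. For negative
  \<open>t\<close> the left side is not positive.\<close>

lemma power_mult_one_minus_le:
  fixes t :: real
  assumes "t \<le> 1"
  shows "((1 - t) ^ k) ^ 2 * t \<le> 1 / (2 * real k + 1)"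
proof (cases "0 \<le> t")
  case True
  have "1 + real (2 * k) * t \<le> (1 + t) ^ (2 * k)"
    using True by (intro Bernoulli_inequality) simp
  then have "(1 - t) ^ (2 * k) * (1 + real (2 * k) * t) \<le> (1 - t) ^ (2 * k) * (1 + t) ^ (2 * k)"
    using assms by (intro mult_left_mono) auto
  also have "\<dots> = (1 - t\<^sup>2) ^ (2 * k)"
    by (simp add: power2_eq_square algebra_simps flip: power_mult_distrib)
  also have "\<dots> \<le> 1"
    using True assms by (intro power_le_one) (auto simp: power_le_one abs_square_le_1)
  finally have *: "(1 - t) ^ (2 * k) * (1 + 2 * real k * t) \<le> 1"
    by simp
  have "((1 - t) ^ (2 * k) * t) * (2 * real k + 1) \<le> (1 - t) ^ (2 * k) * (1 + 2 * real k * t)"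
    unfolding mult.assoc using assms True by (intro mult_left_mono) (auto simp: algebra_simps)
  with * show ?thesis
    by (simp add: pos_le_divide_eq power_mult[symmetric] mult.commute add_pos_nonneg)
next
  case False
  then have "((1 - t) ^ k) ^ 2 * t \<le> 0"
    by (intro mult_nonneg_nonpos) auto
  also have "0 \<le> 1 / (2 * real k + 1)"
    by simp
  finally show ?thesis .
qed

text \<open>The sum of the positive parts is continuous and has a positive minimum over
  \<open>C\<close>; at each point some summand reaches its share. Dividing by
  \<open>card F + 1\<close> yields the strict inequality.\<close>

lemma compact_uniform_positive:
  fixes F :: "'v::finite mpoly set"
  assumes "compact C" "finite F" and pos: "\<And>w. w \<in> C \<Longrightarrow> \<exists>g\<in>F. 0 < mpoly_eval g w"
  obtains \<epsilon> where "0 < \<epsilon>" "\<And>w. w \<in> C \<Longrightarrow> \<exists>g\<in>F. \<epsilon> \<le> mpoly_eval g w"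
proof (cases "C = {}")
  case False
  define \<phi> where "\<phi> w = (\<Sum>g\<in>F. max 0 (mpoly_eval g w))" for w
  have "continuous_on C \<phi>"
    unfolding \<phi>_def by (intro continuous_on_sum continuous_on_max continuous_on_const continuous_on_mpoly_eval)
  then obtain w0 where w0: "w0 \<in> C" "\<And>w. w \<in> C \<Longrightarrow> \<phi> w0 \<le> \<phi> w"
    using continuous_attains_inf[OF assms(1) False] by blast
  obtain g where "g \<in> F" "0 < mpoly_eval g w0"
    using pos[OF w0(1)] by blast
  then have "0 < \<phi> w0"
    unfolding \<phi>_def by (intro sum_pos2[OF assms(2)]) auto
  show ?thesis
  proof (rule that)
    let ?\<epsilon> = "\<phi> w0 / (real (card F) + 1)"
    show "0 < ?\<epsilon>"
      using \<open>0 < \<phi> w0\<close> by simp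
    show "\<exists>g\<in>F. ?\<epsilon> \<le> mpoly_eval g w" if "w \<in> C" for w
    proof (rule ccontr)
      assume "\<not> ?thesis"
      then have "max 0 (mpoly_eval g w) \<le> ?\<epsilon>" if "g \<in> F" for g
        using that \<open>0 < ?\<epsilon>\<close> by fastforce
      then have "\<phi> w \<le> of_nat (card F) * ?\<epsilon>"
        unfolding \<phi>_def by (rule sum_bounded_above)
      also have "\<dots> < \<phi> w0"
        using \<open>0 < \<phi> w0\<close> by (simp add: field_simps)
      finally show False
        using w0(2)[OF that] by simp
    qed
  qed
qed (use that[of 1] in auto)

text \<open>Following Schweighofer and Nie: subtracting a multiple of \<open>\<Sum> (1 - g)\<^sup>2\<^sup>k g\<close> from \<open>p\<close>, where the
  constraints are scaled to satisfy \<open>g \<le> 1\<close> on a box, makes the polynomial positive on the whole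
  box: the subtracted terms are tiny where \<open>g \<ge> 0\<close> and at most \<open>g\<close> where \<open>g < 0\<close>.\<close>

lemma putinar:
  fixes gs :: "('v::finite) mpoly list"
  assumes arch: "\<And>q. \<exists>r. q ^ 2 * (of_real N - (\<Sum>i\<in>UNIV. Var i ^ 2)) \<in> quad_module gs r"
    and pos: "\<And>w. w \<in> basic_semialg gs \<Longrightarrow> 0 < mpoly_eval p w"
  obtains r where "p \<in> quad_module gs r"
proof -
  define QM where "QM = (\<Union>r. quad_module gs r)"
  have QM_add: "a + b \<in> QM" if "a \<in> QM" "b \<in> QM" for a b
    using that unfolding QM_def by (metis UN_iff UNIV_I linorder_linear quad_module_add quad_module_mono)
  have QM_scaleR: "c *\<^sub>R a \<in> QM" if "a \<in> QM" "0 \<le> c" for a c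
    using that unfolding QM_def by (auto intro: quad_module_scaleR)
  have QM_sum: "sum a A \<in> QM" if "\<And>i. i \<in> A \<Longrightarrow> a i \<in> QM" for a and A :: "'v mpoly set"
    using that
  proof (induction A rule: infinite_finite_induct)
    case (insert i A)
    then show ?case by (simp add: QM_add)
  qed (simp_all add: QM_def)
  have QM_square: "q ^ 2 * g \<in> QM" if "g \<in> set gs" for q g
    unfolding QM_def
    by (intro UN_I[of "mpoly_deg q + half_deg g"] UNIV_I quad_moduleI SOS_power2) (use that in auto)
  let ?G = "of_real N - (\<Sum>i\<in>UNIV. Var i ^ 2) :: 'v mpoly"
  have cone: "ball_cone N \<subseteq> QM"
  proof
    fix a :: "'v mpoly" assume "a \<in> ball_cone N"
    then obtain s t where st: "a = s + t * ?G" "s \<in> sum_squares" "t \<in> sum_squares"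
      by (auto simp: ball_cone_def)
    obtain qs where qs: "t = (\<Sum>q\<leftarrow>qs. q ^ 2)"
      using st(3) by (rule sum_squares_obtain)
    have "(\<Sum>q\<leftarrow>qs. q ^ 2) * ?G \<in> QM"
    proof (induction qs)
      case (Cons q qs)
      have "q ^ 2 * ?G \<in> QM"
        using arch by (auto simp: QM_def)
      from QM_add[OF this Cons] show ?case
        by (simp add: distrib_right)
    qed (simp add: QM_def)
    moreover have "s \<in> QM"
      using st(2) quad_module_SOS by (auto simp: sum_squares_def QM_def)
    ultimately show "a \<in> QM"
      by (simp add: st(1) qs QM_add)
  qed
  \<comment> \<open>Chosen so that \<open>c\<close> is at least one and at least \<open>N\<close>,
    whatever the sign of \<open>N\<close>; hence also \<open>N \<le> c^2\<close>.\<close>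
  define c where "c = 1 + \<bar>N\<bar>"
  have "c * 1 \<le> c * c"
    by (intro mult_left_mono) (auto simp: c_def)
  then have c: "0 < c" "N \<le> c\<^sup>2"
    by (auto simp: c_def power2_eq_square)
  let ?C = "cbox (\<chi> i. - c) (\<chi> i. c) :: (real ^ 'v) set"
  have C: "w \<in> ?C \<longleftrightarrow> (\<forall>i. \<bar>w $ i\<bar> \<le> c)" for w
    by (simp add: mem_box_cart abs_le_iff) (metis minus_le_iff)
  have bounded: "\<exists>b. \<forall>w\<in>?C. \<bar>mpoly_eval q w\<bar> \<le> b" for q :: "'v mpoly"
    using compact_imp_bounded[OF compact_continuous_image[OF continuous_on_mpoly_eval compact_cbox]]
    unfolding bounded_iff by (metis image_eqI real_norm_def)
  have "\<exists>M>0. \<forall>g\<in>set gs. \<forall>w\<in>?C. mpoly_eval g w \<le> M"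
  proof (induction gs)
    case Nil
    then show ?case by (auto intro: exI[of _ 1])
  next
    case (Cons g gs)
    then obtain M where "0 < M" "\<forall>g\<in>set gs. \<forall>w\<in>?C. mpoly_eval g w \<le> M" by blast
    moreover obtain b where "\<forall>w\<in>?C. \<bar>mpoly_eval g w\<bar> \<le> b" using bounded by blast
    ultimately show ?case
      by (intro exI[of _ "max M b"]) (force simp: le_max_iff_disj)
  qed
  then obtain M where M: "0 < M" "\<And>g w. g \<in> set gs \<Longrightarrow> w \<in> ?C \<Longrightarrow> mpoly_eval g w \<le> M"
    by blast
  define G where "G = (\<lambda>g. (1 / M) *\<^sub>R g) ` set gs"
  have G: "finite G" "\<And>g w. g \<in> G \<Longrightarrow> w \<in> ?C \<Longrightarrow> mpoly_eval g w \<le> 1"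
    using M by (auto simp: G_def)
  \<comment> \<open>Outside the semialgebraic set some constraint is negative, so at every point
    \<open>p\<close> or some \<open>- g\<close> is positive. Compactness of the box makes this
    uniform.\<close>
  have "\<exists>g\<in>insert p (uminus ` G). 0 < mpoly_eval g w" for w
  proof (cases "w \<in> basic_semialg gs")
    case False
    then obtain g where "g \<in> set gs" "mpoly_eval g w < 0"
      by (auto simp: basic_semialg_def not_le)
    then show ?thesis
      using M(1) by (intro bexI[of _ "- ((1 / M) *\<^sub>R g)"])
        (auto simp: G_def mpoly_eval_uminus divide_neg_pos simp del: scaleR_minus_right)
  qed (use pos in auto)
  then obtain \<epsilon> where \<epsilon>: "0 < \<epsilon>" "\<And>w. w \<in> ?C \<Longrightarrow> \<exists>g\<in>insert p (uminus ` G). \<epsilon> \<le> mpoly_eval g w"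
    using compact_uniform_positive[OF compact_cbox, of "insert p (uminus ` G)"] G(1) by (metis finite.insertI finite_imageI)
  obtain L where L: "\<forall>w\<in>?C. \<bar>mpoly_eval p w\<bar> \<le> L"
    using bounded by blast
  \<comment> \<open>Where some constraint is at most \<open>- \<epsilon>\<close>, its term
    contributes at least \<open>l * \<epsilon>\<close> to \<open>- l *\<^sub>R H\<close>, which
    exceeds any loss from \<open>p\<close> by one.\<close>
  define l where "l = (\<bar>L\<bar> + 1) / \<epsilon>"
  have l: "0 < l" "l * \<epsilon> = \<bar>L\<bar> + 1"
    using \<epsilon>(1) by (auto simp: l_def add_nonneg_pos)
  \<comment> \<open>Makes the total of the harmful terms, at most
    \<open>l * card G / (2 * k + 1)\<close>, smaller than \<epsilon> for the points with
    \<open>\<epsilon> \<le> p\<close>, and smaller than one for the remaining points.\<close>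
  obtain k :: nat where k: "l * real (card G) / min \<epsilon> 1 < real k"
    using reals_Archimedean2 by blast
  define H where "H = (\<Sum>g\<in>G. ((1 - g) ^ k) ^ 2 * g)"
  have eval_H: "mpoly_eval H w = (\<Sum>g\<in>G. ((1 - mpoly_eval g w) ^ k) ^ 2 * mpoly_eval g w)" for w
    by (simp add: H_def mpoly_eval_sum mpoly_eval_mult mpoly_eval_power mpoly_eval_diff mpoly_eval_one)
  define m where "m = min \<epsilon> 1"
  have m: "0 < m" "m \<le> \<epsilon>" "m \<le> 1"
    using \<epsilon>(1) by (auto simp: m_def)
  have "l * (real (card G) * (1 / (2 * real k + 1))) < m"
  proof -
    have "l * real (card G) < real k * m"
      using k m(1) unfolding m_def[symmetric] by (subst (asm) pos_divide_less_eq) auto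
    also have "\<dots> \<le> (2 * real k + 1) * m"
      using m(1) by (intro mult_right_mono) auto
    finally show ?thesis
      by (simp add: divide_less_eq mult_ac add_pos_nonneg)
  qed
  then have small: "l * (real (card G) * (1 / (2 * real k + 1))) < \<epsilon>" "l * (real (card G) * (1 / (2 * real k + 1))) < 1"
    using m by linarith+
  have "0 < mpoly_eval (p - l *\<^sub>R H) w" if w: "\<And>i. \<bar>w $ i\<bar> \<le> c" for w
  proof -
    have wC: "w \<in> ?C" using w by (simp add: C)
    have term_le: "((1 - mpoly_eval g w) ^ k) ^ 2 * mpoly_eval g w \<le> 1 / (2 * real k + 1)" if "g \<in> G" for g
      using G(2)[OF that wC] by (rule power_mult_one_minus_le)
    obtain g where g: "g \<in> insert p (uminus ` G)" "\<epsilon> \<le> mpoly_eval g w"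
      using \<epsilon>(2)[OF wC] by blast
    consider "\<epsilon> \<le> mpoly_eval p w" | g where "g \<in> G" "mpoly_eval g w \<le> - \<epsilon>"
      using g by (fastforce simp: mpoly_eval_uminus)
    then show ?thesis
    proof cases
      case 1
      have "mpoly_eval H w \<le> real (card G) * (1 / (2 * real k + 1))"
        unfolding eval_H by (rule sum_bounded_above) (rule term_le)
      then have "l * mpoly_eval H w < \<epsilon>"
        using l small(1) mult_left_mono[of "mpoly_eval H w" _ l] by fastforce
      then show ?thesis
        using 1 by (simp add: mpoly_eval_diff)
    next
      case 2
      have "((1 - mpoly_eval g w) ^ k) ^ 2 * mpoly_eval g w \<le> 1 * mpoly_eval g w"
        using 2 \<epsilon>(1) by (intro mult_right_mono_neg one_le_power) auto
      then have "((1 - mpoly_eval g w) ^ k) ^ 2 * mpoly_eval g w \<le> - \<epsilon>"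
        using 2 by simp
      moreover have "(\<Sum>g\<in>G - {g}. ((1 - mpoly_eval g w) ^ k) ^ 2 * mpoly_eval g w) \<le>
          real (card (G - {g})) * (1 / (2 * real k + 1))"
        by (rule sum_bounded_above) (auto intro: term_le)
      moreover have "real (card (G - {g})) * (1 / (2 * real k + 1)) \<le> real (card G) * (1 / (2 * real k + 1))"
        by (intro mult_right_mono of_nat_mono card_mono G) auto
      ultimately have "mpoly_eval H w \<le> - \<epsilon> + real (card G) * (1 / (2 * real k + 1))"
        unfolding eval_H sum.remove[OF G(1) 2(1)] by linarith
      then have "l * mpoly_eval H w \<le> l * (- \<epsilon> + real (card G) * (1 / (2 * real k + 1)))"
        using l by (intro mult_left_mono) auto
      then have "l * mpoly_eval H w < - \<bar>L\<bar>"
        using l(2) small(2) unfolding distrib_left by linarith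
      then show ?thesis
        using L wC by (fastforce simp: mpoly_eval_diff)
    qed
  qed
  then have "p - l *\<^sub>R H \<in> QM"
    using ball_cone_if_pos_on_box[OF c] cone by blast
  moreover have "((1 - g) ^ k) ^ 2 * g \<in> QM" if g: "g \<in> G" for g
  proof -
    obtain g0 where g0: "g0 \<in> set gs" "g = (1 / M) *\<^sub>R g0"
      using g by (auto simp: G_def)
    have "((1 - g) ^ k) ^ 2 * g = (1 / M) *\<^sub>R (((1 - g) ^ k) ^ 2 * g0)"
      by (subst (2) g0(2)) simp
    then show ?thesis
      using QM_scaleR[OF QM_square[OF g0(1)], of "1 / M"] M(1) by simp
  qed
  then have "l *\<^sub>R H \<in> QM"
    unfolding H_def using l by (intro QM_scaleR QM_sum) auto
  ultimately have "p - l *\<^sub>R H + l *\<^sub>R H \<in> QM"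
    by (rule QM_add)
  then show ?thesis
    using that by (auto simp: QM_def)
qed

section \<open>Convergence of the optimal polynomials\<close>

context image_approximation
begin

abbreviation "F \<equiv> poly_map f ` S"
abbreviation "h \<equiv> h_fun f S"

lemma compact_F: "compact F"
  unfolding poly_map_def
  by (intro compact_continuous_image compact_S continuous_on_vec_lambda continuous_on_mpoly_eval)

lemma hf_fun_eq: "hf_fun f x y = - (dist y (poly_map f x))\<^sup>2"
  by (simp add: hf_fun_def dist_norm)

text \<open>Compactness of \<open>F\<close> supplies a nearest point, and a preimage of it in
  \<open>S\<close> realises the supremum. The distance formula also gives the continuity of
  \<open>h\<close>.\<close>

lemma h_eq_infdist: "h y = - (infdist y F)\<^sup>2" and h_attained: "\<exists>x\<in>S. h y = hf_fun f x y"
proof -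
  obtain a where "a \<in> F" "\<And>b. b \<in> F \<Longrightarrow> dist y a \<le> dist y b"
    using distance_attains_inf[of F y] compact_F S_nonempty by (auto simp: compact_imp_closed)
  then obtain x where x: "x \<in> S" "\<And>b. b \<in> F \<Longrightarrow> dist y (poly_map f x) \<le> dist y b"
    by blast
  have "dist y (poly_map f x) \<le> infdist y F"
    using x S_nonempty unfolding infdist_def by (auto intro!: cINF_greatest)
  then have inf: "infdist y F = dist y (poly_map f x)"
    using x(1) by (intro antisym infdist_le) auto
  have "h y = hf_fun f x y"
    unfolding h_fun_def
  proof (rule cSup_eq_maximum)
    fix t assume "t \<in> (\<lambda>x. hf_fun f x y) ` S"
    then show "t \<le> hf_fun f x y"
      using x(2) by (auto simp: hf_fun_eq intro!: power_mono)
  qed (use x in auto)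
  then show "h y = - (infdist y F)\<^sup>2" "\<exists>x\<in>S. h y = hf_fun f x y"
    using x(1) inf by (auto simp: hf_fun_eq)
qed

lemma continuous_on_h: "continuous_on A h"
  unfolding h_eq_infdist[abs_def] by (intro continuous_intros)

lemma hf_fun_le_h:
  assumes "x \<in> S"
  shows "hf_fun f x y \<le> h y"
  using infdist_le[of "poly_map f x" F y] assms
  by (auto simp: hf_fun_eq h_eq_infdist intro!: power_mono infdist_nonneg)

lemma h_eq_0_iff: "h y = 0 \<longleftrightarrow> y \<in> F"
  using in_closed_iff_infdist_zero[of F y] compact_F S_nonempty
  by (simp add: h_eq_infdist compact_imp_closed)

lemma h_nonpos: "h y \<le> 0"
  by (simp add: h_eq_infdist)

lemma integrable_B: "continuous_on B g \<Longrightarrow> integrable (lebesgue_on B) g" for g :: "real ^ 'm \<Rightarrow> real"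
  by (intro integrable_lebesgue_on_compact compact_B)

lemma h_le_feasible:
  assumes "q \<in> primal_feasible f gS gB r" "y \<in> B"
  shows "h y \<le> mpoly_eval q y"
proof -
  obtain x where x: "x \<in> S" "h y = hf_fun f x y"
    using h_attained by blast
  have "0 \<le> mpoly_eval (rename Inr q - hf_poly f) (join x y)"
    using assms x(1) by (intro Q_nonneg) (auto simp: primal_feasible_def)
  then show ?thesis
    using x(2) by (simp add: mpoly_eval_diff)
qed

text \<open>The sum of the two ball polynomials is the ball polynomial in all variables that
  \<open>putinar\<close> asks for.\<close>

lemma arch_sum:
  "\<exists>r. q ^ 2 * (of_real (real NS + real NB) - (\<Sum>k\<in>UNIV. Var k ^ 2)) \<in> Q r"
proof -
  let ?a = "rename Inl (ball_poly NS) :: ('n + 'm) mpoly" and ?b = "rename Inr (ball_poly NB) :: ('n + 'm) mpoly"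
  have "q ^ 2 * ?a + q ^ 2 * ?b \<in> Q (mpoly_deg q + half_deg ?a + half_deg ?b)"
    using ball_mem by (intro quad_module_add quad_moduleI SOS_power2) auto
  moreover have "q ^ 2 * ?a + q ^ 2 * ?b = q ^ 2 * (of_real (real NS + real NB) - (\<Sum>k\<in>UNIV. Var k ^ 2))"
  proof (rule mpoly_eqI)
    fix w :: "real ^ ('n + 'm)"
    have "(\<Sum>k\<in>UNIV. (w $ k)\<^sup>2) = (\<Sum>i\<in>UNIV. (w $ Inl i)\<^sup>2) + (\<Sum>j\<in>UNIV. (w $ Inr j)\<^sup>2)"
      unfolding UNIV_Plus_UNIV[symmetric] by (subst sum.Plus) (auto simp: o_def)
    then show "mpoly_eval (q ^ 2 * ?a + q ^ 2 * ?b) w =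
        mpoly_eval (q ^ 2 * (of_real (real NS + real NB) - (\<Sum>k\<in>UNIV. Var k ^ 2))) w"
      by (simp add: mpoly_eval_add mpoly_eval_mult mpoly_eval_power mpoly_eval_diff mpoly_eval_sum
          mpoly_eval_Var mpoly_eval_rename mpoly_eval_ball_poly norm_vec_def L2_set_def sum_nonneg
          mpoly_eval_of_nat del: of_real_add) (simp add: algebra_simps)
  qed
  ultimately show ?thesis
    by metis
qed

text \<open>Raise a Stone-Weierstrass approximation of \<open>h\<close> with error below \<delta> by
  \<open>2 * \<delta>\<close>. It then exceeds \<open>h\<close>, and so \<open>hf_fun f x\<close>,
  by more than \<delta>; this strict positivity is what Putinar's theorem requires.\<close>

lemma feasible_near_h:
  assumes "0 < \<delta>"
  obtains q R where "\<And>r. R \<le> r \<Longrightarrow> q \<in> primal_feasible f gS gB r"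
    "\<And>y. y \<in> B \<Longrightarrow> mpoly_eval q y \<le> h y + 3 * \<delta>"
proof -
  obtain g where g: "real_polynomial_function g" "\<And>y. y \<in> B \<Longrightarrow> \<bar>h y - g y\<bar> < \<delta>"
    using Stone_Weierstrass_real_polynomial_function[OF compact_B continuous_on_h assms] by blast
  have "real_polynomial_function (\<lambda>y. g y + 2 * \<delta>)"
    using g(1) by (intro real_polynomial_function.intros(2,3))
  then obtain q where q: "\<And>y. mpoly_eval q y = g y + 2 * \<delta>"
    by (rule real_polynomial_function_imp_mpoly) blast
  have "0 < mpoly_eval (rename Inr q - hf_poly f) w"
    if w: "w \<in> basic_semialg (prod_constraints gS gB)" for w
  proof -
    define x y where "x = (\<chi> i. w $ Inl i)" and "y = (\<chi> j. w $ Inr j)"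
    have xy: "x \<in> S" "y \<in> B" and w_eq: "w = join x y"
      using w by (simp_all add: basic_semialg_prod_constraints x_def y_def join_proj)
    show ?thesis
      using hf_fun_le_h[OF xy(1), of y] g(2)[OF xy(2)] assms by (simp add: w_eq mpoly_eval_diff q)
  qed
  then obtain r0 where r0: "rename Inr q - hf_poly f \<in> Q r0"
    using putinar[OF arch_sum] by blast
  show ?thesis
  proof (rule that)
    show "q \<in> primal_feasible f gS gB r" if "max r0 (mpoly_deg q) \<le> r" for r
      using that quad_module_mono[OF r0] by (simp add: primal_feasible_def)
    show "mpoly_eval q y \<le> h y + 3 * \<delta>" if "y \<in> B" for y
      using g(2)[OF that] by (simp add: q)
  qed
qed

lemma opt_upper:
  assumes "0 < \<epsilon>"
  shows "\<forall>\<^sub>F r in sequentially. opt r < (\<integral>y. h y \<partial>lebesgue_on B) + \<epsilon>"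
proof -
  \<comment> \<open>The added one keeps \<open>V\<close> positive when \<open>B\<close> is null;
    \<delta> is such that the excess \<open>3 * \<delta>\<close> integrates to at most
    \<open>\<epsilon> / 2\<close>.\<close>
  define V where "V = 3 * measure lebesgue B + 1"
  define \<delta> where "\<delta> = \<epsilon> / V / 2"
  have pos: "0 < V"
    by (simp add: V_def add_nonneg_pos)
  then have "0 < \<delta>"
    using assms by (simp add: \<delta>_def)
  obtain q R where q: "\<And>r. R \<le> r \<Longrightarrow> q \<in> primal_feasible f gS gB r"
    "\<And>y. y \<in> B \<Longrightarrow> mpoly_eval q y \<le> h y + 3 * \<delta>"
    by (rule feasible_near_h[OF \<open>0 < \<delta>\<close>], rule that)
  have bound: "3 * \<delta> * measure lebesgue B < \<epsilon>"
  proof -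
    have "\<delta> * (3 * measure lebesgue B) \<le> \<delta> * V"
      using \<open>0 < \<delta>\<close> by (intro mult_left_mono) (auto simp: V_def)
    also have "\<dots> = \<epsilon> / 2"
      using pos by (simp add: \<delta>_def)
    finally show ?thesis
      using assms by simp
  qed
  show ?thesis
  proof (rule eventually_sequentiallyI[of "max R (min_order f gS gB)"])
    fix r assume r: "max R (min_order f gS gB) \<le> r"
    then have feas: "q \<in> primal_feasible f gS gB r"
      using q(1) by simp
    have "opt r \<le> obj r q"
      using r feas by (intro opt_le) auto
    also have "\<dots> = (\<integral>y. mpoly_eval q y \<partial>lebesgue_on B)"
      using feas by (intro obj_eq_integral) (simp add: primal_feasible_def)
    also have "\<dots> \<le> (\<integral>y. h y + 3 * \<delta> \<partial>lebesgue_on B)"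
      using q(2) by (intro integral_mono integrable_B continuous_on_mpoly_eval continuous_on_add
          continuous_on_h continuous_on_const) auto
    also have "\<dots> = (\<integral>y. h y \<partial>lebesgue_on B) + 3 * \<delta> * measure lebesgue B"
      by (subst Bochner_Integration.integral_add)
        (auto intro!: integrable_B continuous_on_h continuous_on_const 
          simp: measure_restrict_space compact_imp_closed compact_B)
    finally show "opt r < (\<integral>y. h y \<partial>lebesgue_on B) + \<epsilon>"
      using bound by simp
  qed
qed

lemma integrable_diff_h: "integrable (lebesgue_on B) (\<lambda>y. \<bar>mpoly_eval q y - h y\<bar>)"
  by (intro integrable_B continuous_intros continuous_on_h continuous_on_mpoly_eval)

lemma integral_diff_h:
  assumes "min_order f gS gB \<le> r" "primal_optimal f gS gB r q"
  shows "(\<integral>y. \<bar>mpoly_eval q y - h y\<bar> \<partial>lebesgue_on B) = opt r - (\<integral>y. h y \<partial>lebesgue_on B)"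
proof -
  have q: "q \<in> primal_feasible f gS gB r" "obj r q = opt r"
    using assms by (simp_all add: primal_optimal_iff)
  have "(\<integral>y. \<bar>mpoly_eval q y - h y\<bar> \<partial>lebesgue_on B) = (\<integral>y. mpoly_eval q y - h y \<partial>lebesgue_on B)"
    using h_le_feasible[OF q(1)] by (intro Bochner_Integration.integral_cong) auto
  also have "\<dots> = (\<integral>y. mpoly_eval q y \<partial>lebesgue_on B) - (\<integral>y. h y \<partial>lebesgue_on B)"
    by (intro Bochner_Integration.integral_diff integrable_B continuous_on_mpoly_eval continuous_on_h)
  also have "(\<integral>y. mpoly_eval q y \<partial>lebesgue_on B) = opt r"
    using q obj_eq_integral[of q r] by (simp add: primal_feasible_def)
  finally show ?thesis .
qed

lemma L1_convergence:
  assumes "\<forall>r\<ge>min_order f gS gB. primal_optimal f gS gB r (q r)"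
  shows "(\<lambda>r. \<integral>y. \<bar>mpoly_eval (q r) y - h y\<bar> \<partial>lebesgue_on B) \<longlonglongrightarrow> 0"
proof (rule tendstoI)
  fix \<epsilon> :: real assume "0 < \<epsilon>"
  show "\<forall>\<^sub>F r in sequentially. dist (\<integral>y. \<bar>mpoly_eval (q r) y - h y\<bar> \<partial>lebesgue_on B) 0 < \<epsilon>"
    using opt_upper[OF \<open>0 < \<epsilon>\<close>] eventually_ge_at_top[of "min_order f gS gB"]
  proof eventually_elim
    case (elim r)
    have "0 \<le> (\<integral>y. \<bar>mpoly_eval (q r) y - h y\<bar> \<partial>lebesgue_on B)"
      by (intro Bochner_Integration.integral_nonneg) simp
    then show ?case
      using elim integral_diff_h[of r "q r"] assms by simp
  qed
qed

lemma image_subset_superlevel: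
  assumes "q \<in> primal_feasible f gS gB r"
  shows "F \<subseteq> {y \<in> B. 0 \<le> mpoly_eval q y}"
proof
  fix y assume "y \<in> F"
  then show "y \<in> {y \<in> B. 0 \<le> mpoly_eval q y}"
    using h_eq_0_iff[of y] h_le_feasible[OF assms, of y] image_subset by auto
qed

text \<open>The sets decrease to the empty set because \<open>h\<close> is negative off
  \<open>F\<close>; continuity from above applies as they have finite measure.\<close>

lemma measure_near_F: "(\<lambda>n. measure lebesgue {y \<in> B. y \<notin> F \<and> - h y \<le> 1 / real (Suc n)}) \<longlonglongrightarrow> 0"
proof -
  let ?E = "\<lambda>n. {y \<in> B. y \<notin> F \<and> - h y \<le> 1 / real (Suc n)}"
  have E_eq: "?E n = (B \<inter> {y. - h y \<le> 1 / real (Suc n)}) - F" for n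
    by auto
  have "closed {y. - h y \<le> 1 / real (Suc n)}" for n
    by (intro closed_Collect_le continuous_intros continuous_on_h)
  then have "?E n \<in> lmeasurable" for n
    unfolding E_eq using compact_B compact_F
    by (intro fmeasurable.Diff lmeasurable_compact compact_Int_closed)
  then have "(\<lambda>n. measure lebesgue (?E n)) \<longlonglongrightarrow> measure lebesgue (\<Inter>n. ?E n)"
  proof (intro Lim_measure_decseq)
    show "decseq ?E"
    proof (intro decseq_SucI subsetI)
      fix n y
      have "1 / real (Suc (Suc n)) \<le> 1 / real (Suc n)"
        by (intro frac_le) auto
      then show "y \<in> ?E n" if "y \<in> ?E (Suc n)"
        using that by (auto simp del: of_nat_Suc)
    qed
  qed (use fmeasurableD2 in \<open>auto simp: fmeasurable_def simp del: emeasure_completion\<close>)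
  moreover have "(\<Inter>n. ?E n) = {}"
  proof -
    have False if "\<And>n. y \<in> ?E n" for y
    proof -
      have "0 < - h y"
        using that[of 0] h_eq_0_iff[of y] h_nonpos[of y] by auto
      then obtain n where "1 / real (Suc n) < - h y"
        using nat_approx_posE by blast
      then show False
        using that[of n] by simp
    qed
    then show ?thesis by blast
  qed
  ultimately show ?thesis
    by simp
qed

lemma volume_convergence:
  assumes opt: "\<forall>r\<ge>min_order f gS gB. primal_optimal f gS gB r (q r)"
  shows "(\<lambda>r. measure lebesgue ({y \<in> B. 0 \<le> mpoly_eval (q r) y} - F)) \<longlonglongrightarrow> 0"
proof (rule tendstoI)
  fix \<epsilon> :: real assume "0 < \<epsilon>"
  then obtain n where n: "measure lebesgue {y \<in> B. y \<notin> F \<and> - h y \<le> 1 / real (Suc n)} < \<epsilon> / 2"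
    using tendstoD[OF measure_near_F, of "\<epsilon> / 2"] by (auto dest!: eventually_happens)
  let ?E = "{y \<in> B. y \<notin> F \<and> - h y \<le> 1 / real (Suc n)}" and ?c = "1 / real (Suc n)"
  \<comment> \<open>The threshold for the L1 distance at which Markov's inequality at level
    \<open>?c\<close> leaves a measure below \<open>\<epsilon> / 2\<close>.\<close>
  have "0 < \<epsilon> / 2 * ?c"
    using \<open>0 < \<epsilon>\<close> by simp
  from tendstoD[OF L1_convergence[OF opt] this] eventually_ge_at_top[of "min_order f gS gB"]
  show "\<forall>\<^sub>F r in sequentially. dist (measure lebesgue ({y \<in> B. 0 \<le> mpoly_eval (q r) y} - F)) 0 < \<epsilon>"
  proof eventually_elim
    case (elim r)
    let ?I = "\<integral>y. \<bar>mpoly_eval (q r) y - h y\<bar> \<partial>lebesgue_on B"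
    let ?D = "{y \<in> B. ?c \<le> \<bar>mpoly_eval (q r) y - h y\<bar>}"
    have I: "?I / ?c < \<epsilon> / 2"
    proof -
      have "?I < \<epsilon> / 2 * ?c"
        using elim(1) by simp
      then show ?thesis
        by (subst pos_divide_less_eq) auto
    qed
    have cl: "closed {y. ?c \<le> \<bar>mpoly_eval (q r) y - h y\<bar>}" "closed {y. - h y \<le> ?c}"
        "closed {y. 0 \<le> mpoly_eval (q r) y}"
      by (intro closed_Collect_le continuous_intros continuous_on_h continuous_on_mpoly_eval)+
    have eqs: "?D = B \<inter> {y. ?c \<le> \<bar>mpoly_eval (q r) y - h y\<bar>}" "?E = (B \<inter> {y. - h y \<le> ?c}) - F"
      by auto
    have D_meas: "?D \<in> lmeasurable"
      unfolding eqs using cl(1) compact_B by (intro lmeasurable_compact compact_Int_closed)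
    have E_meas: "?E \<in> lmeasurable"
      unfolding eqs using cl(2) compact_B compact_F
      by (intro fmeasurable.Diff lmeasurable_compact compact_Int_closed)
    note meas = D_meas E_meas
    have "measure (lebesgue_on B) {y \<in> space (lebesgue_on B). ?c \<le> \<bar>mpoly_eval (q r) y - h y\<bar>} \<le> ?I / ?c"
      by (intro integral_Markov_inequality_measure[where A = "{}"] integrable_diff_h) auto
    then have D: "measure lebesgue ?D \<le> ?I / ?c"
      using compact_B by (simp add: measure_restrict_space compact_imp_closed)
    \<comment> \<open>A point outside \<open>?E\<close> and \<open>F\<close> has
      \<open>- h y > ?c\<close>; if also \<open>0 \<le> mpoly_eval (q r) y\<close>, then the two
      functions differ by at least \<open>?c\<close>.\<close>
    have "{y \<in> B. 0 \<le> mpoly_eval (q r) y} - F \<subseteq> ?D \<union> ?E"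
      using h_nonpos by (auto simp: not_le abs_real_def)
    moreover have "{y \<in> B. 0 \<le> mpoly_eval (q r) y} - F = (B \<inter> {y. 0 \<le> mpoly_eval (q r) y}) - F"
      by auto
    moreover have "(B \<inter> {y. 0 \<le> mpoly_eval (q r) y}) - F \<in> lmeasurable"
      using cl(3) compact_B compact_F by (intro fmeasurable.Diff lmeasurable_compact compact_Int_closed)
    ultimately have "measure lebesgue ({y \<in> B. 0 \<le> mpoly_eval (q r) y} - F) \<le> measure lebesgue (?D \<union> ?E)"
      using meas by (intro measure_mono_fmeasurable) (auto intro: fmeasurableD)
    also have "\<dots> \<le> measure lebesgue ?D + measure lebesgue ?E"
      using meas by (intro measure_Un_le) (auto intro: fmeasurableD)
    also have "\<dots> < \<epsilon>"
      using D I n by simp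
    finally show ?case
      by simp
  qed
qed

end

section \<open>Positive semidefinite Gram matrices\<close>

text \<open>Cholesky elimination, one index at a time: splitting off a rank-one matrix leaves the
  Schur complement \<open>H\<close>, which is again positive semidefinite.\<close>

lemma psd_on_decompose:
  assumes "finite I" "psd_on I G"
  obtains vs where "\<And>i j. i \<in> I \<Longrightarrow> j \<in> I \<Longrightarrow> G i j = (\<Sum>v\<leftarrow>vs. v i * v j)"
proof -
  have "\<exists>vs. \<forall>i\<in>I. \<forall>j\<in>I. G i j = (\<Sum>v\<leftarrow>vs. v i * v j)"
    using assms
  proof (induction I arbitrary: G)
    case empty
    then show ?case by auto
  next
    case (insert a I)
    \<comment> \<open>If \<open>G a a = 0\<close>, division by zero gives zero, so \<open>H\<close>
      is \<open>G\<close> and the vector \<open>w\<close> below vanishes. This is right because the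
      whole row of \<open>a\<close> is then zero.\<close>
    define H where "H i j = G i j - G a i * G a j / G a a" for i j
    have sym: "G i j = G j i" if "i \<in> insert a I" "j \<in> insert a I" for i j
      using insert.prems that by (auto simp: psd_on_def)
    have form: "0 \<le> t\<^sup>2 * G a a + 2 * t * (\<Sum>i\<in>I. v i * G a i) + (\<Sum>i\<in>I. \<Sum>j\<in>I. v i * G i j * v j)" for t v
    proof -
      let ?v = "v(a := t)"
      have "0 \<le> (\<Sum>i\<in>insert a I. \<Sum>j\<in>insert a I. ?v i * G i j * ?v j)"
        using insert.prems by (simp add: psd_on_def)
      also have "\<dots> = t * G a a * t + (\<Sum>j\<in>I. t * G a j * ?v j) +
          (\<Sum>i\<in>I. ?v i * G i a * t + (\<Sum>j\<in>I. ?v i * G i j * ?v j))"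
        using insert.hyps by simp
      also have "(\<Sum>j\<in>I. t * G a j * ?v j) = t * (\<Sum>i\<in>I. v i * G a i)"
        unfolding sum_distrib_left using insert.hyps by (intro sum.cong) auto
      also have "(\<Sum>i\<in>I. ?v i * G i a * t + (\<Sum>j\<in>I. ?v i * G i j * ?v j)) =
          (\<Sum>i\<in>I. t * (v i * G a i) + (\<Sum>j\<in>I. v i * G i j * v j))"
        using insert.hyps sym by (intro sum.cong arg_cong2[where f = "(+)"]) auto
      also have "\<dots> = t * (\<Sum>i\<in>I. v i * G a i) + (\<Sum>i\<in>I. \<Sum>j\<in>I. v i * G i j * v j)"
        by (simp add: sum.distrib sum_distrib_left)
      finally show ?thesis
        by (simp add: power2_eq_square algebra_simps)
    qed
    have Gaa: "0 \<le> G a a"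
      using form[of 1 "\<lambda>_. 0"] by simp
    \<comment> \<open>With a zero diagonal entry the form is affine in \<open>t\<close> with slope
      \<open>2 * G a i\<close>, and nonnegative for all \<open>t\<close>.\<close>
    have Gai: "G a i = 0" if "G a a = 0" "i \<in> I" for i
    proof (rule ccontr)
      assume "G a i \<noteq> 0"
      let ?v = "\<lambda>j. if j = i then 1 else 0 :: real"
      have "(\<Sum>j\<in>I. \<Sum>k\<in>I. ?v j * G j k * ?v k) = (\<Sum>j\<in>I. if j = i then (\<Sum>k\<in>I. if k = i then G i i else 0) else 0)"
        by (intro sum.cong) (auto intro!: sum.cong)
      then have "(\<Sum>j\<in>I. \<Sum>k\<in>I. ?v j * G j k * ?v k) = G i i"
        using that(2) insert.hyps by simp
      moreover have "(\<Sum>j\<in>I. ?v j * G a j) = (\<Sum>j\<in>I. if j = i then G a i else 0)"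
        by (intro sum.cong) auto
      then have "(\<Sum>j\<in>I. ?v j * G a j) = G a i"
        using that(2) insert.hyps by simp
      ultimately have "0 \<le> 2 * t * G a i + G i i" for t
        using form[of t ?v] that(1) by simp
      from this[of "- (G i i + 1) / (2 * G a i)"] \<open>G a i \<noteq> 0\<close> show False
        by (simp add: field_simps)
    qed
    have "psd_on I H"
      unfolding psd_on_def
    proof (intro conjI ballI allI)
      show "H i j = H j i" if "i \<in> I" "j \<in> I" for i j
        using sym that by (simp add: H_def)
      fix v
      let ?s = "\<Sum>i\<in>I. v i * G a i"
      have "(\<Sum>i\<in>I. \<Sum>j\<in>I. v i * H i j * v j) =
          (\<Sum>i\<in>I. \<Sum>j\<in>I. v i * G i j * v j) - (\<Sum>i\<in>I. \<Sum>j\<in>I. (v i * G a i) * (v j * G a j)) / G a a"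
        by (simp add: H_def algebra_simps sum_subtractf sum_divide_distrib)
      also have "(\<Sum>i\<in>I. \<Sum>j\<in>I. (v i * G a i) * (v j * G a j)) = ?s * ?s"
        by (simp add: sum_product)
      finally have eq: "(\<Sum>i\<in>I. \<Sum>j\<in>I. v i * H i j * v j) = (\<Sum>i\<in>I. \<Sum>j\<in>I. v i * G i j * v j) - ?s * ?s / G a a" .
      \<comment> \<open>For \<open>G a a > 0\<close> the choice \<open>t = - ?s / G a a\<close>
        minimises the quadratic in \<open>t\<close>, and the minimum is the form of
        \<open>H\<close>.\<close>
      show "0 \<le> (\<Sum>i\<in>I. \<Sum>j\<in>I. v i * H i j * v j)"
        using form[of "- ?s / G a a" v] unfolding eq
        by (cases "G a a = 0") (auto simp: power2_eq_square field_simps)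
    qed
    then obtain vs where vs: "\<forall>i\<in>I. \<forall>j\<in>I. H i j = (\<Sum>v\<leftarrow>vs. v i * v j)"
      using insert.IH by blast
    define w where "w i = G a i / sqrt (G a a)" for i
    have w: "w i * w j = G a i * G a j / G a a" for i j
      using Gaa by (simp add: w_def)
    have "G i j = (\<Sum>v\<leftarrow>w # map (\<lambda>v. v(a := 0)) vs. v i * v j)"
      if ij: "i \<in> insert a I" "j \<in> insert a I" for i j
    proof -
      have sum_0: "(\<Sum>v\<leftarrow>map (\<lambda>v. v(a := 0)) vs. v i * v j) = (if i = a \<or> j = a then 0 else (\<Sum>v\<leftarrow>vs. v i * v j))"
        by (induction vs) auto
      have "G i j = G a i * G a j / G a a" if "i = a \<or> j = a"
        using that Gai[of i] Gai[of j] ij sym[of i j] by (cases "G a a = 0") auto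
      moreover have "G i j = G a i * G a j / G a a + (\<Sum>v\<leftarrow>vs. v i * v j)" if "\<not> (i = a \<or> j = a)"
      proof -
        have "H i j = (\<Sum>v\<leftarrow>vs. v i * v j)"
          using vs that ij by auto
        then show ?thesis
          by (simp add: H_def)
      qed
      ultimately show ?thesis
        using sum_0 by (auto simp: w)
    qed
    then show ?case by blast
  qed
  then show ?thesis
    using that by blast
qed

lemma gram_poly_SOS:
  assumes "psd_on (exponents k) G"
  shows "gram_poly (exponents k) G \<in> SOS k"
proof -
  obtain vs where vs: "\<And>i j. i \<in> exponents k \<Longrightarrow> j \<in> exponents k \<Longrightarrow> G i j = (\<Sum>v\<leftarrow>vs. v i * v j)"
    using psd_on_decompose[OF finite_exponents assms] by blast
  define q where "q v = (\<Sum>\<alpha>\<in>exponents k. Poly_Mapping.single \<alpha> (v \<alpha>))" for v :: "('a \<Rightarrow>\<^sub>0 nat) \<Rightarrow> real"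
  have "(q v) ^ 2 = gram_poly (exponents k) (\<lambda>i j. v i * v j)" for v
    by (simp add: q_def gram_poly_def power2_eq_square sum_product mult_single)
  then have "(\<Sum>v\<leftarrow>vs. (q v) ^ 2) = gram_poly (exponents k) (\<lambda>i j. \<Sum>v\<leftarrow>vs. v i * v j)"
    by (induction vs) (simp_all add: gram_poly_add, simp add: gram_poly_def)
  also have "\<dots> = gram_poly (exponents k) G"
    unfolding gram_poly_def using vs by (intro sum.cong) auto
  finally have "gram_poly (exponents k) G = (\<Sum>p\<leftarrow>map q vs. p ^ 2)"
    by (simp add: o_def)
  then show ?thesis
    unfolding SOS_def using mpoly_deg_gram_poly by blast
qed

text \<open>A square has the rank-one Gram matrix of its coefficient vector, with entries at most
  the squared norm of that vector and so at most \<open>riesz z (g * q ^ 2) / \<epsilon>\<close>.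
  Both sides add up over the squares, so the bound is independent of their number.\<close>

lemma SOS_gram:
  fixes s g :: "('v::finite) mpoly"
  assumes "s \<in> SOS k" and \<epsilon>: "0 < \<epsilon>"
    and bound: "\<And>c. \<epsilon> * (\<Sum>\<alpha>\<in>exponents k. (c \<alpha>)\<^sup>2) \<le>
      (\<Sum>\<alpha>\<in>exponents k. \<Sum>\<beta>\<in>exponents k. c \<alpha> * loc_matrix g z \<alpha> \<beta> * c \<beta>)"
  obtains G where "psd_on (exponents k) G" "s = gram_poly (exponents k) G"
    "\<And>\<alpha> \<beta>. \<alpha> \<in> exponents k \<Longrightarrow> \<beta> \<in> exponents k \<Longrightarrow> \<epsilon> * \<bar>G \<alpha> \<beta>\<bar> \<le> riesz z (g * s)"
proof -
  let ?I = "exponents k :: ('v \<Rightarrow>\<^sub>0 nat) set"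
  obtain qs where qs: "s = (\<Sum>q\<leftarrow>qs. q ^ 2)" "\<And>q. q \<in> set qs \<Longrightarrow> mpoly_deg q \<le> k"
    using assms(1) by (rule SOS_obtain) blast
  have "\<exists>G. psd_on ?I G \<and> (\<Sum>q\<leftarrow>ps. q ^ 2) = gram_poly ?I G \<and>
      (\<forall>\<alpha>\<in>?I. \<forall>\<beta>\<in>?I. \<epsilon> * \<bar>G \<alpha> \<beta>\<bar> \<le> riesz z (g * (\<Sum>q\<leftarrow>ps. q ^ 2)))" if "set ps \<subseteq> set qs" for ps
    using that
  proof (induction ps)
    case Nil
    then show ?case
      by (intro exI[of _ "\<lambda>_ _. 0"]) (simp add: psd_on_def gram_poly_def)
  next
    case (Cons q ps)
    then obtain G where G: "psd_on ?I G" "(\<Sum>q\<leftarrow>ps. q ^ 2) = gram_poly ?I G"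
      "\<forall>\<alpha>\<in>?I. \<forall>\<beta>\<in>?I. \<epsilon> * \<bar>G \<alpha> \<beta>\<bar> \<le> riesz z (g * (\<Sum>q\<leftarrow>ps. q ^ 2))"
      by auto
    let ?c = "Poly_Mapping.lookup q"
    have "Poly_Mapping.keys q \<subseteq> ?I"
      using Cons.prems qs(2) by (auto simp: mpoly_deg_le_iff)
    then have sq: "q ^ 2 = gram_poly ?I (\<lambda>\<alpha> \<beta>. ?c \<alpha> * ?c \<beta>)"
      by (rule power2_eq_gram_poly[OF finite_exponents])
    have "riesz z (g * q ^ 2) = (\<Sum>\<alpha>\<in>?I. \<Sum>\<beta>\<in>?I. ?c \<alpha> * loc_matrix g z \<alpha> \<beta> * ?c \<beta>)"
      unfolding sq riesz_mult_gram_poly by (simp add: mult_ac)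
    then have riesz: "\<epsilon> * (\<Sum>\<alpha>\<in>?I. (?c \<alpha>)\<^sup>2) \<le> riesz z (g * q ^ 2)"
      using bound[of ?c] by simp
    have entry: "\<epsilon> * \<bar>?c \<alpha> * ?c \<beta>\<bar> \<le> riesz z (g * q ^ 2)" if "\<alpha> \<in> ?I" "\<beta> \<in> ?I" for \<alpha> \<beta>
    proof -
      have "(?c \<alpha>)\<^sup>2 \<le> (\<Sum>\<alpha>\<in>?I. (?c \<alpha>)\<^sup>2)" "(?c \<beta>)\<^sup>2 \<le> (\<Sum>\<alpha>\<in>?I. (?c \<alpha>)\<^sup>2)"
        using that finite_exponents by (auto intro!: member_le_sum)
      moreover have "2 * (\<bar>?c \<alpha>\<bar> * \<bar>?c \<beta>\<bar>) \<le> (?c \<alpha>)\<^sup>2 + (?c \<beta>)\<^sup>2"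
        using sum_squares_bound[of "\<bar>?c \<alpha>\<bar>" "\<bar>?c \<beta>\<bar>"] by simp
      ultimately have "\<bar>?c \<alpha> * ?c \<beta>\<bar> \<le> (\<Sum>\<alpha>\<in>?I. (?c \<alpha>)\<^sup>2)"
        by (simp add: abs_mult)
      then show ?thesis
        using \<epsilon> riesz mult_left_mono[of "\<bar>?c \<alpha> * ?c \<beta>\<bar>" _ \<epsilon>] by (meson less_imp_le order_trans)
    qed
    show ?case
    proof (intro exI conjI ballI)
      have "(\<Sum>i\<in>?I. \<Sum>j\<in>?I. v i * (?c i * ?c j) * v j) = (\<Sum>i\<in>?I. v i * ?c i)\<^sup>2" for v
        by (simp add: power2_eq_square sum_product mult_ac)
      then show "psd_on ?I (\<lambda>\<alpha> \<beta>. ?c \<alpha> * ?c \<beta> + G \<alpha> \<beta>)"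
        using G(1) by (simp add: psd_on_def ring_distribs sum.distrib)
      show "(\<Sum>q\<leftarrow>q # ps. q ^ 2) = gram_poly ?I (\<lambda>\<alpha> \<beta>. ?c \<alpha> * ?c \<beta> + G \<alpha> \<beta>)"
        by (simp add: gram_poly_add G(2) sq)
      fix \<alpha> \<beta> assume ab: "\<alpha> \<in> ?I" "\<beta> \<in> ?I"
      have "\<epsilon> * \<bar>?c \<alpha> * ?c \<beta> + G \<alpha> \<beta>\<bar> \<le> \<epsilon> * (\<bar>?c \<alpha> * ?c \<beta>\<bar> + \<bar>G \<alpha> \<beta>\<bar>)"
        using \<epsilon> by (intro mult_left_mono abs_triangle_ineq) auto
      also have "\<dots> \<le> riesz z (g * q ^ 2) + riesz z (g * (\<Sum>q\<leftarrow>ps. q ^ 2))"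
        unfolding distrib_left using entry[OF ab] G(3) ab by (intro add_mono) auto
      also have "\<dots> = riesz z (g * (\<Sum>q\<leftarrow>q # ps. q ^ 2))"
        by (simp add: distrib_left riesz_add)
      finally show "\<epsilon> * \<bar>?c \<alpha> * ?c \<beta> + G \<alpha> \<beta>\<bar> \<le> riesz z (g * (\<Sum>q\<leftarrow>q # ps. q ^ 2))" .
    qed
  qed
  from this[OF order_refl] show ?thesis
    using that by (auto simp: qs(1))
qed

section \<open>Compactness in finitely many coordinates, coefficients under renaming\<close>

text \<open>Bolzano-Weierstrass one coordinate at a time, for families indexed by a finite
  set.\<close>

lemma finite_convergent_subsequence:
  fixes X :: "nat \<Rightarrow> 'a \<Rightarrow> real"
  assumes "finite A" "\<And>a. a \<in> A \<Longrightarrow> bounded (range (\<lambda>n. X n a))"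
  obtains \<sigma> L where "strict_mono (\<sigma> :: nat \<Rightarrow> nat)" "\<And>a. a \<in> A \<Longrightarrow> (\<lambda>n. X (\<sigma> n) a) \<longlonglongrightarrow> L a"
proof -
  have "\<exists>\<sigma> L. strict_mono (\<sigma> :: nat \<Rightarrow> nat) \<and> (\<forall>a\<in>A. (\<lambda>n. X (\<sigma> n) a) \<longlonglongrightarrow> L a)"
    using assms
  proof (induction A)
    case empty
    then show ?case using strict_mono_id by blast
  next
    case (insert a A)
    then obtain \<sigma> L where \<sigma>: "strict_mono (\<sigma> :: nat \<Rightarrow> nat)" "\<forall>a\<in>A. (\<lambda>n. X (\<sigma> n) a) \<longlonglongrightarrow> L a"
      by auto
    have "bounded (range (\<lambda>n. X (\<sigma> n) a))"
      using insert.prems[of a] by (rule bounded_subset) auto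
    then obtain l \<tau> where \<tau>: "strict_mono (\<tau> :: nat \<Rightarrow> nat)" "((\<lambda>n. X (\<sigma> n) a) \<circ> \<tau>) \<longlonglongrightarrow> l"
      using bounded_imp_convergent_subsequence by blast
    have "(\<lambda>n. X ((\<sigma> \<circ> \<tau>) n) b) \<longlonglongrightarrow> (L(a := l)) b" if "b \<in> insert a A" for b
    proof (cases "b = a")
      case True
      then show ?thesis using \<tau>(2) by (simp add: o_def)
    next
      case False
      then have "(\<lambda>n. X (\<sigma> n) b) \<longlonglongrightarrow> L b"
        using \<sigma>(2) that by auto
      from LIMSEQ_subseq_LIMSEQ[OF this \<tau>(1)] show ?thesis
        using False by (simp add: o_def)
    qed
    then show ?case
      using strict_mono_o[OF \<sigma>(1) \<tau>(1)] by blast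
  qed
  then show ?thesis
    using that by blast
qed

text \<open>Otherwise unit vectors with values of the form below \<open>1 / (n + 1)\<close> would
  have a limit point of norm one at which the form is not positive.\<close>

lemma positive_definite_lower_bound:
  fixes M :: "'a \<Rightarrow> 'a \<Rightarrow> real"
  assumes "finite I" and pos: "\<And>c i. i \<in> I \<Longrightarrow> c i \<noteq> 0 \<Longrightarrow> 0 < (\<Sum>i\<in>I. \<Sum>j\<in>I. c i * M i j * c j)"
  obtains \<epsilon> where "0 < \<epsilon>" "\<And>c. \<epsilon> * (\<Sum>i\<in>I. (c i)\<^sup>2) \<le> (\<Sum>i\<in>I. \<Sum>j\<in>I. c i * M i j * c j)"
proof (rule ccontr)
  let ?E = "\<lambda>c. \<Sum>i\<in>I. \<Sum>j\<in>I. c i * M i j * c j" and ?N = "\<lambda>c. \<Sum>i\<in>I. (c i)\<^sup>2"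
  assume "\<not> thesis"
  then have "\<forall>n. \<exists>c. ?E c < 1 / real (Suc n) * ?N c"
    using that[of "1 / real (Suc _)"] by (force simp: not_le)
  from choice[OF this] obtain c where c: "\<And>n. ?E (c n) < 1 / real (Suc n) * ?N (c n)"
    by blast
  have N: "0 < ?N (c n)" for n
  proof (rule ccontr)
    assume "\<not> 0 < ?N (c n)"
    then have "?N (c n) = 0"
      by (simp add: antisym not_less sum_nonneg)
    then have "\<forall>i\<in>I. c n i = 0"
      using assms(1) by (simp add: sum_nonneg_eq_0_iff)
    then show False
      using c[of n] by simp
  qed
  define d where "d n i = c n i / sqrt (?N (c n))" for n i
  have Nd: "?N (d n) = 1" for n
    using N[of n] by (simp add: d_def power_divide flip: sum_divide_distrib)
  have Ed: "?E (d n) < 1 / real (Suc n)" for n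
  proof -
    have "d n i * M i j * d n j = c n i * M i j * c n j / ?N (c n)" for i j
      using N[of n] by (simp add: d_def)
    then have "?E (d n) = ?E (c n) / ?N (c n)"
      by (simp only: sum_divide_distrib)
    then show ?thesis
      using c[of n] N[of n] by (simp only: pos_divide_less_eq)
  qed
  have "bounded (range (\<lambda>n. d n i))" if "i \<in> I" for i
  proof (rule boundedI)
    fix t assume "t \<in> range (\<lambda>n. d n i)"
    then obtain n where "t = d n i" by blast
    moreover have "(d n i)\<^sup>2 \<le> ?N (d n)"
      using assms(1) that by (intro member_le_sum) auto
    ultimately show "norm t \<le> 1"
      by (simp add: Nd abs_square_le_1)
  qed
  then obtain \<sigma> L where \<sigma>: "strict_mono (\<sigma> :: nat \<Rightarrow> nat)" "\<And>i. i \<in> I \<Longrightarrow> (\<lambda>n. d (\<sigma> n) i) \<longlonglongrightarrow> L i"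
    using finite_convergent_subsequence[OF assms(1), of d] by metis
  have "(\<lambda>n. ?N (d (\<sigma> n))) \<longlonglongrightarrow> ?N L"
    using \<sigma>(2) by (intro tendsto_sum tendsto_power)
  then have "?N L = 1"
    by (simp add: Nd LIMSEQ_const_iff)
  then obtain i where "i \<in> I" "L i \<noteq> 0"
    by (metis (no_types, lifting) sum.neutral zero_neq_one zero_power2)
  then have "0 < ?E L"
    by (rule pos)
  moreover have "(\<lambda>n. ?E (d (\<sigma> n))) \<longlonglongrightarrow> ?E L"
    using \<sigma>(2) by (intro tendsto_sum tendsto_mult tendsto_const)
  moreover have "(\<lambda>n. 1 / real (Suc (\<sigma> n))) \<longlonglongrightarrow> 0"
    using LIMSEQ_subseq_LIMSEQ[OF LIMSEQ_Suc[OF lim_1_over_n] \<sigma>(1)] by (simp add: o_def)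
  ultimately have "?E L \<le> 0"
    using Ed by (intro LIMSEQ_le[of "\<lambda>n. ?E (d (\<sigma> n))"]) (auto intro: less_imp_le)
  with \<open>0 < ?E L\<close> show False by simp
qed

lemma real_polynomial_function_eq_0:
  fixes g :: "real ^ 'v::finite \<Rightarrow> real"
  assumes "real_polynomial_function g" "\<not> negligible A" "\<And>a. a \<in> A \<Longrightarrow> g a = 0"
  shows "g x = 0"
proof -
  obtain p where p: "\<And>x. mpoly_eval p x = g x"
    using assms(1) by (rule real_polynomial_function_imp_mpoly) blast
  have "\<not> negligible {x. mpoly_eval p x = 0}"
    using assms(2,3) negligible_subset[of _ A] by (auto simp: p)
  then have "p = 0"
    using negligible_mpoly_zeros by blast
  then show ?thesis
    using p[of x] by simp
qed

lemma real_polynomial_function_join: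
  "real_polynomial_function (\<lambda>x. mpoly_eval p (join x y))"
  "real_polynomial_function (\<lambda>y. mpoly_eval p (join x y))"
proof -
  have 1: "real_polynomial_function (\<lambda>x. join x y $ k)" for k
    by (cases k) (simp_all add: real_polynomial_function.intros bounded_linear_vec_nth)
  have 2: "real_polynomial_function (\<lambda>y. join x y $ k)" for k
    by (cases k) (simp_all add: real_polynomial_function.intros bounded_linear_vec_nth)
  have "polynomial_function (\<lambda>x. join x y)" "polynomial_function (\<lambda>y. join x y)"
    unfolding polynomial_function_iff_Basis_inner using 1 2 by (auto simp: Basis_vec_def inner_axis)
  then show "real_polynomial_function (\<lambda>x. mpoly_eval p (join x y))"
    "real_polynomial_function (\<lambda>y. mpoly_eval p (join x y))"
    using real_polynomial_function_compose[OF _ real_polynomial_function_mpoly_eval]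
    by (auto simp: o_def)
qed

lemma lookup_rename_mono_Inr [simp]:
  "Poly_Mapping.lookup (rename_mono Inr \<beta> :: 'n::finite + 'm::finite \<Rightarrow>\<^sub>0 nat) (Inr j) = Poly_Mapping.lookup \<beta> j"
  by (simp add: rename_mono_def lookup_sum lookup_single when_def)

lemma inj_rename_mono_Inr: "inj (rename_mono Inr :: _ \<Rightarrow> 'n::finite + 'm::finite \<Rightarrow>\<^sub>0 nat)"
  by (rule injI) (metis lookup_rename_mono_Inr poly_mapping_eqI)

lemma lookup_rename_Inr [simp]:
  "Poly_Mapping.lookup (rename Inr q :: ('n::finite + 'm::finite) mpoly) (rename_mono Inr \<beta>) = Poly_Mapping.lookup q \<beta>"
proof -
  have "Poly_Mapping.lookup (rename Inr q :: ('n + 'm) mpoly) (rename_mono Inr \<beta>) =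
      (\<Sum>\<alpha>\<in>Poly_Mapping.keys q. if \<alpha> = \<beta> then Poly_Mapping.lookup q \<beta> else 0)"
    unfolding rename_def lookup_sum
    by (intro sum.cong refl) (auto simp: lookup_single when_def inj_eq[OF inj_rename_mono_Inr])
  then show ?thesis
    by (simp add: in_keys_iff)
qed

section \<open>Attainment of the primal optimum\<close>

definition mono_left :: "('n::finite + 'm::finite \<Rightarrow>\<^sub>0 nat) \<Rightarrow> real ^ 'n \<Rightarrow> real" where
  "mono_left \<gamma> x = (\<Prod>i\<in>UNIV. (x $ i) ^ Poly_Mapping.lookup \<gamma> (Inl i))"

definition mono_right :: "('n::finite + 'm::finite \<Rightarrow>\<^sub>0 nat) \<Rightarrow> real ^ 'm \<Rightarrow> real" where
  "mono_right \<gamma> y = (\<Prod>j\<in>UNIV. (y $ j) ^ Poly_Mapping.lookup \<gamma> (Inr j))"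

lemma mono_eval_join: "mono_eval \<gamma> (join x y) = mono_left \<gamma> x * mono_right \<gamma> y"
  unfolding mono_eval_def mono_left_def mono_right_def UNIV_Plus_UNIV[symmetric]
  by (subst prod.Plus) (auto simp: o_def)

lemma continuous_on_mono_left: "continuous_on A (mono_left \<gamma>)"
  unfolding mono_left_def by (intro continuous_intros)

lemma continuous_on_mono_right: "continuous_on A (mono_right \<gamma>)"
  unfolding mono_right_def by (intro continuous_intros)

text \<open>Coefficients are linear in the Gram entries, so convergence of the entries carries over
  to the polynomial.\<close>

lemma sum_gram_lookup:
  fixes g :: "('v::finite) mpoly"
  shows "Poly_Mapping.lookup (gram_poly I G * g) \<gamma> =
    (\<Sum>\<alpha>\<in>I. \<Sum>\<beta>\<in>I. G \<alpha> \<beta> * Poly_Mapping.lookup (Poly_Mapping.single (\<alpha> + \<beta>) 1 * g) \<gamma>)"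
proof -
  have "Poly_Mapping.single \<delta> c * g = c *\<^sub>R (Poly_Mapping.single \<delta> 1 * g)" for \<delta> c
    by (simp only: mult_scaleR_left[symmetric] scaleR_single mult_1_right)
  then have "Poly_Mapping.lookup (Poly_Mapping.single \<delta> c * g) \<gamma> =
      c * Poly_Mapping.lookup (Poly_Mapping.single \<delta> 1 * g) \<gamma>" for \<delta> c
    by (metis lookup_scaleR real_scaleR_def)
  then show ?thesis
    unfolding gram_poly_def sum_distrib_right lookup_sum by (intro sum.cong refl)
qed

lemma psd_on_limit:
  assumes "\<And>n. psd_on I (G n)"
    and "\<And>i j. i \<in> I \<Longrightarrow> j \<in> I \<Longrightarrow> (\<lambda>n. G n i j) \<longlonglongrightarrow> L i j"
  shows "psd_on I L"
  unfolding psd_on_def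
proof (intro conjI ballI allI)
  fix i j assume ij: "i \<in> I" "j \<in> I"
  then have "(\<lambda>n. G n i j) = (\<lambda>n. G n j i)"
    using assms(1) by (auto simp: psd_on_def)
  then show "L i j = L j i"
    using assms(2)[OF ij] assms(2)[OF ij(2,1)] LIMSEQ_unique by metis
next
  fix v
  have "(\<lambda>n. \<Sum>i\<in>I. \<Sum>j\<in>I. v i * G n i j * v j) \<longlonglongrightarrow> (\<Sum>i\<in>I. \<Sum>j\<in>I. v i * L i j * v j)"
    using assms(2) by (intro tendsto_sum tendsto_mult tendsto_const)
  then show "0 \<le> (\<Sum>i\<in>I. \<Sum>j\<in>I. v i * L i j * v j)"
    using assms(1) by (intro LIMSEQ_le_const) (auto simp: psd_on_def)
qed

lemma negligible_if_AE_lebesgue_on: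
  assumes "A \<in> sets lebesgue" "AE x in lebesgue_on A. P x"
  shows "negligible {x \<in> A. \<not> P x}"
proof -
  have "AE x in lebesgue. x \<in> A \<longrightarrow> P x"
    using assms by (simp add: AE_restrict_space_iff)
  then obtain N where "N \<in> null_sets lebesgue" "{x \<in> A. \<not> P x} \<subseteq> N"
    unfolding eventually_ae_filter by auto
  then show ?thesis
    using negligible_iff_null_sets negligible_subset by blast
qed

context image_approximation
begin

lemma integrable_S: "continuous_on S g \<Longrightarrow> integrable (lebesgue_on S) g" for g :: "real ^ 'n \<Rightarrow> real"
  by (intro integrable_lebesgue_on_compact compact_S)

text \<open>The moments of the product of the normalised Lebesgue measure on \<open>S\<close> with the Lebesgue
  measure on \<open>B\<close>: a Slater point of the dual program.\<close>

definition slater :: "('n + 'm \<Rightarrow>\<^sub>0 nat) \<Rightarrow> real" where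
  "slater \<gamma> = (\<integral>x. mono_left \<gamma> x \<partial>lebesgue_on S) * (\<integral>y. mono_right \<gamma> y \<partial>lebesgue_on B) / measure lebesgue S"

lemma inner_integral:
  "(\<integral>x. mpoly_eval p (join x y) \<partial>lebesgue_on S) =
    (\<Sum>\<gamma>\<in>Poly_Mapping.keys p. Poly_Mapping.lookup p \<gamma> * (\<integral>x. mono_left \<gamma> x \<partial>lebesgue_on S) * mono_right \<gamma> y)"
proof -
  have "(\<integral>x. mpoly_eval p (join x y) \<partial>lebesgue_on S) =
      (\<integral>x. (\<Sum>\<gamma>\<in>Poly_Mapping.keys p. Poly_Mapping.lookup p \<gamma> * (mono_left \<gamma> x * mono_right \<gamma> y)) \<partial>lebesgue_on S)"
    by (simp add: mpoly_eval_def mono_eval_join)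
  also have "\<dots> = (\<Sum>\<gamma>\<in>Poly_Mapping.keys p. \<integral>x. Poly_Mapping.lookup p \<gamma> * (mono_left \<gamma> x * mono_right \<gamma> y) \<partial>lebesgue_on S)"
    by (intro Bochner_Integration.integral_sum integrable_S continuous_intros continuous_on_mono_left)
  finally show ?thesis
    by (simp add: mult.assoc)
qed

lemma continuous_on_inner_integral: "continuous_on A (\<lambda>y. \<integral>x. mpoly_eval p (join x y) \<partial>lebesgue_on S)"
  unfolding inner_integral by (intro continuous_intros continuous_on_mono_right)

lemma riesz_slater:
  "riesz slater p = (\<integral>y. \<integral>x. mpoly_eval p (join x y) \<partial>lebesgue_on S \<partial>lebesgue_on B) / measure lebesgue S"
proof -
  have "(\<integral>y. \<integral>x. mpoly_eval p (join x y) \<partial>lebesgue_on S \<partial>lebesgue_on B) = (\<Sum>\<gamma>\<in>Poly_Mapping.keys p.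
      \<integral>y. Poly_Mapping.lookup p \<gamma> * (\<integral>x. mono_left \<gamma> x \<partial>lebesgue_on S) * mono_right \<gamma> y \<partial>lebesgue_on B)"
    unfolding inner_integral
    by (intro Bochner_Integration.integral_sum integrable_B continuous_intros continuous_on_mono_right)
  then show ?thesis
    by (simp add: riesz_def slater_def sum_divide_distrib mult.assoc)
qed

lemma riesz_slater_nonneg:
  assumes "\<And>x y. x \<in> S \<Longrightarrow> y \<in> B \<Longrightarrow> 0 \<le> mpoly_eval p (join x y)"
  shows "0 \<le> riesz slater p"
  unfolding riesz_slater using assms
  by (intro divide_nonneg_nonneg Bochner_Integration.integral_nonneg) auto

lemma measure_S_pos:
  assumes "interior S \<noteq> {}"
  shows "\<not> negligible S" "0 < measure lebesgue S"
proof -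
  show "\<not> negligible S"
    using assms open_not_negligible[of "interior S"] negligible_subset[OF _ interior_subset] by blast
  then have "measure lebesgue S \<noteq> 0"
    using negligible_iff_measure0[OF lmeasurable_compact[OF compact_S]] by simp
  then show "0 < measure lebesgue S"
    by (simp add: zero_less_measure_iff)
qed

text \<open>The division by the volume of \<open>S\<close> gives the measure in \<open>x\<close>
  total mass one, so the moments in \<open>y\<close> are those prescribed in the dual
  program.\<close>

lemma riesz_slater_rename_Inr:
  assumes "interior S \<noteq> {}" "mpoly_deg q \<le> 2 * r"
  shows "riesz slater (rename Inr q) = obj r q"
  using measure_S_pos(2)[OF assms(1)] compact_S
  by (simp add: riesz_slater obj_eq_integral[OF assms(2)] measure_restrict_space compact_imp_closed)

text \<open>If the integral vanishes, then for almost all \<open>y\<close> in \<open>B\<close> the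
  polynomial vanishes almost everywhere on \<open>S\<close>, hence for all \<open>x\<close>. For
  each fixed \<open>x\<close> it then vanishes on a non-null set of \<open>y\<close>, hence
  identically.\<close>

lemma riesz_slater_pos:
  assumes S: "interior S \<noteq> {}" and B: "\<not> negligible B"
    and nonneg: "\<And>x y. x \<in> S \<Longrightarrow> y \<in> B \<Longrightarrow> 0 \<le> mpoly_eval p (join x y)" and "p \<noteq> 0"
  shows "0 < riesz slater p"
proof (rule ccontr)
  assume "\<not> 0 < riesz slater p"
  then have "riesz slater p = 0"
    using riesz_slater_nonneg[OF nonneg] by simp
  define I where "I y = (\<integral>x. mpoly_eval p (join x y) \<partial>lebesgue_on S)" for y
  have "(\<integral>y. I y \<partial>lebesgue_on B) = 0"
    using \<open>riesz slater p = 0\<close> measure_S_pos(2)[OF S] by (simp add: riesz_slater I_def)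
  moreover have "0 \<le> I y" if "y \<in> B" for y
    unfolding I_def using nonneg that by (intro Bochner_Integration.integral_nonneg) auto
  moreover have "integrable (lebesgue_on B) I"
    unfolding I_def by (intro integrable_B continuous_on_inner_integral)
  ultimately have "AE y in lebesgue_on B. I y = 0"
    by (subst (asm) integral_nonneg_eq_0_iff_AE) auto
  then have "negligible {y \<in> B. I y \<noteq> 0}"
    using compact_B by (intro negligible_if_AE_lebesgue_on) (auto simp: compact_imp_closed)
  then have Y: "\<not> negligible {y \<in> B. I y = 0}"
    using B negligible_Un[of "{y \<in> B. I y \<noteq> 0}" "{y \<in> B. I y = 0}"] negligible_subset[of _ B] by fastforce
  have "mpoly_eval p (join x y) = 0" if "y \<in> B" "I y = 0" for x y
  proof -
    have "AE x in lebesgue_on S. mpoly_eval p (join x y) = 0"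
      using that nonneg unfolding I_def
      by (subst (asm) integral_nonneg_eq_0_iff_AE)
        (auto intro!: integrable_S continuous_on_polymonial_function
          simp: real_polynomial_function_join real_polynomial_function_eq[symmetric])
    then have "negligible {x \<in> S. mpoly_eval p (join x y) \<noteq> 0}"
      using compact_S by (intro negligible_if_AE_lebesgue_on) (auto simp: compact_imp_closed)
    then have "\<not> negligible {x \<in> S. mpoly_eval p (join x y) = 0}"
      using measure_S_pos(1)[OF S] negligible_Un[of "{x \<in> S. mpoly_eval p (join x y) \<noteq> 0}"
          "{x \<in> S. mpoly_eval p (join x y) = 0}"] negligible_subset[of _ S] by fastforce
    then show ?thesis
      by (rule real_polynomial_function_eq_0[of "\<lambda>x. mpoly_eval p (join x y)",
            OF real_polynomial_function_join(1)]) auto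
  qed
  then have "mpoly_eval p (join x y) = 0" for x y
    by (rule real_polynomial_function_eq_0[of "\<lambda>y. mpoly_eval p (join x y)",
          OF real_polynomial_function_join(2) Y]) auto
  then have "p = 0"
    by (intro mpoly_eqI) (metis join_proj mpoly_eval_zero)
  then show False
    using \<open>p \<noteq> 0\<close> by simp
qed

lemma primal_feasible_obtain:
  assumes "q \<in> primal_feasible f gS gB r"
  obtains s where "rename Inr q - hf_poly f = (\<Sum>j\<le>length (prod_constraints gS gB). s j * (1 # prod_constraints gS gB) ! j)"
    "\<And>j. j \<le> length (prod_constraints gS gB) \<Longrightarrow> s j \<in> SOS (r - half_deg ((1 # prod_constraints gS gB) ! j))"
  using assms unfolding primal_feasible_def quad_module_def by blast

lemma constraint_nonneg:
  assumes "g \<in> set (1 # prod_constraints gS gB)" "x \<in> S" "y \<in> B"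
  shows "0 \<le> mpoly_eval g (join x y)"
  using assms join_mem_prod_constraints[of x y gS gB] by (auto simp: basic_semialg_def mpoly_eval_one)

text \<open>The conclusion concerns \<open>s * g\<close> instead of \<open>s\<close> because a zero
  constraint puts no bound on its multiplier; in that case the zero matrix represents the same
  product. Otherwise the localizing matrix of \<open>g\<close> is positive definite and controls
  every Gram entry.\<close>

lemma gram_bounded:
  assumes S: "interior S \<noteq> {}" and B: "\<not> negligible B"
    and g: "g \<in> set (1 # prod_constraints gS gB)" and "0 \<le> C"
  obtains K where "\<And>s. s \<in> SOS k \<Longrightarrow> riesz slater (s * g) \<le> C \<Longrightarrow>
    \<exists>G. psd_on (exponents k) G \<and> s * g = gram_poly (exponents k) G * g \<and>
      (\<forall>\<alpha>\<in>exponents k. \<forall>\<beta>\<in>exponents k. \<bar>G \<alpha> \<beta>\<bar> \<le> K)"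
proof (cases "g = 0")
  case True
  then show ?thesis
    by (intro that[of 0] exI[of _ "\<lambda>_ _. 0"]) (simp add: psd_on_def)
next
  case False
  let ?I = "exponents k :: ('n + 'm \<Rightarrow>\<^sub>0 nat) set"
  have pos: "0 < (\<Sum>\<alpha>\<in>?I. \<Sum>\<beta>\<in>?I. c \<alpha> * loc_matrix g slater \<alpha> \<beta> * c \<beta>)"
    if i: "i \<in> ?I" "c i \<noteq> 0" for c i
  proof -
    define q where "q = (\<Sum>\<alpha>\<in>?I. Poly_Mapping.single \<alpha> (c \<alpha>))"
    have lookup: "Poly_Mapping.lookup q \<alpha> = (if \<alpha> \<in> ?I then c \<alpha> else 0)" for \<alpha>
      by (simp add: q_def lookup_sum lookup_single when_def finite_exponents)
    have "q \<noteq> 0"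
      using lookup[of i] i by auto
    then have "g * q ^ 2 \<noteq> 0"
      using False by (simp add: mpoly_mult_eq_0_iff power2_eq_square)
    then have "0 < riesz slater (g * q ^ 2)"
      using constraint_nonneg[OF g]
      by (intro riesz_slater_pos[OF S B]) (auto simp: mpoly_eval_mult mpoly_eval_power)
    moreover have keys: "Poly_Mapping.keys q \<subseteq> ?I"
      using lookup by (auto simp: in_keys_iff split: if_splits)
    have "riesz slater (g * q ^ 2) = (\<Sum>\<alpha>\<in>?I. \<Sum>\<beta>\<in>?I. c \<alpha> * loc_matrix g slater \<alpha> \<beta> * c \<beta>)"
      unfolding power2_eq_gram_poly[OF finite_exponents keys] riesz_mult_gram_poly
      by (intro sum.cong) (auto simp: lookup)
    ultimately show ?thesis by simp
  qed
  obtain \<epsilon> where \<epsilon>: "0 < \<epsilon>" "\<And>c. \<epsilon> * (\<Sum>\<alpha>\<in>?I. (c \<alpha>)\<^sup>2) \<le>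
      (\<Sum>\<alpha>\<in>?I. \<Sum>\<beta>\<in>?I. c \<alpha> * loc_matrix g slater \<alpha> \<beta> * c \<beta>)"
    by (rule positive_definite_lower_bound[OF finite_exponents pos], assumption, assumption, rule that)
  show ?thesis
  proof (rule that)
    fix s assume s: "s \<in> SOS k" "riesz slater (s * g) \<le> C"
    obtain G where G: "psd_on ?I G" "s = gram_poly ?I G"
      "\<And>\<alpha> \<beta>. \<alpha> \<in> ?I \<Longrightarrow> \<beta> \<in> ?I \<Longrightarrow> \<epsilon> * \<bar>G \<alpha> \<beta>\<bar> \<le> riesz slater (g * s)"
      by (rule SOS_gram[OF s(1) \<epsilon>], rule that)
    have "\<bar>G \<alpha> \<beta>\<bar> \<le> C / \<epsilon>" if "\<alpha> \<in> ?I" "\<beta> \<in> ?I" for \<alpha> \<beta>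
      using G(3)[OF that] s(2) \<epsilon>(1) by (simp add: pos_le_divide_eq mult.commute)
    then show "\<exists>G. psd_on ?I G \<and> s * g = gram_poly ?I G * g \<and> (\<forall>\<alpha>\<in>?I. \<forall>\<beta>\<in>?I. \<bar>G \<alpha> \<beta>\<bar> \<le> C / \<epsilon>)"
      using G by auto
  qed
qed

lemma primal_attained_null:
  assumes r: "min_order f gS gB \<le> r" and B: "negligible B"
  shows "primal_optimal f gS gB r 0"
proof -
  have "obj r q = 0" if "q \<in> primal_feasible f gS gB r" for q
  proof -
    have "AE y in lebesgue_on B. mpoly_eval q y = 0"
      using B compact_B AE_not_in[of B lebesgue]
      by (auto simp: AE_restrict_space_iff compact_imp_closed negligible_iff_null_sets)
    then have "(\<integral>y. mpoly_eval q y \<partial>lebesgue_on B) = 0"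
      by (rule integral_eq_zero_AE)
    then show ?thesis
      using that by (simp add: obj_eq_integral primal_feasible_def)
  qed
  then have "obj r ` primal_feasible f gS gB r = {0}"
    using zero_primal_feasible[OF r] by force
  then show ?thesis
    using zero_primal_feasible[OF r] by (simp add: primal_optimal_iff[OF r] opt_def primal_objective_def)
qed

lemma primal_attained:
  assumes S: "interior S \<noteq> {}" and r: "min_order f gS gB \<le> r"
  obtains q where "primal_optimal f gS gB r q"
proof (cases "negligible B")
  case True
  then show ?thesis
    using that primal_attained_null[OF r] by blast
next
  case B: False
  let ?gs = "prod_constraints gS gB"
  define g where "g j = (1 # ?gs) ! j" for j
  define k where "k j = r - half_deg (g j)" for j
  define J where "J = {..length ?gs}"
  have g: "g j \<in> set (1 # ?gs)" if "j \<in> J" for j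
    unfolding g_def using that by (intro nth_Cons_one_mem) (simp add: J_def)
  have "\<exists>q\<in>primal_feasible f gS gB r. obj r q < opt r + 1 / real (Suc n)" for n
    using cInf_lessD[of "obj r ` primal_feasible f gS gB r" "opt r + 1 / real (Suc n)"]
      zero_primal_feasible[OF r] by (auto simp: opt_def)
  then obtain q where q: "\<And>n. q n \<in> primal_feasible f gS gB r" "\<And>n. obj r (q n) < opt r + 1 / real (Suc n)"
    by metis
  have deg_q: "mpoly_deg (q n) \<le> 2 * r" for n
    using q(1)[of n] by (simp add: primal_feasible_def)
  have "\<forall>n. \<exists>s. rename Inr (q n) - hf_poly f = (\<Sum>j\<in>J. s j * g j) \<and> (\<forall>j\<in>J. s j \<in> SOS (k j))"
  proof
    fix n
    obtain s where "rename Inr (q n) - hf_poly f = (\<Sum>j\<le>length ?gs. s j * (1 # ?gs) ! j)"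
      "\<And>j. j \<le> length ?gs \<Longrightarrow> s j \<in> SOS (r - half_deg ((1 # ?gs) ! j))"
      by (rule primal_feasible_obtain[OF q(1)[of n]], rule that)
    then show "\<exists>s. rename Inr (q n) - hf_poly f = (\<Sum>j\<in>J. s j * g j) \<and> (\<forall>j\<in>J. s j \<in> SOS (k j))"
      by (intro exI[of _ s]) (simp add: J_def g_def k_def)
  qed
  from choice[OF this] obtain s where s: "\<And>n. rename Inr (q n) - hf_poly f = (\<Sum>j\<in>J. s n j * g j)"
    "\<And>n j. j \<in> J \<Longrightarrow> s n j \<in> SOS (k j)"
    by blast
  \<comment> \<open>The terms of the representation take nonnegative values under
    \<open>slater\<close>, so each is at most their sum, the objective minus the value at
    \<open>hf_poly f\<close>. Every objective in the sequence is below
    \<open>opt r + 1\<close>.\<close>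
  define C where "C = opt r + 1 - riesz slater (hf_poly f)"
  have nonneg: "0 \<le> riesz slater (s n j * g j)" if "j \<in> J" for n j
    using constraint_nonneg[OF g[OF that]] SOS_nonneg[OF s(2)[OF that]]
    by (intro riesz_slater_nonneg) (simp add: mpoly_eval_mult)
  have "riesz slater (s n j * g j) \<le> C" if "j \<in> J" for n j
  proof -
    have "riesz slater (s n j * g j) \<le> (\<Sum>j\<in>J. riesz slater (s n j * g j))"
      using that nonneg by (intro member_le_sum) (auto simp: J_def)
    also have "\<dots> = riesz slater (rename Inr (q n) - hf_poly f)"
      by (simp only: s(1) riesz_sum)
    also have "\<dots> = obj r (q n) - riesz slater (hf_poly f)"
      by (simp add: riesz_diff riesz_slater_rename_Inr[OF S deg_q])
    also have "\<dots> \<le> opt r + 1 / real (Suc n) - riesz slater (hf_poly f)"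
      using q(2)[of n] by simp
    also have "\<dots> \<le> C"
      by (simp add: C_def)
    finally show ?thesis .
  qed
  note le_C = this
  have "0 \<le> C"
    using nonneg[of 0 0] le_C[of 0 0] by (simp add: J_def)
  define good where "good j K n G \<longleftrightarrow> psd_on (exponents (k j)) G \<and>
      s n j * g j = gram_poly (exponents (k j)) G * g j \<and>
      (\<forall>\<alpha>\<in>exponents (k j). \<forall>\<beta>\<in>exponents (k j). \<bar>G \<alpha> \<beta>\<bar> \<le> K)" for j K n G
  have "\<exists>K. \<forall>n. \<exists>G. good j K n G" if j: "j \<in> J" for j
  proof -
    obtain K where "\<And>s. s \<in> SOS (k j) \<Longrightarrow> riesz slater (s * g j) \<le> C \<Longrightarrow>
        \<exists>G. psd_on (exponents (k j)) G \<and> s * g j = gram_poly (exponents (k j)) G * g j \<and>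
          (\<forall>\<alpha>\<in>exponents (k j). \<forall>\<beta>\<in>exponents (k j). \<bar>G \<alpha> \<beta>\<bar> \<le> K)"
      by (rule gram_bounded[OF S B g[OF j] \<open>0 \<le> C\<close>], rule that)
    then show ?thesis
      unfolding good_def using s(2)[OF j] le_C[OF j] by blast
  qed
  then have "\<forall>j. \<exists>K. j \<in> J \<longrightarrow> (\<forall>n. \<exists>G. good j K n G)"
    by blast
  from choice[OF this] obtain K where "\<forall>j. \<forall>n. \<exists>G. j \<in> J \<longrightarrow> good j (K j) n G"
    by blast
  then have "\<exists>G. \<forall>j n. j \<in> J \<longrightarrow> good j (K j) n (G j n)"
    by (simp only: choice_iff)
  then obtain G where G: "\<And>n j. j \<in> J \<Longrightarrow> psd_on (exponents (k j)) (G j n)"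
    "\<And>n j. j \<in> J \<Longrightarrow> s n j * g j = gram_poly (exponents (k j)) (G j n) * g j"
    "\<And>n j \<alpha> \<beta>. j \<in> J \<Longrightarrow> \<alpha> \<in> exponents (k j) \<Longrightarrow> \<beta> \<in> exponents (k j) \<Longrightarrow> \<bar>G j n \<alpha> \<beta>\<bar> \<le> K j"
    unfolding good_def by blast
  \<comment> \<open>All entries of all Gram matrices are collected in one finite index set, so that
    a single subsequence serves every constraint.\<close>
  define A :: "(nat \<times> ('n + 'm \<Rightarrow>\<^sub>0 nat) \<times> ('n + 'm \<Rightarrow>\<^sub>0 nat)) set"
    where "A = (SIGMA j:J. exponents (k j) \<times> exponents (k j))"
  define X where "X n = (\<lambda>(j, \<alpha>, \<beta>). G j n \<alpha> \<beta>)" for n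
  have fin: "finite A"
    unfolding A_def by (intro finite_SigmaI finite_cartesian_product finite_exponents) (simp add: J_def)
  have bdd: "bounded (range (\<lambda>n. X n a))" if a: "a \<in> A" for a
  proof -
    obtain j \<alpha> \<beta> where "a = (j, \<alpha>, \<beta>)" "j \<in> J" "\<alpha> \<in> exponents (k j)" "\<beta> \<in> exponents (k j)"
      using a by (auto simp: A_def)
    then show ?thesis
      using G(3) by (intro boundedI[of _ "K j"]) (auto simp: X_def)
  qed
  obtain \<sigma> L where \<sigma>: "strict_mono (\<sigma> :: nat \<Rightarrow> nat)" "\<And>a. a \<in> A \<Longrightarrow> (\<lambda>n. X (\<sigma> n) a) \<longlonglongrightarrow> L a"
    by (rule finite_convergent_subsequence[OF fin bdd], assumption, rule that)
  define H where "H j \<alpha> \<beta> = L (j, \<alpha>, \<beta>)" for j \<alpha> \<beta>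
  have G_lim: "(\<lambda>n. G j (\<sigma> n) \<alpha> \<beta>) \<longlonglongrightarrow> H j \<alpha> \<beta>"
    if "j \<in> J" "\<alpha> \<in> exponents (k j)" "\<beta> \<in> exponents (k j)" for j \<alpha> \<beta>
    using \<sigma>(2)[of "(j, \<alpha>, \<beta>)"] that by (simp add: A_def X_def H_def)
  define t where "t j = gram_poly (exponents (k j)) (H j)" for j
  have t: "t j \<in> SOS (k j)" if "j \<in> J" for j
    unfolding t_def
    by (rule gram_poly_SOS, rule psd_on_limit[where G = "\<lambda>n. G j (\<sigma> n)"])
      (use G(1)[OF that] G_lim[OF that] in auto)
  define P where "P = hf_poly f + (\<Sum>j\<in>J. t j * g j)"
  have P_lim: "(\<lambda>n. Poly_Mapping.lookup (rename Inr (q (\<sigma> n))) \<gamma>) \<longlonglongrightarrow> Poly_Mapping.lookup P \<gamma>" for \<gamma>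
  proof -
    have "rename Inr (q n) = hf_poly f + (\<Sum>j\<in>J. gram_poly (exponents (k j)) (G j n) * g j)" for n
      using s(1)[of n] G(2) by (simp add: algebra_simps)
    then show ?thesis
      unfolding P_def t_def using G_lim
      by (auto simp: lookup_add lookup_sum sum_gram_lookup
          intro!: tendsto_add tendsto_sum tendsto_mult tendsto_const)
  qed
  \<comment> \<open>The limit \<open>P\<close> is known only as a polynomial in both blocks of
    variables; \<open>q'\<close> reads off its coefficients at monomials in
    \<open>y\<close>.\<close>
  define q' where "q' = (\<Sum>\<beta>\<in>exponents (2 * r). Poly_Mapping.single \<beta> (Poly_Mapping.lookup P (rename_mono Inr \<beta>)))"
  have lookup_q': "Poly_Mapping.lookup q' \<beta> =
      (if \<beta> \<in> exponents (2 * r) then Poly_Mapping.lookup P (rename_mono Inr \<beta>) else 0)" for \<beta>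
    by (simp add: q'_def lookup_sum lookup_single when_def finite_exponents)
  then have deg_q': "mpoly_deg q' \<le> 2 * r"
    by (auto simp: mpoly_deg_le_iff in_keys_iff split: if_splits)
  have not_in_keys: "Poly_Mapping.lookup (rename Inr p :: ('n + 'm) mpoly) \<gamma> = 0"
    if "mpoly_deg p \<le> 2 * r" "\<gamma> \<notin> rename_mono Inr ` exponents (2 * r)" for p \<gamma>
  proof -
    have "\<gamma> \<notin> Poly_Mapping.keys (rename Inr p :: ('n + 'm) mpoly)"
      using keys_rename[of Inr p] that unfolding mpoly_deg_le_iff by blast
    then show ?thesis
      by (simp add: in_keys_iff)
  qed
  \<comment> \<open>All other coefficients of \<open>P\<close> vanish, being limits of coefficients
    that are zero along the sequence.\<close>
  have "rename Inr q' = P"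
  proof (rule poly_mapping_eqI)
    fix \<gamma>
    show "Poly_Mapping.lookup (rename Inr q') \<gamma> = Poly_Mapping.lookup P \<gamma>"
    proof (cases "\<gamma> \<in> rename_mono Inr ` exponents (2 * r)")
      case True
      then show ?thesis by (auto simp: lookup_q')
    next
      case False
      then show ?thesis
        using P_lim[of \<gamma>] not_in_keys[OF deg_q False] not_in_keys[OF deg_q' False]
        by (simp add: LIMSEQ_const_iff)
    qed
  qed
  then have "rename Inr q' - hf_poly f = (\<Sum>j\<in>J. t j * g j)"
    by (simp add: P_def)
  then have "rename Inr q' - hf_poly f \<in> Q r"
    unfolding quad_module_def using t by (auto simp: J_def g_def k_def)
  then have feas: "q' \<in> primal_feasible f gS gB r"
    using deg_q' by (simp add: primal_feasible_def)
  have "(\<lambda>n. obj r (q (\<sigma> n))) \<longlonglongrightarrow> obj r q'"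
    unfolding primal_objective_def
  proof (intro tendsto_sum tendsto_mult tendsto_const)
    fix \<beta> :: "'m \<Rightarrow>\<^sub>0 nat" assume "\<beta> \<in> exponents (2 * r)"
    then show "(\<lambda>n. Poly_Mapping.lookup (q (\<sigma> n)) \<beta>) \<longlonglongrightarrow> Poly_Mapping.lookup q' \<beta>"
      using P_lim[of "rename_mono Inr \<beta>"] by (simp add: lookup_q')
  qed
  moreover have "(\<lambda>n. opt r + 1 / real (Suc (\<sigma> n))) \<longlonglongrightarrow> opt r + 0"
    using LIMSEQ_subseq_LIMSEQ[OF LIMSEQ_Suc[OF lim_1_over_n] \<sigma>(1)]
    by (intro tendsto_add tendsto_const) (simp add: o_def)
  ultimately have "obj r q' \<le> opt r + 0"
    using q(2) by (intro LIMSEQ_le) (auto intro: less_imp_le)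
  then show ?thesis
    using that opt_le[OF r feas] feas by (simp add: primal_optimal_iff[OF r] antisym)
qed

end

theorem theorem3p3:
  fixes f :: "'m::finite \<Rightarrow> ('n::finite) mpoly"
    and gS :: "'n mpoly list"
    and gB :: "'m mpoly list"
    and S :: "(real ^ 'n) set"
    and B :: "(real ^ 'm) set"
    and F :: "(real ^ 'm) set"
    and NS NB :: nat
  assumes "S = basic_semialg gS"
    and "B = basic_semialg gB"
    and "F = poly_map f ` S"
    and "S \<noteq> {}"
    and "compact S"
    and "compact B"
    and "F \<subseteq> B"
    and "NS > 0" and "ball_poly NS \<in> set gS"
    and "NB > 0" and "ball_poly NB \<in> set gB"
  shows "(\<forall>r\<ge>min_order f gS gB. primal_value f gS gB r = dual_value f gS gB r) \<and>
    (\<forall>r\<ge>min_order f gS gB. \<exists>z. dual_optimal f gS gB r z) \<and>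
    (interior S \<noteq> {} \<longrightarrow>
      (\<forall>r\<ge>min_order f gS gB. \<exists>q. primal_optimal f gS gB r q) \<and>
      (\<forall>q. (\<forall>r\<ge>min_order f gS gB. primal_optimal f gS gB r (q r)) \<longrightarrow>
        (\<forall>r\<ge>min_order f gS gB.
          integrable (lebesgue_on B) (\<lambda>y. \<bar>mpoly_eval (q r) y - h_fun f S y\<bar>)) \<and>
        (\<lambda>r. \<integral>y. \<bar>mpoly_eval (q r) y - h_fun f S y\<bar> \<partial>lebesgue_on B) \<longlonglongrightarrow> 0 \<and>
        (\<forall>r\<ge>min_order f gS gB. F \<subseteq> {y \<in> B. mpoly_eval (q r) y \<ge> 0}) \<and>
        (\<lambda>r. measure lebesgue ({y \<in> B. mpoly_eval (q r) y \<ge> 0} - F)) \<longlonglongrightarrow> 0))"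
proof -
  interpret A: image_approximation f gS gB NS NB
    using assms by unfold_locales auto
  show ?thesis
    unfolding assms(3) unfolding assms(1,2)
  proof (intro conjI impI allI)
    fix r assume r: "min_order f gS gB \<le> r"
    show "primal_value f gS gB r = dual_value f gS gB r" "\<exists>z. dual_optimal f gS gB r z"
      using A.primal_value_eq[OF r] A.dual_value_eq[OF r] by simp_all
    show "\<exists>q. primal_optimal f gS gB r q" if "interior (basic_semialg gS) \<noteq> {}"
      using A.primal_attained[OF that r] by blast
  next
    fix q assume q: "\<forall>r\<ge>min_order f gS gB. primal_optimal f gS gB r (q r)"
    show "integrable (lebesgue_on A.B) (\<lambda>y. \<bar>mpoly_eval (q r) y - A.h y\<bar>)" for r
      by (rule A.integrable_diff_h)
    show "(\<lambda>r. \<integral>y. \<bar>mpoly_eval (q r) y - A.h y\<bar> \<partial>lebesgue_on A.B) \<longlonglongrightarrow> 0"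
      by (rule A.L1_convergence[OF q])
    show "A.F \<subseteq> {y \<in> A.B. 0 \<le> mpoly_eval (q r) y}" if "min_order f gS gB \<le> r" for r
      using q that by (intro A.image_subset_superlevel[where r = r]) (simp add: primal_optimal_def)
    show "(\<lambda>r. measure lebesgue ({y \<in> A.B. 0 \<le> mpoly_eval (q r) y} - A.F)) \<longlonglongrightarrow> 0"
      by (rule A.volume_convergence[OF q])
  qed
qed

end
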